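(* For $N\in\mathbb{N}$, $N\ge1$, let $\Omega=(0,1)^2$, let $\mathcal{T}=\mathcal{T}_N$ be the triangulation of $\overline\Omega$ obtained by subdividing $[0,1]^2$ into $4N^2$ squares with sides of length $\frac{1}{2N}$ and dividing each of these squares into two triangles by its diagonal from the top-left corner to the bottom-right corner, and let $a=a_N$ be the checkerboard coefficient on these $4N^2$ squares which equals $\frac1{N^2}$ on the black squares and $1$ on the white squares, the top-left square being black. For measurable $\omega\subset\Omega$ put $|||v|||_{N,\omega}=\|a_N^{1/2}\nabla v\|_{L^2(\omega)}$. Then there exist constants $c,C>0$ such that for every $N$ there is a function $U_N\in H^1_0(\Omega)$ with $$\inf_{v\in S^{1,0}(\mathcal{T}_N)\cap H^1_0(\Omega)}|||U_N-v|||_{N,\Omega}^2\ge c$$ and $$\sum_{z\in\mathcal{V}_\Omega}\ \inf_{v_z\in (S^{1,0}(\mathcal{T}_N)\cap H^1_0(\Omega))|_{\omega_z}}|||U_N-v_z|||_{N,\omega_z}^2\le \frac{C}{N}.$$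
   Context: $S^{1,0}(\mathcal{T}_N)$ is the space of continuous functions on $\overline\Omega$ that are affine on each triangle of $\mathcal{T}_N$. $\mathcal{V}_\Omega$ is the set of vertices of $\mathcal{T}_N$ lying in the open square $\Omega$. For $z\in\mathcal{V}_\Omega$, $\omega_z$ is the union of all triangles of $\mathcal{T}_N$ having $z$ as a vertex. $(S^{1,0}(\mathcal{T}_N)\cap H^1_0(\Omega))|_{\omega_z}$ is the space of restrictions to $\omega_z$ of functions in $S^{1,0}(\mathcal{T}_N)\cap H^1_0(\Omega)$. Checkerboard means that squares sharing an edge have different colours. *)

theory Defs
  imports "HOL-Analysis.Analysis"
begin

section \<open>Sobolev spaces on open sets\<close>

text \<open>
  Elements of $L^2$, $H^1$, $H^1_0$ are represented by functions on the whole space; only their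
  values on the domain \<open>D\<close> (up to null sets) matter.
\<close>

primrec Ck :: "nat \<Rightarrow> ('a::euclidean_space \<Rightarrow> real) \<Rightarrow> bool" where
  "Ck 0 f \<longleftrightarrow> continuous_on UNIV f"
| "Ck (Suc k) f \<longleftrightarrow> (\<forall>x. f differentiable (at x)) \<and>
     (\<forall>b\<in>Basis. Ck k (\<lambda>x. frechet_derivative f (at x) b))"

definition test_functions :: "('a::euclidean_space) set \<Rightarrow> ('a \<Rightarrow> real) set" where
  "test_functions D =
     {\<phi>. (\<forall>k. Ck k \<phi>) \<and> compact (closure {x. \<phi> x \<noteq> 0}) \<and> closure {x. \<phi> x \<noteq> 0} \<subseteq> D}"

definition loc_integrable :: "('a::euclidean_space) set \<Rightarrow> ('a \<Rightarrow> 'b::euclidean_space) \<Rightarrow> bool" where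
  "loc_integrable D f \<longleftrightarrow> (\<forall>K. compact K \<and> K \<subseteq> D \<longrightarrow> f absolutely_integrable_on K)"

definition has_weak_grad :: "('a::euclidean_space) set \<Rightarrow> ('a \<Rightarrow> real) \<Rightarrow> ('a \<Rightarrow> 'a) \<Rightarrow> bool" where
  "has_weak_grad D v g \<longleftrightarrow> loc_integrable D v \<and> loc_integrable D g \<and>
     (\<forall>\<phi>\<in>test_functions D. \<forall>b\<in>Basis.
        (LINT x|lebesgue_on D. v x * frechet_derivative \<phi> (at x) b)
          = - (LINT x|lebesgue_on D. (g x \<bullet> b) * \<phi> x))"

text \<open>A weak gradient is unique up to null sets, so \<open>SOME\<close> picks a representative.\<close>

definition weak_grad :: "('a::euclidean_space) set \<Rightarrow> ('a \<Rightarrow> real) \<Rightarrow> 'a \<Rightarrow> 'a" where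
  "weak_grad D v = (SOME g. has_weak_grad D v g)"

definition L2 :: "('a::euclidean_space) set \<Rightarrow> ('a \<Rightarrow> 'b::euclidean_space) set" where
  "L2 D = {f \<in> borel_measurable (lebesgue_on D). integrable (lebesgue_on D) (\<lambda>x. (norm (f x))\<^sup>2)}"

definition L2_norm :: "('a::euclidean_space) set \<Rightarrow> ('a \<Rightarrow> 'b::euclidean_space) \<Rightarrow> real" where
  "L2_norm D f = sqrt (LINT x|lebesgue_on D. (norm (f x))\<^sup>2)"

definition H1 :: "('a::euclidean_space) set \<Rightarrow> ('a \<Rightarrow> real) set" where
  "H1 D = {v \<in> L2 D. \<exists>g\<in>L2 D. has_weak_grad D v g}"

definition H1_norm :: "('a::euclidean_space) set \<Rightarrow> ('a \<Rightarrow> real) \<Rightarrow> real" where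
  "H1_norm D v = sqrt ((L2_norm D v)\<^sup>2 + (L2_norm D (weak_grad D v))\<^sup>2)"

definition H10 :: "('a::euclidean_space) set \<Rightarrow> ('a \<Rightarrow> real) set" where
  "H10 D = {v \<in> H1 D. \<exists>\<phi>. (\<forall>n. \<phi> n \<in> test_functions D) \<and>
                (\<lambda>n. H1_norm D (\<lambda>x. v x - \<phi> n x)) \<longlonglongrightarrow> 0}"


section \<open>The mesh and the checkerboard coefficient\<close>

definition Omega :: "(real \<times> real) set" where
  "Omega = {0<..<1} \<times> {0<..<1}"

text \<open>Grid points; \<open>i\<close> counts columns from the left and \<open>j\<close> rows from the bottom.\<close>

definition gridpt :: "nat \<Rightarrow> nat \<Rightarrow> nat \<Rightarrow> real \<times> real" where
  "gridpt N i j = (real i / (2 * real N), real j / (2 * real N))"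

definition square :: "nat \<Rightarrow> nat \<Rightarrow> nat \<Rightarrow> (real \<times> real) set" where
  "square N i j = cbox (gridpt N i j) (gridpt N (Suc i) (Suc j))"

text \<open>
  A triangle is given by its set of three vertices; the closed triangle is the convex hull.
  Both triangles of a square contain its top-left and its bottom-right corner.
\<close>

definition mesh :: "nat \<Rightarrow> (real \<times> real) set set" where
  "mesh N = (\<Union>i<2*N. \<Union>j<2*N.
     {{gridpt N i (Suc j), gridpt N (Suc i) j, gridpt N i j},
      {gridpt N i (Suc j), gridpt N (Suc i) j, gridpt N (Suc i) (Suc j)}})"

definition inner_vertices :: "nat \<Rightarrow> (real \<times> real) set" where
  "inner_vertices N = \<Union>(mesh N) \<inter> Omega"

definition patch :: "nat \<Rightarrow> real \<times> real \<Rightarrow> (real \<times> real) set" where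
  "patch N z = (\<Union>V\<in>{V \<in> mesh N. z \<in> V}. convex hull V)"

definition S10 :: "nat \<Rightarrow> (real \<times> real \<Rightarrow> real) set" where
  "S10 N = {v. continuous_on (closure Omega) v \<and>
     (\<forall>V\<in>mesh N. \<exists>p q. \<forall>x\<in>convex hull V. v x = p \<bullet> x + q)}"

definition black :: "nat \<Rightarrow> nat \<Rightarrow> bool" where
  "black i j \<longleftrightarrow> odd (i + j)"

lemma black_top_left: "N \<ge> 1 \<Longrightarrow> black 0 (2 * N - 1)"
  by (simp add: black_def)

lemma black_neighbour: "black (Suc i) j \<longleftrightarrow> \<not> black i j" "black i (Suc j) \<longleftrightarrow> \<not> black i j"
  by (simp_all add: black_def)

text \<open>The values on the edges of the squares, a null set, are immaterial.\<close>

definition coeff :: "nat \<Rightarrow> real \<times> real \<Rightarrow> real" where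
  "coeff N x = (if \<exists>i<2*N. \<exists>j<2*N. black i j \<and> x \<in> interior (square N i j)
                then 1 / (real N)\<^sup>2 else 1)"

text \<open>
  \<open>energy_norm N D \<omega> v\<close> is the norm $\|a_N^{1/2}\nabla v\|_{L^2(\omega)}$ of a function
  \<open>v\<close> living on the open set \<open>D\<close>, in which the weak gradient is taken; \<open>\<omega>\<close> is
  contained in \<open>D\<close> up to a null set. For \<open>v\<close> given only on a patch, \<open>D\<close> is the interior of
  the patch.
\<close>

definition energy_norm ::
  "nat \<Rightarrow> (real \<times> real) set \<Rightarrow> (real \<times> real) set \<Rightarrow> (real \<times> real \<Rightarrow> real) \<Rightarrow> real" where
  "energy_norm N D \<omega> v = L2_norm \<omega> (\<lambda>x. sqrt (coeff N x) *\<^sub>R weak_grad D v x)"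

lemma finite_inner_vertices: "finite (inner_vertices N)"
  by (auto simp: inner_vertices_def mesh_def)

end

theory Submission
  imports Defs
begin

text \<open>
  Why the estimator fails. Write $h = 1/(2N)$ and call a vertex \<^emph>\<open>even\<close> if the sum of its two grid indices
  is even. At an even vertex the lower left and the upper right squares are white and touch each other only
  at this vertex. A discrete function is continuous there, but in $H^1$ a jump of height $J$
  between the two white squares costs only about $J^2/N$: the transition is made in the two black
  sectors at the cost of $N^{-2}$ times a logarithm, and the continuity at the vertex is restored inside a disc of
  radius $e^{-N} h$.

  The function \<open>witness N\<close> is a sawtooth. On every white square its gradient is close to $(1,1)$, and
  at every interior even vertex it jumps by about $-2h$, so that it vanishes on the boundary of each
  diamond $|x| + |y| \le h$ around an even vertex (with a slightly smaller diamond in place of this one, for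
  a compact support in \<open>Omega\<close>). In scaled coordinates it is a sum of translates of
  \[ \psi(x,y) = -(x+y)\,\frac{(\tau - r)^+}{r}\,\Bigl(1 + \frac{\ln r}{N}\Bigr)^+, \qquad r = |x|+|y|. \]
  With the coefficient as weight, $|\nabla\psi - (1,1)|^2$ is bounded by a function of $r$ whose integral over the
  diamond is $O(1/N)$ (\<open>err_white\<close>, \<open>err_black\<close>, \<open>err_l1_integral\<close>).

  Local errors: on a patch away from the boundary there is a discrete function with zero boundary values that equals
  $x + y$ there (\<open>deep_interp_patch\<close>), so the local error is $O(N^{-3})$ (\<open>deep_patch_energy\<close>). On
  the $O(N)$ patches near the boundary the zero function gives $O(N^{-2})$ (\<open>patch_energy\<close>). The
  sum of all is $O(1/N)$.

  Global error: the functional $v \mapsto \int_{\mathrm{white}} (1,1)\cdot\nabla v$ vanishes on the discrete space with zero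
  boundary values, because every interior nodal basis function and the union of the white squares are both symmetric
  about the vertex (\<open>white_integral_hat\<close>). On the sawtooth it is bounded below by a positive constant
  (\<open>white_flux\<close>, \<open>white_integral_witness\<close>). Since $a = 1$ on the white squares, this bounds the global error
  from below (\<open>global_error\<close>).

  What has to be provided about Sobolev functions is: weak gradients are unique
  (\<open>has_weak_grad_unique\<close>); piecewise differentiable Lipschitz functions have their pointwise gradient as weak gradient
  (\<open>lip_grad_has_weak_grad\<close>) and lie in \<open>H10\<close> if they have compact support (\<open>lip_grad_in_H10\<close>, by
  mollification); and a continuous representative of a function in \<open>H10 Omega\<close> vanishes on the boundary
  (\<open>H10_zero_on_edges\<close>).
\<close>

section \<open>Smooth functions\<close>

lemma Ck_Suc_D: "Ck (Suc k) f \<Longrightarrow> Ck k f"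
proof (induction k arbitrary: f)
  case 0
  then show ?case
    by (auto simp: continuous_on_eq_continuous_within intro: differentiable_imp_continuous_within)
next
  case (Suc k)
  then show ?case by (metis Ck.simps(2))
qed

lemma Ck_const: "Ck k (\<lambda>x::'a::euclidean_space. c)"
proof (induction k arbitrary: c)
  case (Suc k)
  have "frechet_derivative (\<lambda>x::'a. c) (at x) = (\<lambda>h. 0)" for x
    by (rule frechet_derivative_at[symmetric]) (rule has_derivative_const)
  then show ?case using Suc by simp
qed (simp add: continuous_on_const)

lemma Ck_inner: "Ck k (\<lambda>x::'a::euclidean_space. x \<bullet> i)"
proof (cases k)
  case (Suc n)
  have "frechet_derivative (\<lambda>x::'a. x \<bullet> i) (at x) = (\<lambda>h. h \<bullet> i)" for x
    by (rule frechet_derivative_at[symmetric]) (intro derivative_intros)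
  then show ?thesis using Suc by (auto intro: Ck_const[of n "_ \<bullet> i"])
qed (auto intro!: continuous_intros)

lemma Ck_add:
  "Ck k f \<Longrightarrow> Ck k g \<Longrightarrow> Ck k (\<lambda>x::'a::euclidean_space. f x + g x)"
proof (induction k arbitrary: f g)
  case (Suc k)
  then have "frechet_derivative (\<lambda>x. f x + g x) (at x)
      = (\<lambda>h. frechet_derivative f (at x) h + frechet_derivative g (at x) h)" for x
    by (intro frechet_derivative_at[symmetric] has_derivative_add) (auto simp: frechet_derivative_works)
  then show ?case using Suc by simp
qed (auto intro: continuous_on_add)

lemma Ck_mult:
  "Ck k f \<Longrightarrow> Ck k g \<Longrightarrow> Ck k (\<lambda>x::'a::euclidean_space. f x * g x)"
proof (induction k arbitrary: f g)
  case (Suc k)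
  then have "frechet_derivative (\<lambda>x. f x * g x) (at x)
      = (\<lambda>h. f x * frechet_derivative g (at x) h + frechet_derivative f (at x) h * g x)" for x
    by (intro frechet_derivative_at[symmetric] has_derivative_mult) (auto simp: frechet_derivative_works)
  then show ?case using Suc Ck_Suc_D[OF Suc.prems(1)] Ck_Suc_D[OF Suc.prems(2)]
    by (auto intro!: Ck_add Suc.IH)
qed (auto intro: continuous_on_mult)

lemma Ck_prod:
  "finite I \<Longrightarrow> (\<And>i. i \<in> I \<Longrightarrow> Ck k (f i)) \<Longrightarrow> Ck k (\<lambda>x::'a::euclidean_space. \<Prod>i\<in>I. f i x)"
  by (induction I rule: finite_induct) (auto intro!: Ck_const Ck_mult)

lemma Ck_compose:
  assumes "Ck k h" "Ck k f"
  shows "Ck k (\<lambda>x::'a::euclidean_space. h (f x))"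
  using assms
proof (induction k arbitrary: h f)
  case 0
  then show ?case using continuous_on_compose2[of UNIV h UNIV f] by simp
next
  case (Suc k)
  have *: "frechet_derivative (\<lambda>x. h (f x)) (at x)
      = (\<lambda>d. frechet_derivative h (at (f x)) 1 * frechet_derivative f (at x) d)" for x
  proof -
    have "((\<lambda>x. h (f x)) has_derivative
        (\<lambda>d. frechet_derivative h (at (f x)) (frechet_derivative f (at x) d))) (at x)"
      using Suc.prems has_derivative_compose[of f "frechet_derivative f (at x)" x UNIV h
          "frechet_derivative h (at (f x))"]
      by (auto simp: frechet_derivative_works)
    moreover have "linear (frechet_derivative h (at (f x)))"
      using Suc.prems by (auto intro: linear_frechet_derivative)
    then have "frechet_derivative h (at (f x)) t = frechet_derivative h (at (f x)) 1 * t" for t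
      using linear_cmul[of "frechet_derivative h (at (f x))" t 1] by simp
    ultimately show ?thesis by (metis (no_types, lifting) ext frechet_derivative_at)
  qed
  have "\<forall>x. (\<lambda>x. h (f x)) differentiable (at x)"
    using Suc.prems differentiable_chain_at[of f _ h] by (simp add: o_def)
  then show ?case
    using Suc.prems Ck_Suc_D[OF Suc.prems(2)] Suc.IH[of "\<lambda>y. frechet_derivative h (at y) 1" f]
    by (auto simp: * intro!: Ck_mult)
qed

text \<open>The function $e^{-1/t}$, extended by zero, is smooth: its derivatives stay in the family
  of all $p(1/t)\,e^{-1/t}$ with polynomials $p$.\<close>

definition poly_exp :: "real poly \<Rightarrow> real \<Rightarrow> real" where
  "poly_exp p t = (if t > 0 then poly p (1 / t) * exp (- (1 / t)) else 0)"

lemma poly_div_exp_tendsto_0: "((\<lambda>x::real. poly p x / exp x) \<longlongrightarrow> 0) at_top"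
proof -
  have "((\<lambda>x::real. \<Sum>i\<le>degree p. Polynomial.coeff p i * (x ^ i / exp x)) \<longlongrightarrow> (\<Sum>i\<le>degree p. Polynomial.coeff p i * 0)) at_top"
    by (intro tendsto_sum tendsto_mult tendsto_const tendsto_power_div_exp_0)
  then show ?thesis by (simp add: poly_altdef sum_divide_distrib)
qed

lemma has_derivative_poly_exp:
  "(poly_exp p has_real_derivative poly_exp (monom 1 2 * (p - pderiv p)) t) (at t)"
proof -
  consider "t > 0" | "t < 0" | "t = 0" by linarith
  then show ?thesis
  proof cases
    case 1
    have "((\<lambda>t. poly p (1/t) * exp (-(1/t))) has_real_derivative
        poly_exp (monom 1 2 * (p - pderiv p)) t) (at t)"
      using 1 by (auto intro!: derivative_eq_intros DERIV_chain2[OF poly_DERIV]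
          simp: poly_exp_def poly_monom field_simps power2_eq_square)
    then show ?thesis
      by (rule has_field_derivative_transform_within_open[where S="{0<..}"])
        (use 1 in \<open>auto simp: poly_exp_def\<close>)
  next
    case 2
    have "((\<lambda>t. 0) has_real_derivative poly_exp (monom 1 2 * (p - pderiv p)) t) (at t)"
      using 2 by (simp add: poly_exp_def)
    then show ?thesis
      by (rule has_field_derivative_transform_within_open[where S="{..<0}"])
        (use 2 in \<open>auto simp: poly_exp_def\<close>)
  next
    case 3
    have "((\<lambda>x. poly (monom 1 1 * p) x / exp x) \<longlongrightarrow> 0) at_top"
      by (rule poly_div_exp_tendsto_0)
    then have "((\<lambda>h. poly (monom 1 1 * p) (inverse h) / exp (inverse h)) \<longlongrightarrow> 0) (at_right 0)"
      by (rule filterlim_compose[OF _ filterlim_inverse_at_top_right])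
    then have "((\<lambda>h. (poly_exp p (0 + h) - poly_exp p 0) / h) \<longlongrightarrow> 0) (at_right 0)"
      by (rule Lim_transform_eventually)
        (auto simp: eventually_at_right_field poly_exp_def poly_monom exp_minus field_simps intro!: exI[of _ 1])
    moreover have "((\<lambda>h. (poly_exp p (0 + h) - poly_exp p 0) / h) \<longlongrightarrow> 0) (at_left 0)"
      by (rule Lim_transform_eventually[OF tendsto_const])
        (auto simp: eventually_at_left_field poly_exp_def intro!: exI[of _ "-1"])
    ultimately have "((\<lambda>h. (poly_exp p (0 + h) - poly_exp p 0) / h) \<longlongrightarrow> 0) (at 0)"
      by (simp add: filterlim_split_at)
    then show ?thesis using 3 by (simp add: DERIV_def poly_exp_def)
  qed
qed

lemma Ck_poly_exp: "Ck k (poly_exp p)"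
proof (induction k arbitrary: p)
  case 0
  show ?case using has_derivative_poly_exp by (auto intro!: DERIV_continuous_on)
next
  case (Suc k)
  have "frechet_derivative (poly_exp p) (at t) 1 = poly_exp (monom 1 2 * (p - pderiv p)) t" for t
    using frechet_derivative_at[OF has_derivative_poly_exp[of p t, unfolded has_field_derivative_def]]
    by (metis mult.right_neutral)
  moreover have "poly_exp p differentiable (at t)" for t
    using has_derivative_poly_exp[of p t] unfolding has_field_derivative_def by (rule differentiableI)
  ultimately show ?case using Suc by simp
qed

text \<open>The function $e^{-1/t}$ itself.\<close>

definition exp_inv :: "real \<Rightarrow> real" where
  "exp_inv = poly_exp 1"

lemma exp_inv: "exp_inv t = (if t > 0 then exp (- (1 / t)) else 0)"
  by (simp add: exp_inv_def poly_exp_def)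

lemma Ck_exp_inv: "Ck k exp_inv"
  by (simp add: exp_inv_def Ck_poly_exp)

text \<open>A smooth function that is positive exactly on the open box with corners \<open>a\<close> and \<open>b\<close>.\<close>

definition box_bump :: "'a::euclidean_space \<Rightarrow> 'a \<Rightarrow> 'a \<Rightarrow> real" where
  "box_bump a b x = (\<Prod>i\<in>Basis. exp_inv (x \<bullet> i - a \<bullet> i) * exp_inv (b \<bullet> i - x \<bullet> i))"

lemma Ck_box_bump: "Ck k (box_bump a b)"
proof -
  have 1: "Ck k (\<lambda>x::'a. x \<bullet> i + (- (a \<bullet> i)))" for i a
    by (rule Ck_add[OF Ck_inner Ck_const])
  have 2: "Ck k (\<lambda>x::'a. b \<bullet> i + (-1) * (x \<bullet> i))" for i
    by (rule Ck_add[OF Ck_const Ck_mult[OF Ck_const Ck_inner]])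
  have "Ck k (\<lambda>x::'a. \<Prod>i\<in>Basis. exp_inv (x \<bullet> i + (- (a \<bullet> i))) * exp_inv (b \<bullet> i + (-1) * (x \<bullet> i)))"
    by (intro Ck_prod Ck_mult Ck_compose[OF Ck_exp_inv] 1 2) simp
  then show ?thesis by (simp add: box_bump_def[abs_def])
qed

lemma box_bump_nonneg: "box_bump a b x \<ge> 0"
  by (auto simp: box_bump_def exp_inv intro!: prod_nonneg)

lemma box_bump_pos_iff: "box_bump a b x > 0 \<longleftrightarrow> x \<in> box a b"
proof
  assume "box_bump a b x > 0"
  then have "box_bump a b x \<noteq> 0" by simp
  then have "\<forall>i\<in>Basis. exp_inv (x \<bullet> i - a \<bullet> i) * exp_inv (b \<bullet> i - x \<bullet> i) \<noteq> 0"
    by (simp add: box_bump_def)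
  then show "x \<in> box a b" by (auto simp: mem_box exp_inv split: if_splits)
next
  assume "x \<in> box a b"
  then show "box_bump a b x > 0"
    by (auto simp: box_bump_def mem_box exp_inv intro!: prod_pos)
qed

lemma box_bump_eq_0: "x \<notin> box a b \<Longrightarrow> box_bump a b x = 0"
  using box_bump_pos_iff[of a b x] box_bump_nonneg[of a b x] by linarith

lemma closure_nonzero_subset:
  assumes "\<And>x. x \<notin> A \<Longrightarrow> f x = 0" "closed A"
  shows "closure {x. f x \<noteq> (0::real)} \<subseteq> A"
  by (rule closure_minimal) (use assms in auto)

lemma test_functionsI:
  assumes "\<And>k. Ck k f" "compact K" "K \<subseteq> D" "\<And>x. x \<notin> K \<Longrightarrow> f x = 0"
  shows "f \<in> test_functions D"
proof -
  have "closure {x. f x \<noteq> 0} \<subseteq> K"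
    using closure_nonzero_subset[of K f] assms compact_imp_closed by blast
  then show ?thesis
    using assms compact_Int_closed[of K "closure {x. f x \<noteq> 0}"]
    by (auto simp: test_functions_def Int_absorb1)
qed

lemma box_bump_test_functions:
  assumes "cbox a b \<subseteq> D"
  shows "box_bump a b \<in> test_functions D"
  by (rule test_functionsI[OF Ck_box_bump compact_cbox assms])
    (use box_subset_cbox box_bump_eq_0 in blast)

text \<open>The indicator of an open box is a bounded pointwise limit of test functions.\<close>

lemma indicator_box_limit:
  assumes "cbox a b \<subseteq> D"
  shows "\<exists>\<theta>. (\<forall>n. \<theta> n \<in> test_functions D \<and> (\<forall>x. 0 \<le> \<theta> n x \<and> \<theta> n x \<le> indicator (box a b) x))
           \<and> (\<forall>x. (\<lambda>n. \<theta> n x) \<longlonglongrightarrow> indicator (box a b) x)"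
proof (intro exI conjI allI)
  \<comment> \<open>As the argument tends to infinity inside the box, $e^{-1/t}$ tends to one; outside it stays zero.\<close>
  define \<theta> where "\<theta> n x = exp_inv (real (Suc n) * box_bump a b x)" for n x
  fix n x
  have 0: "\<theta> n x = 0" if "x \<notin> box a b" for n x
    using box_bump_eq_0[OF that] by (simp add: \<theta>_def exp_inv)
  have "Ck k (\<lambda>x. exp_inv (real (Suc n) * box_bump a b x))" for k
    by (intro Ck_compose[OF Ck_exp_inv] Ck_mult Ck_const Ck_box_bump)
  then have "Ck k (\<theta> n)" for k by (simp add: \<theta>_def[abs_def])
  then show "\<theta> n \<in> test_functions D"
    by (rule test_functionsI[OF _ compact_cbox assms]) (use 0 box_subset_cbox in blast)
  show "0 \<le> \<theta> n x" by (simp add: \<theta>_def exp_inv)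
  show "\<theta> n x \<le> indicator (box a b) x"
    using 0[of x n] by (auto simp: indicator_def \<theta>_def exp_inv)
  show "(\<lambda>n. \<theta> n x) \<longlonglongrightarrow> indicator (box a b) x"
  proof (cases "x \<in> box a b")
    case True
    then have pos: "box_bump a b x > 0" by (simp add: box_bump_pos_iff)
    have "(\<lambda>n. exp (- (1 / box_bump a b x * inverse (real (Suc n))))) \<longlonglongrightarrow> exp (- (1 / box_bump a b x * 0))"
      by (intro tendsto_intros LIMSEQ_inverse_real_of_nat)
    moreover have "\<theta> n x = exp (- (1 / box_bump a b x * inverse (real (Suc n))))" for n
      using pos by (simp add: \<theta>_def exp_inv divide_inverse mult.commute)
    ultimately show ?thesis using True by simp
  qed (use 0 in simp)
qed

lemma test_functionsD:
  assumes "\<phi> \<in> test_functions D"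
  shows "compact (closure {x. \<phi> x \<noteq> 0})" "closure {x. \<phi> x \<noteq> 0} \<subseteq> D" "Ck k \<phi>"
  using assms unfolding test_functions_def by blast+

section \<open>Uniqueness of weak gradients\<close>

text \<open>The positive and the negative part of \<open>f\<close> are densities of two finite measures that agree on all
  boxes, a generator of the Borel sets that is stable under intersection.\<close>

lemma AE_zero_if_box_integrals_zero:
  fixes f :: "'a::euclidean_space \<Rightarrow> real"
  assumes f: "integrable lebesgue f"
    and box: "\<And>a b. (LINT x|lebesgue. indicator (box a b) x * f x) = 0"
  shows "AE x in lebesgue. f x = 0"
proof -
  obtain g where g[measurable]: "g \<in> borel_measurable lborel" and fg: "AE x in lborel. f x = g x"
    using completion_ex_borel_measurable_real[of f lborel] f by auto
  have fg': "AE x in lebesgue. f x = g x"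
    using fg by (rule AE_completion)
  have "integrable lebesgue g"
    by (rule integrable_cong_AE_imp[OF f]) (use fg' in \<open>auto intro: measurable_completion\<close>)
  then have gi: "integrable lborel g"
    by (simp add: integrable_completion)
  have gbox: "(LINT x|lborel. indicator (box a b) x * g x) = 0" for a b
  proof -
    have "(LINT x|lborel. indicator (box a b) x * g x) = (LINT x|lebesgue. indicator (box a b) x * g x)"
      by (rule integral_completion[symmetric]) simp
    also have "\<dots> = (LINT x|lebesgue. indicator (box a b) x * f x)"
    proof (rule integral_cong_AE)
      show "(\<lambda>x. indicator (box a b) x * f x) \<in> borel_measurable lebesgue"
        using f by (intro borel_measurable_times borel_measurable_indicator) auto
      show "(\<lambda>x. indicator (box a b) x * g x) \<in> borel_measurable lebesgue"
        by (intro measurable_completion) simp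
      show "AE x in lebesgue. indicator (box a b) x * g x = indicator (box a b) x * f x"
        using fg' by eventually_elim simp
    qed
    finally show ?thesis using box by simp
  qed
  define M1 where "M1 = density lborel (\<lambda>x. ennreal (g x))"
  define M2 where "M2 = density lborel (\<lambda>x. ennreal (- g x))"
  have fin1: "emeasure M1 A \<noteq> \<infinity>" for A
  proof -
    have "emeasure M1 A \<le> emeasure M1 (space M1)" by (rule emeasure_space)
    also have "\<dots> = (\<integral>\<^sup>+x. ennreal (g x) \<partial>lborel)" by (simp add: M1_def emeasure_density)
    also have "\<dots> < \<infinity>" using gi by (simp add: real_integrable_def less_top)
    finally show ?thesis by simp
  qed
  have "M1 = M2"
  proof (rule measure_eqI_generator_eq)
    let ?E = "range (\<lambda>(a, b). box a b::'a set)"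
    let ?A = "\<lambda>n::nat. box (- (real n *\<^sub>R One)) (real n *\<^sub>R One) :: 'a set"
    show "Int_stable ?E" by (auto simp: Int_stable_def box_Int_box)
    show "?E \<subseteq> Pow UNIV" "sets M1 = sigma_sets UNIV ?E" "sets M2 = sigma_sets UNIV ?E"
      by (simp_all add: borel_eq_box M1_def M2_def)
    show "range ?A \<subseteq> ?E" "(\<Union>i. ?A i) = UNIV"
      unfolding UN_box_eq_UNIV by auto
    show "emeasure M1 (?A i) \<noteq> \<infinity>" for i by (rule fin1)
    fix X assume "X \<in> ?E"
    then obtain a b where X: "X = box a b" by auto
    let ?g = "\<lambda>x. indicator X x * g x"
    have int: "integrable lborel ?g"
      unfolding X using integrable_mult_indicator[OF _ gi, of "box a b"] by simp
    have 1: "(\<integral>\<^sup>+x. ennreal (?g x) \<partial>lborel) = emeasure M1 X"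
      by (auto simp: M1_def emeasure_density X indicator_def intro!: nn_integral_cong)
    have 2: "(\<integral>\<^sup>+x. ennreal (- ?g x) \<partial>lborel) = emeasure M2 X"
      by (auto simp: M2_def emeasure_density X indicator_def intro!: nn_integral_cong)
    have "enn2real (emeasure M1 X) = enn2real (emeasure M2 X)"
      using real_lebesgue_integral_def[OF int] gbox[of a b] unfolding 1[symmetric] 2[symmetric]
      by (simp add: X)
    then show "emeasure M1 X = emeasure M2 X"
      using int unfolding real_integrable_def 1 2
      by (metis ennreal_enn2real less_top infinity_ennreal_def)
  qed
  then have "AE x in lborel. ennreal (g x) = ennreal (- g x)"
    unfolding M1_def M2_def by (intro sigma_finite_measure.density_unique[OF sigma_finite_lborel]) auto
  then have "AE x in lborel. f x = 0"
    using fg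
  proof eventually_elim
    case (elim x)
    then show ?case by (cases "g x \<ge> 0") (auto simp: ennreal_neg)
  qed
  then show ?thesis by (rule AE_completion)
qed

lemma LINT_lebesgue_on:
  fixes f :: "'a::euclidean_space \<Rightarrow> real"
  assumes "S \<in> sets lebesgue"
  shows "(LINT x|lebesgue_on S. f x) = (LINT x|lebesgue. indicator S x * f x)"
  using integral_restrict_space[of S lebesgue f] assms by simp

text \<open>The fundamental lemma of the calculus of variations.\<close>

lemma fundamental_lemma:
  fixes f :: "'a::euclidean_space \<Rightarrow> real"
  assumes D: "open D" and f: "loc_integrable D f"
    and test: "\<And>\<phi>. \<phi> \<in> test_functions D \<Longrightarrow> (LINT x|lebesgue_on D. f x * \<phi> x) = 0"
  shows "AE x in lebesgue. x \<in> D \<longrightarrow> f x = 0"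
proof -
  have Dm: "D \<in> sets lebesgue" using D by simp
  \<comment> \<open>Test functions approximating the indicator of a box show that \<open>f\<close> integrates to zero over the box.\<close>
  have box0: "(LINT x|lebesgue. indicator (box c d) x * f x) = 0" if cd: "cbox c d \<subseteq> D" for c d
  proof -
    obtain \<theta> where \<theta>: "\<And>n. \<theta> n \<in> test_functions D"
      and bd: "\<And>n x. 0 \<le> \<theta> n x" "\<And>n x. \<theta> n x \<le> indicator (box c d) x"
      and lim: "\<And>x. (\<lambda>n. \<theta> n x) \<longlonglongrightarrow> indicator (box c d) x"
      using indicator_box_limit[OF cd] by metis
    have int: "integrable lebesgue (\<lambda>x. indicator (cbox c d) x * f x)"
      using f cd by (auto simp: loc_integrable_def set_integrable_def)
    have \<theta>c: "continuous_on UNIV (\<theta> n)" for n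
      using test_functionsD(3)[OF \<theta>, of 0] by simp
    have \<theta>m: "\<theta> n \<in> borel_measurable lebesgue" for n
      using borel_measurable_continuous_onI[OF \<theta>c[of n]] by (simp add: measurable_completion)
    have ind: "indicat_real (box c d) x * indicator (cbox c d) x = indicator (box c d) x" for x
      using box_subset_cbox[of c d] by (auto simp: indicator_def)
    have \<theta>cb: "\<theta> n x * indicator (cbox c d) x = \<theta> n x" for n x
      using bd[of n x] box_subset_cbox[of c d] by (cases "x \<in> box c d") (auto simp: indicator_def)
    have "(\<lambda>n. LINT x|lebesgue. \<theta> n x * (indicator (cbox c d) x * f x)) \<longlonglongrightarrow>
        (LINT x|lebesgue. indicator (box c d) x * (indicator (cbox c d) x * f x))"
    proof (rule integral_dominated_convergence[where w="\<lambda>x. norm (indicator (cbox c d) x * f x)"])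
      show "(\<lambda>x. indicator (box c d) x * (indicator (cbox c d) x * f x)) \<in> borel_measurable lebesgue"
        by (intro borel_measurable_times borel_measurable_indicator borel_measurable_integrable[OF int]) simp
      show "(\<lambda>x. \<theta> n x * (indicator (cbox c d) x * f x)) \<in> borel_measurable lebesgue" for n
        by (intro borel_measurable_times \<theta>m borel_measurable_integrable[OF int])
      show "integrable lebesgue (\<lambda>x. norm (indicator (cbox c d) x * f x))"
        using int by (rule integrable_norm)
      show "AE x in lebesgue. (\<lambda>n. \<theta> n x * (indicator (cbox c d) x * f x)) \<longlonglongrightarrow>
          indicator (box c d) x * (indicator (cbox c d) x * f x)"
        using lim by (intro AE_I2 tendsto_mult tendsto_const) auto
      show "AE x in lebesgue. norm (\<theta> n x * (indicator (cbox c d) x * f x)) \<le> norm (indicator (cbox c d) x * f x)" for n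
      proof (rule AE_I2)
        fix x
        have "\<bar>\<theta> n x\<bar> \<le> 1" using bd[of n x] by (cases "x \<in> box c d") auto
        then show "norm (\<theta> n x * (indicator (cbox c d) x * f x)) \<le> norm (indicator (cbox c d) x * f x)"
          by (simp add: abs_mult mult_left_le_one_le)
      qed
    qed
    moreover have "(LINT x|lebesgue. \<theta> n x * (indicator (cbox c d) x * f x)) = 0" for n
    proof -
      have "\<theta> n x * (indicator (cbox c d) x * f x) = indicator D x * (f x * \<theta> n x)" for x
        using \<theta>cb[of n x] cd by (auto simp: indicator_def split: if_splits)
      then have "(LINT x|lebesgue. \<theta> n x * (indicator (cbox c d) x * f x)) =
          (LINT x|lebesgue. indicator D x * (f x * \<theta> n x))"
        by (rule Bochner_Integration.integral_cong[OF refl])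
      then show ?thesis using test[OF \<theta>[of n]] by (simp add: LINT_lebesgue_on[OF Dm])
    qed
    ultimately have "(LINT x|lebesgue. indicator (box c d) x * (indicator (cbox c d) x * f x)) = 0"
      by (simp add: LIMSEQ_const_iff)
    then show ?thesis by (simp add: mult.assoc[symmetric] ind)
  qed
  have boxAE: "AE x in lebesgue. x \<in> box a b \<longrightarrow> f x = 0" if ab: "cbox a b \<subseteq> D" for a b
  proof -
    have "AE x in lebesgue. indicator (box a b) x * f x = 0"
    proof (rule AE_zero_if_box_integrals_zero)
      have "f absolutely_integrable_on cbox a b"
        using f ab by (auto simp: loc_integrable_def)
      then have "f absolutely_integrable_on box a b"
        by (rule set_integrable_subset) (auto simp: box_subset_cbox)
      then show "integrable lebesgue (\<lambda>x. indicator (box a b) x * f x)"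
        by (simp add: set_integrable_def)
    next
      fix c d
      obtain e g where eg: "box c d \<inter> box a b = box e g" using box_Int_box[of c d a b] by blast
      have "(LINT x|lebesgue. indicator (box e g) x * f x) = 0"
      proof (cases "box e g = {}")
        case False
        then have "cbox e g \<subseteq> cbox a b"
          using eg subset_box(4)[of e g a b] subset_box(1)[of e g a b] box_ne_empty(2)[of e g] by fastforce
        then show ?thesis using box0 ab by blast
      qed simp
      then show "(LINT x|lebesgue. indicator (box c d) x * (indicator (box a b) x * f x)) = 0"
        by (simp add: mult.assoc[symmetric] indicator_inter_arith[symmetric] eg)
    qed
    then show ?thesis by eventually_elim (auto simp: indicator_def split: if_splits)
  qed
  obtain \<D> where \<D>: "countable \<D>" "\<D> \<subseteq> Pow D"
    "\<And>X. X \<in> \<D> \<Longrightarrow> \<exists>a b. X = cbox a b" "\<Union>\<D> = D"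
    using open_countable_Union_open_cbox[OF D] by metis
  have "negligible (X - interior X)" if "X \<in> \<D>" for X
    using \<D>(3)[OF that] negligible_frontier_interval by auto
  moreover have "AE x in lebesgue. x \<in> interior X \<longrightarrow> f x = 0" if "X \<in> \<D>" for X
    using \<D>(3)[OF that] \<D>(2) that boxAE by (auto simp: interior_cbox)
  ultimately have "AE x in lebesgue. x \<in> X \<longrightarrow> f x = 0" if X: "X \<in> \<D>" for X
  proof -
    have "AE x in lebesgue. x \<notin> X - interior X"
      using \<open>\<And>X. X \<in> \<D> \<Longrightarrow> negligible (X - interior X)\<close>[OF X] by (intro AE_not_in) (simp add: negligible_iff_null_sets)
    then show ?thesis
      using \<open>\<And>X. X \<in> \<D> \<Longrightarrow> AE x in lebesgue. x \<in> interior X \<longrightarrow> f x = 0\<close>[OF X]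
      by eventually_elim auto
  qed
  then have "AE x in lebesgue. \<forall>X\<in>\<D>. x \<in> X \<longrightarrow> f x = 0"
    using \<D>(1) by (intro AE_ball_countable') auto
  then show ?thesis by eventually_elim (use \<D>(4) in blast)
qed

lemma has_weak_gradD:
  assumes "has_weak_grad D v g" "\<phi> \<in> test_functions D" "b \<in> Basis"
  shows "(LINT x|lebesgue_on D. v x * frechet_derivative \<phi> (at x) b)
    = - (LINT x|lebesgue_on D. (g x \<bullet> b) * \<phi> x)"
  using assms unfolding has_weak_grad_def by blast

lemma has_weak_grad_unique:
  fixes v :: "'a::euclidean_space \<Rightarrow> real"
  assumes D: "open D" and g: "has_weak_grad D v g" and h: "has_weak_grad D v h"
  shows "AE x in lebesgue. x \<in> D \<longrightarrow> g x = h x"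
proof -
  have comp: "AE x in lebesgue. x \<in> D \<longrightarrow> g x \<bullet> b - h x \<bullet> b = 0" if b: "b \<in> Basis" for b
  proof (rule fundamental_lemma[OF D])
    have lb: "loc_integrable D (\<lambda>x. u x \<bullet> b)" if "loc_integrable D u" for u :: "'a \<Rightarrow> 'a"
      using that unfolding loc_integrable_def
      using absolutely_integrable_component by blast
    show "loc_integrable D (\<lambda>x. g x \<bullet> b - h x \<bullet> b)"
      using lb[of g] lb[of h] g h unfolding has_weak_grad_def loc_integrable_def
      by (auto intro: set_integral_diff(1))
    fix \<phi> :: "'a \<Rightarrow> real" assume \<phi>: "\<phi> \<in> test_functions D"
    define K where "K = closure {x. \<phi> x \<noteq> 0}"
    have K: "compact K" "K \<subseteq> D" and \<phi>Ck: "\<And>k. Ck k \<phi>"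
      unfolding K_def by (fact test_functionsD[OF \<phi>])+
    have \<phi>c: "continuous_on UNIV \<phi>" using \<phi>Ck[of 0] by simp
    have \<phi>0: "\<phi> x = 0" if "x \<notin> K" for x using that closure_subset[of "{x. \<phi> x \<noteq> 0}"] unfolding K_def by blast
    have int: "integrable lebesgue (\<lambda>x. indicator D x * ((u x \<bullet> b) * \<phi> x))" if "loc_integrable D u" for u :: "'a \<Rightarrow> 'a"
    proof -
      have "(\<lambda>x. u x \<bullet> b) absolutely_integrable_on K"
        using lb[OF that] K by (auto simp: loc_integrable_def)
      moreover have "continuous_on K \<phi>" using \<phi>c by (rule continuous_on_subset) simp
      moreover have "K \<in> sets lebesgue" using K by (auto dest: compact_imp_closed)
      moreover from calculation have "\<phi> \<in> borel_measurable (lebesgue_on K)"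
        by (intro continuous_imp_measurable_on_sets_lebesgue)
      moreover have "bounded (\<phi> ` K)"
        by (rule compact_imp_bounded[OF compact_continuous_image]) fact+
      ultimately have "(\<lambda>x. \<phi> x * (u x \<bullet> b)) absolutely_integrable_on K"
        by (intro absolutely_integrable_bounded_measurable_product[OF bilinear_times])
      moreover have "indicator K x * (\<phi> x * (u x \<bullet> b)) = indicator D x * ((u x \<bullet> b) * \<phi> x)" for x
        using K \<phi>0[of x] by (auto simp: indicator_def)
      ultimately show ?thesis by (simp add: set_integrable_def)
    qed
    have "(LINT x|lebesgue_on D. (g x \<bullet> b) * \<phi> x) = (LINT x|lebesgue_on D. (h x \<bullet> b) * \<phi> x)"
      using has_weak_gradD[OF g \<phi> b] has_weak_gradD[OF h \<phi> b] by simp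
    moreover have "integrable lebesgue (\<lambda>x. indicator D x * ((g x \<bullet> b) * \<phi> x))"
      "integrable lebesgue (\<lambda>x. indicator D x * ((h x \<bullet> b) * \<phi> x))"
      using int g h by (auto simp: has_weak_grad_def)
    ultimately show "(LINT x|lebesgue_on D. (g x \<bullet> b - h x \<bullet> b) * \<phi> x) = 0"
      using D by (simp add: LINT_lebesgue_on algebra_simps)
  qed
  have "AE x in lebesgue. \<forall>b\<in>Basis. x \<in> D \<longrightarrow> g x \<bullet> b - h x \<bullet> b = 0"
    by (intro AE_ball_countable' comp countable_finite finite_Basis)
  then show ?thesis
  proof eventually_elim
    case (elim x)
    then show ?case by (intro impI euclidean_eqI[of "g x"]) simp
  qed
qed

section \<open>Piecewise differentiable Lipschitz functions\<close>

text \<open>Real functions that are Lipschitz on the whole space, with some constant.\<close>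

definition lip :: "('a::euclidean_space \<Rightarrow> real) \<Rightarrow> bool" where
  "lip w \<longleftrightarrow> (\<exists>L\<ge>0. \<forall>x y. \<bar>w x - w y\<bar> \<le> L * norm (x - y))"

text \<open>\<open>lip_grad w g\<close>: the function \<open>w\<close> is Lipschitz, and off a closed null set it has the continuous
  gradient \<open>g\<close>. The values of \<open>g\<close> on the null set are arbitrary.\<close>

definition lip_grad :: "('a::euclidean_space \<Rightarrow> real) \<Rightarrow> ('a \<Rightarrow> 'a) \<Rightarrow> bool" where
  "lip_grad w g \<longleftrightarrow> lip w \<and> (\<exists>G. open G \<and> negligible (- G) \<and> continuous_on G g \<and>
     (\<forall>x\<in>G. (w has_derivative (\<lambda>d. g x \<bullet> d)) (at x)))"

lemma lipI: "0 \<le> L \<Longrightarrow> (\<And>x y. \<bar>w x - w y\<bar> \<le> L * norm (x - y)) \<Longrightarrow> lip w"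
  unfolding lip_def by blast

lemma lipE:
  assumes "lip w"
  obtains L where "L \<ge> 0" "\<And>x y. \<bar>w x - w y\<bar> \<le> L * norm (x - y)"
  using assms unfolding lip_def by blast

lemma lip_continuous_on:
  assumes "lip w" shows "continuous_on S w"
proof -
  obtain L where L: "L \<ge> 0" "\<And>x y. \<bar>w x - w y\<bar> \<le> L * norm (x - y)" using lipE[OF assms] by blast
  have "L-lipschitz_on S w"
    by (rule lipschitz_onI) (use L in \<open>auto simp: dist_norm\<close>)
  then show ?thesis by (rule lipschitz_on_continuous_on)
qed

lemma lip_borel: "lip w \<Longrightarrow> w \<in> borel_measurable borel"
  by (rule borel_measurable_continuous_onI) (rule lip_continuous_on)

lemma lip_bounded:
  assumes "lip w" "bounded S" obtains B where "B \<ge> 0" "\<And>x. x \<in> S \<Longrightarrow> \<bar>w x\<bar> \<le> B"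
proof -
  obtain L where L: "L \<ge> 0" "\<And>x y. \<bar>w x - w y\<bar> \<le> L * norm (x - y)" using lipE[OF assms(1)] by blast
  obtain R where R: "\<And>x. x \<in> S \<Longrightarrow> norm x \<le> R" using assms(2) by (auto simp: bounded_iff)
  show ?thesis
  proof (rule that[of "\<bar>w 0\<bar> + L * \<bar>R\<bar>"])
    show "0 \<le> \<bar>w 0\<bar> + L * \<bar>R\<bar>" using L by simp
    fix x assume "x \<in> S"
    then have "norm x \<le> \<bar>R\<bar>" using R by fastforce
    then have "L * norm x \<le> L * \<bar>R\<bar>" using L by (intro mult_left_mono)
    then show "\<bar>w x\<bar> \<le> \<bar>w 0\<bar> + L * \<bar>R\<bar>" using L(2)[of x 0] by simp
  qed
qed

lemma lip_const: "lip (\<lambda>x. c)"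
  by (rule lipI[of 0]) auto

lemma lip_inner: "lip (\<lambda>x. c \<bullet> x)"
proof (rule lipI[of "norm c"])
  show "\<bar>c \<bullet> x - c \<bullet> y\<bar> \<le> norm c * norm (x - y)" for x y
    using Cauchy_Schwarz_ineq2[of c "x - y"] by (simp add: inner_diff_right)
qed simp

lemma lip_add:
  fixes u w :: "'a::euclidean_space \<Rightarrow> real"
  assumes "lip u" "lip w" shows "lip (\<lambda>x. u x + w x)"
proof -
  obtain L where L: "L \<ge> 0" "\<And>x y. \<bar>u x - u y\<bar> \<le> L * norm (x - y)" using lipE[OF assms(1)] by blast
  obtain M where M: "M \<ge> 0" "\<And>x y. \<bar>w x - w y\<bar> \<le> M * norm (x - y)" using lipE[OF assms(2)] by blast
  show ?thesis
  proof (rule lipI[of "L + M"])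
    show "\<bar>u x + w x - (u y + w y)\<bar> \<le> (L + M) * norm (x - y)" for x y
      using L(2)[of x y] M(2)[of x y] by (simp add: distrib_right)
  qed (use L M in simp)
qed

lemma lip_max:
  fixes u w :: "'a::euclidean_space \<Rightarrow> real"
  assumes "lip u" "lip w" shows "lip (\<lambda>x. max (u x) (w x))"
proof -
  obtain L where L: "L \<ge> 0" "\<And>x y. \<bar>u x - u y\<bar> \<le> L * norm (x - y)" using lipE[OF assms(1)] by blast
  obtain M where M: "M \<ge> 0" "\<And>x y. \<bar>w x - w y\<bar> \<le> M * norm (x - y)" using lipE[OF assms(2)] by blast
  show ?thesis
  proof (rule lipI[of "L + M"])
    fix x y :: 'a
    have "0 \<le> L * norm (x - y)" "0 \<le> M * norm (x - y)" using L M by auto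
    then show "\<bar>max (u x) (w x) - max (u y) (w y)\<bar> \<le> (L + M) * norm (x - y)"
      using L(2)[of x y] M(2)[of x y] by (simp add: distrib_right max_def abs_if split: if_splits)
  qed (use L M in simp)
qed

text \<open>Outer functions only need to be Lipschitz on the range of the inner one.\<close>

lemma lip_compose:
  assumes "lip w" "K \<ge> 0" "\<And>x y. \<bar>h (w x) - h (w y)\<bar> \<le> K * \<bar>w x - w y\<bar>"
  shows "lip (\<lambda>x. h (w x))"
proof -
  obtain L where L: "L \<ge> 0" "\<And>x y. \<bar>w x - w y\<bar> \<le> L * norm (x - y)" using lipE[OF assms(1)] by blast
  show ?thesis
  proof (rule lipI[of "K * L"])
    show "\<bar>h (w x) - h (w y)\<bar> \<le> K * L * norm (x - y)" for x y
      using assms(3)[of x y] mult_left_mono[OF L(2)[of x y] assms(2)] by (simp add: mult.assoc)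
  qed (use L assms in simp)
qed

lemma lip_abs: "lip w \<Longrightarrow> lip (\<lambda>x. \<bar>w x\<bar>)"
  by (rule lip_compose[where K=1]) auto

lemma lip_cmult: "lip w \<Longrightarrow> lip (\<lambda>x. c * w x)"
  by (rule lip_compose[where K="\<bar>c\<bar>" and h="\<lambda>t. c * t"])
    (auto simp: abs_mult[symmetric] right_diff_distrib)

lemma lip_mult_support:
  assumes u: "lip u" and w: "lip w" and S: "bounded S" and 0: "\<And>x. x \<notin> S \<Longrightarrow> w x = 0"
  shows "lip (\<lambda>x. u x * w x)"
proof -
  obtain L where L: "L \<ge> 0" "\<And>x y. \<bar>u x - u y\<bar> \<le> L * norm (x - y)" using lipE[OF u] by blast
  obtain M where M: "M \<ge> 0" "\<And>x y. \<bar>w x - w y\<bar> \<le> M * norm (x - y)" using lipE[OF w] by blast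
  obtain B where B: "B \<ge> 0" "\<And>x. x \<in> S \<Longrightarrow> \<bar>u x\<bar> \<le> B" using lip_bounded[OF u S] by blast
  obtain C where C: "C \<ge> 0" "\<And>x. x \<in> S \<Longrightarrow> \<bar>w x\<bar> \<le> C" using lip_bounded[OF w S] by blast
  have C': "\<bar>w x\<bar> \<le> C" for x using C 0 by (cases "x \<in> S") auto
  have *: "\<bar>u x * w x - u y * w y\<bar> \<le> (B * M + C * L) * norm (x - y)" if x: "x \<in> S" for x y
  proof -
    have "\<bar>u x * w x - u y * w y\<bar> = \<bar>u x * (w x - w y) + w y * (u x - u y)\<bar>"
      by (simp add: algebra_simps)
    also have "\<dots> \<le> \<bar>u x\<bar> * \<bar>w x - w y\<bar> + \<bar>w y\<bar> * \<bar>u x - u y\<bar>"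
      by (metis abs_mult abs_triangle_ineq)
    also have "\<dots> \<le> B * (M * norm (x - y)) + C * (L * norm (x - y))"
      by (intro add_mono mult_mono B x M C' C(1) L) auto
    finally show ?thesis by (simp add: algebra_simps)
  qed
  show ?thesis
  proof (rule lipI[of "B * M + C * L"])
    fix x y
    consider "x \<in> S" | "y \<in> S" | "x \<notin> S" "y \<notin> S" by blast
    then show "\<bar>u x * w x - u y * w y\<bar> \<le> (B * M + C * L) * norm (x - y)"
      using *[of x y] *[of y x] 0 B C L M
      by cases (auto simp: norm_minus_commute abs_minus_commute)
  qed (use B C L M in simp)
qed

subsection \<open>Closure properties\<close>

lemma lip_gradE:
  assumes "lip_grad w g"
  obtains G where "open G" "negligible (- G)" "continuous_on G g"
    "\<And>x. x \<in> G \<Longrightarrow> (w has_derivative (\<lambda>d. g x \<bullet> d)) (at x)"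
  using assms unfolding lip_grad_def by blast

lemma lip_gradI:
  assumes "lip w" "open G" "negligible (- G)" "continuous_on G g"
    "\<And>x. x \<in> G \<Longrightarrow> (w has_derivative (\<lambda>d. g x \<bullet> d)) (at x)"
  shows "lip_grad w g"
  using assms unfolding lip_grad_def by blast

lemma lip_grad_lip: "lip_grad w g \<Longrightarrow> lip w"
  by (simp add: lip_grad_def)

lemma lip_grad_inner: "lip_grad (\<lambda>x. c \<bullet> x) (\<lambda>x. c)"
  by (rule lip_gradI[OF lip_inner open_UNIV]) (auto intro!: derivative_eq_intros)

lemma lip_grad_zero: "lip_grad (\<lambda>x. 0) (\<lambda>x. 0)"
  by (rule lip_gradI[OF lip_const open_UNIV]) auto

lemma negligible_compl_Int: "negligible (- G) \<Longrightarrow> negligible (- H) \<Longrightarrow> negligible (- (G \<inter> H))"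
  by (simp add: Compl_Int negligible_Un)

lemma lip_grad_add:
  assumes "lip_grad u g" "lip_grad w h"
  shows "lip_grad (\<lambda>x. u x + w x) (\<lambda>x. g x + h x)"
proof -
  obtain G where G: "open G" "negligible (- G)" "continuous_on G g"
    "\<And>x. x \<in> G \<Longrightarrow> (u has_derivative (\<lambda>d. g x \<bullet> d)) (at x)" using lip_gradE[OF assms(1)] by blast
  obtain H where H: "open H" "negligible (- H)" "continuous_on H h"
    "\<And>x. x \<in> H \<Longrightarrow> (w has_derivative (\<lambda>d. h x \<bullet> d)) (at x)" using lip_gradE[OF assms(2)] by blast
  show ?thesis
  proof (rule lip_gradI[of _ "G \<inter> H"])
    show "((\<lambda>x. u x + w x) has_derivative (\<lambda>d. (g x + h x) \<bullet> d)) (at x)" if "x \<in> G \<inter> H" for x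
      using has_derivative_add[OF G(4) H(4)] that by (simp add: inner_add_left)
  qed (use G H assms in \<open>auto intro!: negligible_compl_Int lip_add continuous_intros
      intro: continuous_on_subset lip_grad_lip\<close>)
qed

lemma lip_grad_cmult:
  assumes "lip_grad w g"
  shows "lip_grad (\<lambda>x. c * w x) (\<lambda>x. c *\<^sub>R g x)"
proof -
  obtain G where G: "open G" "negligible (- G)" "continuous_on G g"
    "\<And>x. x \<in> G \<Longrightarrow> (w has_derivative (\<lambda>d. g x \<bullet> d)) (at x)" using lip_gradE[OF assms] by blast
  show ?thesis
  proof (rule lip_gradI[of _ G])
    show "((\<lambda>x. c * w x) has_derivative (\<lambda>d. (c *\<^sub>R g x) \<bullet> d)) (at x)" if "x \<in> G" for x
      using has_derivative_mult_right[OF G(4)[OF that], of c] by simp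
  qed (use G assms in \<open>auto intro!: lip_cmult continuous_intros intro: lip_grad_lip\<close>)
qed

lemma lip_grad_diff:
  assumes "lip_grad u g" "lip_grad w h"
  shows "lip_grad (\<lambda>x. u x - w x) (\<lambda>x. g x - h x)"
  using lip_grad_add[OF assms(1) lip_grad_cmult[OF assms(2), of "-1"]] by simp

lemma lip_grad_sum:
  "finite I \<Longrightarrow> (\<And>i. i \<in> I \<Longrightarrow> lip_grad (w i) (g i)) \<Longrightarrow>
    lip_grad (\<lambda>x. \<Sum>i\<in>I. w i x) (\<lambda>x. \<Sum>i\<in>I. g i x)"
  by (induction I rule: finite_induct) (simp_all add: lip_grad_zero lip_grad_add)

lemma lip_grad_mult:
  assumes u: "lip_grad u g" and w: "lip_grad w h" and S: "bounded S" and 0: "\<And>x. x \<notin> S \<Longrightarrow> w x = 0"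
  shows "lip_grad (\<lambda>x. u x * w x) (\<lambda>x. u x *\<^sub>R h x + w x *\<^sub>R g x)"
proof -
  obtain G where G: "open G" "negligible (- G)" "continuous_on G g"
    "\<And>x. x \<in> G \<Longrightarrow> (u has_derivative (\<lambda>d. g x \<bullet> d)) (at x)" using lip_gradE[OF u] by blast
  obtain H where H: "open H" "negligible (- H)" "continuous_on H h"
    "\<And>x. x \<in> H \<Longrightarrow> (w has_derivative (\<lambda>d. h x \<bullet> d)) (at x)" using lip_gradE[OF w] by blast
  have l: "lip u" "lip w" using u w by (auto dest: lip_grad_lip)
  show ?thesis
  proof (rule lip_gradI[of _ "G \<inter> H"])
    show "lip (\<lambda>x. u x * w x)" using lip_mult_support[OF l S 0] .
    show "((\<lambda>x. u x * w x) has_derivative (\<lambda>d. (u x *\<^sub>R h x + w x *\<^sub>R g x) \<bullet> d)) (at x)"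
      if "x \<in> G \<inter> H" for x
      using has_derivative_mult[OF G(4) H(4)] that by (simp add: inner_add_left algebra_simps)
    show "continuous_on (G \<inter> H) (\<lambda>x. u x *\<^sub>R h x + w x *\<^sub>R g x)"
      by (intro continuous_intros lip_continuous_on l continuous_on_subset[OF G(3)] continuous_on_subset[OF H(3)]) auto
  qed (use G H in \<open>auto intro!: negligible_compl_Int\<close>)
qed

lemma lip_grad_affine:
  fixes w :: "'a::euclidean_space \<Rightarrow> real"
  assumes w: "lip_grad w g" and c: "c \<noteq> 0"
  shows "lip_grad (\<lambda>x. w (c *\<^sub>R x + a)) (\<lambda>x. c *\<^sub>R g (c *\<^sub>R x + a))"
proof -
  obtain G where G: "open G" "negligible (- G)" "continuous_on G g"
    "\<And>x. x \<in> G \<Longrightarrow> (w has_derivative (\<lambda>d. g x \<bullet> d)) (at x)" using lip_gradE[OF w] by blast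
  define f where "f = (\<lambda>x. c *\<^sub>R x + a)"
  obtain L where L: "L \<ge> 0" "\<And>x y. \<bar>w x - w y\<bar> \<le> L * norm (x - y)"
    using lipE[OF lip_grad_lip[OF w]] by blast
  have cf: "continuous_on UNIV f" unfolding f_def by (intro continuous_intros)
  have "lip_grad (\<lambda>x. w (f x)) (\<lambda>x. c *\<^sub>R g (f x))"
  proof (rule lip_gradI[of _ "f -` G"])
    show "lip (\<lambda>x. w (f x))"
    proof (rule lipI[of "L * \<bar>c\<bar>"])
      fix x y
      have "norm (f x - f y) = \<bar>c\<bar> * norm (x - y)"
        by (simp add: f_def flip: scaleR_diff_right)
      then show "\<bar>w (f x) - w (f y)\<bar> \<le> L * \<bar>c\<bar> * norm (x - y)" using L(2)[of "f x" "f y"] by simp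
    qed (use L in simp)
    show "open (f -` G)" using G(1) cf by (simp add: open_vimage)
    have "- (f -` G) = (\<lambda>y. (1/c) *\<^sub>R y + (- (1/c)) *\<^sub>R a) ` (- G)"
    proof safe
      fix x assume "x \<notin> f -` G"
      then have "f x \<in> - G" by simp
      moreover have "x = (1/c) *\<^sub>R f x + (- (1/c)) *\<^sub>R a"
        using c by (simp add: f_def scaleR_add_right)
      ultimately show "x \<in> (\<lambda>y. (1/c) *\<^sub>R y + (- (1/c)) *\<^sub>R a) ` (- G)" by blast
    next
      fix y assume "y \<notin> G" "f ((1/c) *\<^sub>R y + (- (1/c)) *\<^sub>R a) \<in> G"
      then show False using c by (simp add: f_def scaleR_add_right scaleR_diff_right)
    qed
    then show "negligible (- (f -` G))"
      using G(2) by (auto intro!: negligible_differentiable_image_negligible derivative_intros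
          simp: differentiable_on_def)
    show "continuous_on (f -` G) (\<lambda>x. c *\<^sub>R g (f x))"
      by (intro continuous_intros continuous_on_compose2[OF G(3)] continuous_on_subset[OF cf]) auto
    fix x assume "x \<in> f -` G"
    then have "(w has_derivative (\<lambda>d. g (f x) \<bullet> d)) (at (f x))" using G(4) by simp
    moreover have "(f has_derivative (\<lambda>d. c *\<^sub>R d)) (at x)"
      unfolding f_def by (auto intro!: derivative_eq_intros)
    ultimately show "((\<lambda>x. w (f x)) has_derivative (\<lambda>d. (c *\<^sub>R g (f x)) \<bullet> d)) (at x)"
      using has_derivative_compose[of f "\<lambda>d. c *\<^sub>R d" x UNIV w "\<lambda>d. g (f x) \<bullet> d"] by simp
  qed
  then show ?thesis by (simp add: f_def)
qed

lemma negligible_affine_hyperplane: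
  fixes n :: "'a::euclidean_space"
  assumes "n \<noteq> 0" shows "negligible {x. n \<bullet> x = s}"
  using assms negligible_hyperplane[of n s] by simp

lemma lip_grad_pos_part:
  fixes n :: "'a::euclidean_space"
  assumes "n \<noteq> 0"
  shows "lip_grad (\<lambda>x. max 0 (n \<bullet> x + s)) (\<lambda>x. if n \<bullet> x + s > 0 then n else 0)"
proof (rule lip_gradI[of _ "{x. n \<bullet> x + s > 0} \<union> {x. n \<bullet> x + s < 0}"])
  let ?P = "{x. n \<bullet> x + s > 0}" and ?N = "{x. n \<bullet> x + s < 0}"
  have op: "open ?P" "open ?N" by (intro open_Collect_less continuous_intros)+
  show "lip (\<lambda>x. max 0 (n \<bullet> x + s))" by (intro lip_max lip_add lip_const lip_inner)
  show "open (?P \<union> ?N)" using op by blast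
  have "- (?P \<union> ?N) = {x. n \<bullet> x = - s}" by auto
  then show "negligible (- (?P \<union> ?N))" using negligible_affine_hyperplane[OF assms] by simp
  show "continuous_on (?P \<union> ?N) (\<lambda>x. if n \<bullet> x + s > 0 then n else 0)"
  proof (rule continuous_on_open_Un[OF op])
    show "continuous_on ?P (\<lambda>x. if n \<bullet> x + s > 0 then n else 0)"
      by (rule continuous_on_eq[OF continuous_on_const[of _ n]]) simp
    show "continuous_on ?N (\<lambda>x. if n \<bullet> x + s > 0 then n else 0)"
      by (rule continuous_on_eq[OF continuous_on_const[of _ 0]]) simp
  qed
  fix x assume "x \<in> ?P \<union> ?N"
  then show "((\<lambda>x. max 0 (n \<bullet> x + s)) has_derivative (\<lambda>d. (if n \<bullet> x + s > 0 then n else 0) \<bullet> d)) (at x)"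
  proof
    assume x: "x \<in> ?P"
    have "((\<lambda>x. n \<bullet> x + s) has_derivative (\<lambda>d. (if n \<bullet> x + s > 0 then n else 0) \<bullet> d)) (at x)"
      using x by (auto intro!: derivative_eq_intros)
    then show ?thesis
      by (rule has_derivative_transform_within_open[OF _ op(1) x]) auto
  next
    assume x: "x \<in> ?N"
    have "((\<lambda>x. 0) has_derivative (\<lambda>d. (if n \<bullet> x + s > 0 then n else 0) \<bullet> d)) (at x)"
      using x by (auto intro!: derivative_eq_intros)
    then show ?thesis
      by (rule has_derivative_transform_within_open[OF _ op(2) x]) auto
  qed
qed

subsection \<open>Measurability and boundedness of the gradient\<close>

lemma negligible_compl_AE: "negligible (- G) \<Longrightarrow> AE x in lebesgue. x \<in> G"
  using AE_not_in[of "- G" lebesgue] by (simp add: negligible_iff_null_sets)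

lemma lip_grad_measurable:
  assumes "lip_grad w g" shows "g \<in> borel_measurable lebesgue"
proof -
  obtain G where G: "open G" "negligible (- G)" "continuous_on G g"
    "\<And>x. x \<in> G \<Longrightarrow> (w has_derivative (\<lambda>d. g x \<bullet> d)) (at x)" using lip_gradE[OF assms] by blast
  have "g \<in> borel_measurable (lebesgue_on G)"
    using G by (intro continuous_imp_measurable_on_sets_lebesgue) auto
  then have "(\<lambda>x. if x \<in> G then g x else 0) \<in> borel_measurable lebesgue"
    using G by (intro borel_measurable_if[THEN iffD2]) auto
  moreover have "AE x in lebesgue. (if x \<in> G then g x else 0) = g x"
    using negligible_compl_AE[OF G(2)] by eventually_elim simp
  ultimately show ?thesis by (rule borel_measurable_AE)
qed

text \<open>Where it is the gradient, \<open>g\<close> is bounded by the Lipschitz constant: differentiate in its own direction.\<close>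

lemma lip_grad_bounded:
  assumes "lip_grad w g" obtains L where "L \<ge> 0" "AE x in lebesgue. norm (g x) \<le> L"
proof -
  obtain G where G: "open G" "negligible (- G)" "continuous_on G g"
    "\<And>x. x \<in> G \<Longrightarrow> (w has_derivative (\<lambda>d. g x \<bullet> d)) (at x)" using lip_gradE[OF assms] by blast
  obtain L where L: "L \<ge> 0" "\<And>x y. \<bar>w x - w y\<bar> \<le> L * norm (x - y)"
    using lipE[OF lip_grad_lip[OF assms]] by blast
  have bd: "norm (g x) \<le> L" if "x \<in> G" for x
  proof -
    let ?d = "g x"
    have "((\<lambda>t. x + t *\<^sub>R ?d) has_derivative (\<lambda>t. t *\<^sub>R ?d)) (at 0)"
      by (auto intro!: derivative_eq_intros)
    moreover have "(w has_derivative (\<lambda>d. g x \<bullet> d)) (at (x + 0 *\<^sub>R ?d))" using G(4)[OF that] by simp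
    ultimately have "((\<lambda>t. w (x + t *\<^sub>R ?d)) has_derivative (\<lambda>t. g x \<bullet> (t *\<^sub>R ?d))) (at 0)"
      by (rule has_derivative_compose)
    then have "((\<lambda>t. w (x + t *\<^sub>R ?d)) has_real_derivative (g x \<bullet> g x)) (at 0)"
      by (rule has_derivative_imp_has_field_derivative) simp
    then have "((\<lambda>t. (w (x + (0 + t) *\<^sub>R ?d) - w (x + 0 *\<^sub>R ?d)) / t) \<longlongrightarrow> (g x \<bullet> g x)) (at 0)"
      unfolding DERIV_def .
    then have lim: "((\<lambda>t. \<bar>(w (x + t *\<^sub>R ?d) - w x) / t\<bar>) \<longlongrightarrow> \<bar>g x \<bullet> g x\<bar>) (at 0)"
      by (intro tendsto_rabs) simp
    have "\<bar>(w (x + t *\<^sub>R ?d) - w x) / t\<bar> \<le> L * norm ?d" if "t \<noteq> 0" for t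
      using L(2)[of "x + t *\<^sub>R ?d" x] that by (simp add: abs_divide field_simps)
    then have "\<forall>\<^sub>F t in at 0. \<bar>(w (x + t *\<^sub>R ?d) - w x) / t\<bar> \<le> L * norm ?d"
      by (auto simp: eventually_at_filter)
    then have "\<bar>g x \<bullet> g x\<bar> \<le> L * norm ?d"
      by (intro tendsto_upperbound[OF lim]) auto
    then have "norm (g x) * norm (g x) \<le> L * norm (g x)"
      by (simp add: dot_square_norm power2_eq_square)
    then show ?thesis using L(1) by (cases "norm (g x) = 0") (auto simp: mult_le_cancel_right)
  qed
  have "AE x in lebesgue. norm (g x) \<le> L"
    using negligible_compl_AE[OF G(2)] by eventually_elim (rule bd)
  then show ?thesis by (rule that[OF L(1)])
qed

lemma lip_measurable_lebesgue: "lip w \<Longrightarrow> w \<in> borel_measurable lebesgue"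
  using lip_borel[of w] by (simp add: measurable_completion)

lemma bounded_emeasure_finite:
  "bounded S \<Longrightarrow> S \<in> sets lebesgue \<Longrightarrow> emeasure lebesgue S < \<infinity>"
  using fmeasurableD2[OF bounded_set_imp_lmeasurable, of S] by (simp only: infinity_ennreal_def less_top)

lemma integrable_lebesgue_bounded:
  fixes f :: "'a::euclidean_space \<Rightarrow> 'b::euclidean_space"
  assumes f: "f \<in> borel_measurable lebesgue" and S: "S \<in> sets lebesgue" "bounded S"
    and B: "AE x in lebesgue. norm (f x) \<le> B"
  shows "integrable lebesgue (\<lambda>x. indicator S x *\<^sub>R f x)"
proof (rule integrableI_bounded_set[where A=S and B=B])
  show "S \<in> sets lebesgue" by fact
  show "(\<lambda>x. indicator S x *\<^sub>R f x) \<in> borel_measurable lebesgue"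
    using S f by (intro borel_measurable_scaleR borel_measurable_indicator)
  show "emeasure lebesgue S < \<infinity>"
    by (rule bounded_emeasure_finite[OF S(2,1)])
  show "AE x in lebesgue. x \<in> S \<longrightarrow> norm (indicator S x *\<^sub>R f x) \<le> B"
    using B by eventually_elim simp
qed simp

lemma lebesgue_integral_shift:
  fixes f :: "'a::euclidean_space \<Rightarrow> real"
  assumes [measurable]: "f \<in> borel_measurable borel"
  shows "(LINT x|lebesgue. f (x + c)) = (LINT x|lebesgue. f x)"
proof -
  have "(LINT x|lborel. f x) = (LINT x|distr lborel borel ((+) c). f x)"
    by (simp add: lborel_distr_plus)
  also have "\<dots> = (LINT x|lborel. f (c + x))"
    by (rule integral_distr) auto
  finally show ?thesis by (simp add: integral_completion add.commute)
qed

lemma lebesgue_measurable_reflect: "(\<lambda>x::'a::euclidean_space. c - x) \<in> lebesgue \<rightarrow>\<^sub>M lebesgue"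
proof -
  have "(\<lambda>x. c + (\<Sum>j\<in>Basis. (- 1 * (x \<bullet> j)) *\<^sub>R j)) = (\<lambda>x::'a. c - x)"
    by (simp add: sum_negf euclidean_representation fun_eq_iff)
  then show ?thesis using lebesgue_affine_measurable[of "\<lambda>_. -1" c] by simp
qed

lemma lebesgue_integral_reflect:
  fixes f :: "'a::euclidean_space \<Rightarrow> real"
  assumes f: "f \<in> borel_measurable lebesgue"
  shows "(LINT x|lebesgue. f (c - x)) = (LINT x|lebesgue. f x)"
proof -
  have T: "(\<lambda>x. c + (\<Sum>j\<in>Basis. (- 1 * (x \<bullet> j)) *\<^sub>R j)) = (\<lambda>x::'a. c - x)"
    by (simp add: sum_negf euclidean_representation fun_eq_iff)
  have "(lebesgue :: 'a measure) = distr lebesgue lebesgue (\<lambda>x. c - x)"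
    using lebesgue_affine_euclidean[of "\<lambda>_::'a. -1" c] unfolding T by (simp add: density_1)
  then have "(LINT x|lebesgue. f x) = (LINT x|distr lebesgue lebesgue (\<lambda>x. c - x). f x)" by simp
  also have "\<dots> = (LINT x|lebesgue. f (c - x))"
    by (rule integral_distr[OF lebesgue_measurable_reflect f])
  finally show ?thesis by simp
qed

subsection \<open>The gradient of a test function\<close>

text \<open>The pointwise gradient; it is meaningful where the function is differentiable.\<close>

definition gradient :: "('a::euclidean_space \<Rightarrow> real) \<Rightarrow> 'a \<Rightarrow> 'a" where
  "gradient f x = (\<Sum>b\<in>Basis. frechet_derivative f (at x) b *\<^sub>R b)"

lemma gradient_inner_Basis: "b \<in> Basis \<Longrightarrow> gradient f x \<bullet> b = frechet_derivative f (at x) b"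
  by (simp add: gradient_def inner_sum_left_Basis)

lemma frechet_derivative_gradient:
  assumes "f differentiable (at x)"
  shows "frechet_derivative f (at x) d = gradient f x \<bullet> d"
proof -
  have lin: "linear (frechet_derivative f (at x))" by (rule linear_frechet_derivative[OF assms])
  have "frechet_derivative f (at x) d = frechet_derivative f (at x) (\<Sum>b\<in>Basis. (d \<bullet> b) *\<^sub>R b)"
    by (simp add: euclidean_representation)
  also have "\<dots> = (\<Sum>b\<in>Basis. (d \<bullet> b) * frechet_derivative f (at x) b)"
    by (simp add: linear_sum[OF lin] linear_cmul[OF lin])
  also have "\<dots> = gradient f x \<bullet> d"
    by (simp add: gradient_def inner_sum_left inner_sum_right inner_commute[of _ d] mult.commute)
  finally show ?thesis .
qed

lemma Ck_has_derivative: "Ck (Suc 0) f \<Longrightarrow> (f has_derivative (\<lambda>d. gradient f x \<bullet> d)) (at x)"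
proof -
  assume "Ck (Suc 0) f"
  then have f: "f differentiable (at x)" by simp
  then have "frechet_derivative f (at x) = (\<lambda>d. gradient f x \<bullet> d)"
    by (intro ext frechet_derivative_gradient)
  then show ?thesis using f by (simp add: frechet_derivative_works)
qed

lemma Ck_continuous_gradient:
  assumes "Ck (Suc 0) f" shows "continuous_on UNIV (gradient f)"
  using assms unfolding gradient_def by (auto intro!: continuous_intros)

lemma gradient_eq_0:
  assumes "x \<notin> closure {x. f x \<noteq> 0}" shows "gradient f x = 0"
proof -
  let ?K = "closure {x. f x \<noteq> 0}"
  have "((\<lambda>x. 0) has_derivative (\<lambda>d. 0)) (at x)" by simp
  then have "(f has_derivative (\<lambda>d. 0)) (at x)"
    by (rule has_derivative_transform_within_open[of _ _ _ _ "- ?K"])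
      (use assms closure_subset[of "{x. f x \<noteq> 0}"] in auto)
  then have "frechet_derivative f (at x) = (\<lambda>d. 0)" by (rule frechet_derivative_at[symmetric])
  then show ?thesis by (simp add: gradient_def)
qed

lemma test_functions_lip_grad:
  assumes \<phi>: "\<phi> \<in> test_functions D" shows "lip_grad \<phi> (gradient \<phi>)"
proof -
  let ?K = "closure {x. \<phi> x \<noteq> 0}"
  have C1: "Ck (Suc 0) \<phi>" and K: "compact ?K" using test_functionsD[OF \<phi>] by blast+
  have der: "(\<phi> has_derivative (\<lambda>d. gradient \<phi> x \<bullet> d)) (at x)" for x
    by (rule Ck_has_derivative[OF C1])
  have "continuous_on ?K (gradient \<phi>)"
    using Ck_continuous_gradient[OF C1] by (rule continuous_on_subset) simp
  then have "bounded (gradient \<phi> ` ?K)"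
    using K by (intro compact_imp_bounded compact_continuous_image)
  then obtain B where B: "B > 0" "\<And>y. y \<in> gradient \<phi> ` ?K \<Longrightarrow> norm y \<le> B"
    by (auto simp: bounded_pos)
  have B': "norm (gradient \<phi> x) \<le> B" for x
    using B gradient_eq_0[of x \<phi>] by (cases "x \<in> ?K") auto
  have "onorm (\<lambda>d. gradient \<phi> x \<bullet> d) \<le> B" for x
  proof (rule onorm_bound[OF less_imp_le[OF B(1)]])
    show "norm (gradient \<phi> x \<bullet> d) \<le> B * norm d" for d
      using Cauchy_Schwarz_ineq2[of "gradient \<phi> x" d] mult_right_mono[OF B'[of x], of "norm d"] by simp
  qed
  then have "\<bar>\<phi> x - \<phi> y\<bar> \<le> B * norm (x - y)" for x y
    using differentiable_bound[of UNIV \<phi> "\<lambda>x d. gradient \<phi> x \<bullet> d" B x y] der by simp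
  then have "lip \<phi>" by (rule lipI[OF less_imp_le[OF B(1)]])
  then show ?thesis
    by (rule lip_gradI[OF _ open_UNIV _ Ck_continuous_gradient[OF C1] der]) simp
qed

subsection \<open>Integration by parts\<close>

lemma tendsto_difference_quotient:
  fixes w :: "'a::euclidean_space \<Rightarrow> real"
  assumes "(w has_derivative D) (at x)"
  shows "(\<lambda>n. (w (x + inverse (real (Suc n)) *\<^sub>R b) - w x) / inverse (real (Suc n))) \<longlonglongrightarrow> D b"
proof -
  have lin: "linear D" using assms by (rule has_derivative_linear)
  have "((\<lambda>t. x + t *\<^sub>R b) has_derivative (\<lambda>t. t *\<^sub>R b)) (at 0)"
    by (auto intro!: derivative_eq_intros)
  moreover have "(w has_derivative D) (at (x + 0 *\<^sub>R b))" using assms by simp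
  ultimately have "((\<lambda>t. w (x + t *\<^sub>R b)) has_derivative (\<lambda>t. D (t *\<^sub>R b))) (at 0)"
    by (rule has_derivative_compose)
  then have "((\<lambda>t. w (x + t *\<^sub>R b)) has_real_derivative D b) (at 0)"
    by (rule has_derivative_imp_has_field_derivative) (simp add: linear_cmul[OF lin])
  then have lim: "((\<lambda>t. (w (x + t *\<^sub>R b) - w x) / t) \<longlongrightarrow> D b) (at 0)"
    unfolding DERIV_def by simp
  have "filterlim (\<lambda>n. inverse (real (Suc n))) (at 0) sequentially"
    using LIMSEQ_inverse_real_of_nat by (auto simp: filterlim_at simp del: of_nat_Suc)
  from filterlim_compose[OF lim this] show ?thesis .
qed

text \<open>The integral of a difference quotient of \<open>f\<close> vanishes by translation invariance; the Lipschitz bound permits the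
  limit under the integral.\<close>

lemma integral_gradient_eq_0:
  fixes f :: "'a::euclidean_space \<Rightarrow> real"
  assumes f: "lip_grad f g" and S: "bounded S" and 0: "\<And>x. x \<notin> S \<Longrightarrow> f x = 0"
  shows "(LINT x|lebesgue. g x \<bullet> b) = 0"
proof -
  obtain G where G: "open G" "negligible (- G)" "continuous_on G g"
    "\<And>x. x \<in> G \<Longrightarrow> (f has_derivative (\<lambda>d. g x \<bullet> d)) (at x)" using lip_gradE[OF f] by blast
  have lf: "lip f" using f by (rule lip_grad_lip)
  obtain L where L: "L \<ge> 0" "\<And>x y. \<bar>f x - f y\<bar> \<le> L * norm (x - y)" using lipE[OF lf] by blast
  obtain R where R: "\<And>x. x \<in> S \<Longrightarrow> norm x \<le> R" using S by (auto simp: bounded_iff)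
  define t where "t = (\<lambda>n. inverse (real (Suc n)))"
  have t: "0 < t n" "t n \<le> 1" for n unfolding t_def by (auto simp: field_simps)
  define C where "C = cball (0::'a) (R + norm b)"
  have C: "C \<in> sets lebesgue" "bounded C" unfolding C_def by auto
  have fb[measurable]: "f \<in> borel_measurable borel" by (rule lip_borel[OF lf])
  have fC: "f y = 0" if "y \<notin> C" for y
  proof (rule 0)
    show "y \<notin> S" using that R[of y] norm_ge_zero[of b] unfolding C_def by auto
  qed
  have fsC: "f (y + t n *\<^sub>R b) = 0" if "y \<notin> C" for y n
  proof (rule 0)
    have "norm y > R + norm b" using that by (simp add: C_def)
    moreover have "norm y \<le> norm (y + t n *\<^sub>R b) + norm (t n *\<^sub>R b)"
      using norm_triangle_ineq4[of "y + t n *\<^sub>R b" "t n *\<^sub>R b"] by simp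
    moreover have "norm (t n *\<^sub>R b) \<le> norm b" using t[of n] by (simp add: mult_left_le_one_le)
    ultimately have "norm (y + t n *\<^sub>R b) > R" by linarith
    then show "y + t n *\<^sub>R b \<notin> S" using R by fastforce
  qed
  define q where "q = (\<lambda>n x. (f (x + t n *\<^sub>R b) - f x) / t n)"
  have qb: "\<bar>q n x\<bar> \<le> indicator C x * (L * norm b)" for n x
  proof (cases "x \<in> C")
    case True
    have "\<bar>q n x\<bar> = \<bar>f (x + t n *\<^sub>R b) - f x\<bar> / t n" using t[of n] by (simp add: q_def)
    also have "\<dots> \<le> L * norm (t n *\<^sub>R b) / t n"
      using L(2)[of "x + t n *\<^sub>R b" x] t[of n] by (intro divide_right_mono) auto
    also have "\<dots> = L * norm b" using t[of n] by simp
    finally show ?thesis using True by simp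
  qed (simp add: q_def fC fsC)
  have iC: "integrable lebesgue (\<lambda>x. indicator C x * (L * norm b))"
    using integrable_lebesgue_bounded[of "\<lambda>x. L * norm b" C "\<bar>L * norm b\<bar>"] C by simp
  have lim: "(\<lambda>n. LINT x|lebesgue. q n x) \<longlonglongrightarrow> (LINT x|lebesgue. g x \<bullet> b)"
  proof (rule integral_dominated_convergence[OF _ _ iC])
    show "(\<lambda>x. g x \<bullet> b) \<in> borel_measurable lebesgue"
      using lip_grad_measurable[OF f] by simp
    show "q n \<in> borel_measurable lebesgue" for n
      unfolding q_def by (rule measurable_completion) measurable
    show "AE x in lebesgue. (\<lambda>n. q n x) \<longlonglongrightarrow> g x \<bullet> b"
      using negligible_compl_AE[OF G(2)]
    proof eventually_elim
      case (elim x)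
      show ?case unfolding q_def t_def by (rule tendsto_difference_quotient[OF G(4)[OF elim]])
    qed
    show "AE x in lebesgue. norm (q n x) \<le> indicator C x * (L * norm b)" for n
      using qb by (intro AE_I2) simp
  qed
  have "(LINT x|lebesgue. q n x) = 0" for n
  proof -
    obtain B where B: "B \<ge> 0" "\<And>x. x \<in> C \<Longrightarrow> \<bar>f x\<bar> \<le> B" using lip_bounded[OF lf C(2)] by blast
    have i1: "integrable lebesgue f"
      by (rule integrableI_bounded_set[where A=C and B=B])
        (use C B fC lip_measurable_lebesgue[OF lf] bounded_emeasure_finite[OF C(2,1)] in auto)
    obtain B' where B': "B' \<ge> 0" "\<And>x. x \<in> (\<lambda>x. x + t n *\<^sub>R b) ` C \<Longrightarrow> \<bar>f x\<bar> \<le> B'"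
      using lip_bounded[OF lf bounded_translation[OF C(2), of "t n *\<^sub>R b"]]
      by (auto simp: add.commute)
    have i2: "integrable lebesgue (\<lambda>x. f (x + t n *\<^sub>R b))"
    proof (rule integrableI_bounded_set[where A=C and B=B'])
      show "(\<lambda>x. f (x + t n *\<^sub>R b)) \<in> borel_measurable lebesgue"
        by (rule measurable_completion) measurable
    qed (use C B' fsC bounded_emeasure_finite[OF C(2,1)] in auto)
    show ?thesis unfolding q_def using i1 i2 lebesgue_integral_shift[OF fb, of "t n *\<^sub>R b"] by simp
  qed
  then show ?thesis using lim by (simp add: LIMSEQ_const_iff)
qed

lemma integral_by_parts:
  fixes u w :: "'a::euclidean_space \<Rightarrow> real"
  assumes u: "lip_grad u g" and w: "lip_grad w h" and S: "bounded S" and 0: "\<And>x. x \<notin> S \<Longrightarrow> w x = 0"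
    and h0: "\<And>x. x \<notin> S \<Longrightarrow> h x = 0" and Sm: "S \<in> sets lebesgue"
  shows "(LINT x|lebesgue. u x * (h x \<bullet> b)) = - (LINT x|lebesgue. (g x \<bullet> b) * w x)"
proof -
  have "(LINT x|lebesgue. (u x *\<^sub>R h x + w x *\<^sub>R g x) \<bullet> b) = 0"
    by (rule integral_gradient_eq_0[OF lip_grad_mult[OF u w S 0] S]) (auto simp: 0)
  moreover have "integrable lebesgue (\<lambda>x. u x * (h x \<bullet> b))"
  proof -
    obtain B where B: "B \<ge> 0" "\<And>x. x \<in> S \<Longrightarrow> \<bar>u x\<bar> \<le> B" using lip_bounded[OF lip_grad_lip[OF u] S] by blast
    obtain L where L: "L \<ge> 0" "AE x in lebesgue. norm (h x) \<le> L" using lip_grad_bounded[OF w] by blast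
    show ?thesis
    proof (rule integrableI_bounded_set[where A=S and B="B * (L * norm b)"])
      show "emeasure lebesgue S < \<infinity>"
        by (rule bounded_emeasure_finite[OF S Sm])
      show "(\<lambda>x. u x * (h x \<bullet> b)) \<in> borel_measurable lebesgue"
        using lip_grad_measurable[OF w] lip_measurable_lebesgue[OF lip_grad_lip[OF u]] by simp
      show "AE x in lebesgue. x \<in> S \<longrightarrow> norm (u x * (h x \<bullet> b)) \<le> B * (L * norm b)"
        using L(2)
      proof eventually_elim
        case (elim x)
        have "\<bar>h x \<bullet> b\<bar> \<le> L * norm b"
          using Cauchy_Schwarz_ineq2[of "h x" b] mult_right_mono[OF elim, of "norm b"] by simp
        then show ?case using B by (auto simp: abs_mult intro!: mult_mono)
      qed
    qed (use Sm h0 in auto)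
  qed
  moreover have "integrable lebesgue (\<lambda>x. (g x \<bullet> b) * w x)"
  proof -
    obtain B where B: "B \<ge> 0" "\<And>x. x \<in> S \<Longrightarrow> \<bar>w x\<bar> \<le> B" using lip_bounded[OF lip_grad_lip[OF w] S] by blast
    obtain L where L: "L \<ge> 0" "AE x in lebesgue. norm (g x) \<le> L" using lip_grad_bounded[OF u] by blast
    show ?thesis
    proof (rule integrableI_bounded_set[where A=S and B="(L * norm b) * B"])
      show "emeasure lebesgue S < \<infinity>"
        by (rule bounded_emeasure_finite[OF S Sm])
      show "(\<lambda>x. (g x \<bullet> b) * w x) \<in> borel_measurable lebesgue"
        using lip_grad_measurable[OF u] lip_measurable_lebesgue[OF lip_grad_lip[OF w]] by simp
      show "AE x in lebesgue. x \<in> S \<longrightarrow> norm ((g x \<bullet> b) * w x) \<le> (L * norm b) * B"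
        using L(2)
      proof eventually_elim
        case (elim x)
        have "\<bar>g x \<bullet> b\<bar> \<le> L * norm b"
          using Cauchy_Schwarz_ineq2[of "g x" b] mult_right_mono[OF elim, of "norm b"] by simp
        then show ?case using B by (auto simp: abs_mult intro!: mult_mono)
      qed
    qed (use Sm 0 in auto)
  qed
  ultimately show ?thesis
    by (simp add: inner_add_left mult.commute)
qed

lemma lip_grad_has_weak_grad:
  fixes v w :: "'a::euclidean_space \<Rightarrow> real"
  assumes w: "lip_grad w g" and D: "open D" and eq: "\<And>x. x \<in> D \<Longrightarrow> v x = w x"
  shows "has_weak_grad D v g"
  unfolding has_weak_grad_def
proof (intro conjI ballI)
  have lw: "lip w" using w by (rule lip_grad_lip)
  have Kc: "K \<in> sets lebesgue \<and> bounded K" if "compact K" for K :: "'a set"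
    using that by (auto dest: compact_imp_closed compact_imp_bounded)
  show "loc_integrable D g"
    unfolding loc_integrable_def
  proof safe
    fix K assume K: "compact K" "K \<subseteq> D"
    obtain L where L: "L \<ge> 0" "AE x in lebesgue. norm (g x) \<le> L" using lip_grad_bounded[OF w] by blast
    show "g absolutely_integrable_on K"
      unfolding set_integrable_def
      using integrable_lebesgue_bounded[OF lip_grad_measurable[OF w] _ _ L(2)] Kc[OF K(1)] by blast
  qed
  show "loc_integrable D v"
    unfolding loc_integrable_def
  proof safe
    fix K assume K: "compact K" "K \<subseteq> D"
    obtain B where B: "B \<ge> 0" "\<And>x. x \<in> K \<Longrightarrow> \<bar>w x\<bar> \<le> B" using lip_bounded[OF lw] Kc[OF K(1)] by blast
    have "integrable lebesgue (\<lambda>x. indicator K x *\<^sub>R v x)"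
    proof (rule integrableI_bounded_set[where A=K and B=B])
      have "(\<lambda>x. indicator K x *\<^sub>R v x) = (\<lambda>x. indicator K x *\<^sub>R w x)"
        using K eq by (auto simp: indicator_def fun_eq_iff)
      moreover have "(\<lambda>x. indicator K x *\<^sub>R w x) \<in> borel_measurable lebesgue"
        using Kc[OF K(1)] lip_measurable_lebesgue[OF lw]
        by (intro borel_measurable_scaleR borel_measurable_indicator) auto
      ultimately show "(\<lambda>x. indicator K x *\<^sub>R v x) \<in> borel_measurable lebesgue" by simp
      show "emeasure lebesgue K < \<infinity>"
        using bounded_emeasure_finite Kc[OF K(1)] by blast
      show "AE x in lebesgue. x \<in> K \<longrightarrow> norm (indicator K x *\<^sub>R v x) \<le> B"
        using K B eq by (intro AE_I2) auto
    qed (use Kc[OF K(1)] in auto)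
    then show "v absolutely_integrable_on K" unfolding set_integrable_def .
  qed
  fix \<phi> b assume \<phi>: "\<phi> \<in> test_functions D" and b: "b \<in> (Basis :: 'a set)"
  define K where "K = closure {x. \<phi> x \<noteq> 0}"
  have K: "compact K" "K \<subseteq> D" unfolding K_def by (fact test_functionsD[OF \<phi>])+
  have \<phi>0: "\<phi> x = 0" if "x \<notin> K" for x
    using that closure_subset[of "{x. \<phi> x \<noteq> 0}"] unfolding K_def by blast
  have g0: "gradient \<phi> x = 0" if "x \<notin> K" for x
    using gradient_eq_0 that unfolding K_def by blast
  have \<phi>D: "\<phi> x = 0" "gradient \<phi> x = 0" if "x \<notin> D" for x
    using \<phi>0 g0 K that by blast+
  have Dm: "D \<in> sets lebesgue" using D by simp
  have "(LINT x|lebesgue_on D. v x * frechet_derivative \<phi> (at x) b)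
      = (LINT x|lebesgue. w x * (gradient \<phi> x \<bullet> b))"
    unfolding LINT_lebesgue_on[OF Dm] gradient_inner_Basis[OF b, symmetric]
    by (rule Bochner_Integration.integral_cong[OF refl]) (use \<phi>D eq in \<open>auto simp: indicator_def\<close>)
  also have "\<dots> = - (LINT x|lebesgue. (g x \<bullet> b) * \<phi> x)"
    by (rule integral_by_parts[OF w test_functions_lip_grad[OF \<phi>], where S=K])
      (use Kc[OF K(1)] \<phi>0 g0 in auto)
  also have "(LINT x|lebesgue. (g x \<bullet> b) * \<phi> x) = (LINT x|lebesgue_on D. (g x \<bullet> b) * \<phi> x)"
    unfolding LINT_lebesgue_on[OF Dm]
    by (rule Bochner_Integration.integral_cong[OF refl]) (use \<phi>D in \<open>auto simp: indicator_def\<close>)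
  finally show "(LINT x|lebesgue_on D. v x * frechet_derivative \<phi> (at x) b)
      = - (LINT x|lebesgue_on D. (g x \<bullet> b) * \<phi> x)" .
qed

lemma weak_grad_AE:
  fixes v :: "'a::euclidean_space \<Rightarrow> real"
  assumes D: "open D" and g: "has_weak_grad D v g"
  shows "AE x in lebesgue. x \<in> D \<longrightarrow> weak_grad D v x = g x"
proof -
  have "has_weak_grad D v (weak_grad D v)"
    unfolding weak_grad_def by (rule someI[where P="has_weak_grad D v", OF g])
  then show ?thesis by (rule has_weak_grad_unique[OF D _ g])
qed

section \<open>Mollification\<close>

text \<open>The convolution; the letter \<open>\<rho>\<close> stands for a mollifier.\<close>

definition conv :: "('a::euclidean_space \<Rightarrow> real) \<Rightarrow> ('a \<Rightarrow> real) \<Rightarrow> 'a \<Rightarrow> real" where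
  "conv w \<rho> x = (LINT y|lebesgue. w y * \<rho> (x - y))"

lemma conv_eq_integral:
  assumes w: "continuous_on UNIV w" "\<And>y. y \<notin> cbox a b \<Longrightarrow> w y = 0" and \<rho>: "continuous_on UNIV \<rho>"
  shows "conv w \<rho> x = integral (cbox a b) (\<lambda>y. w y * \<rho> (x - y))"
proof -
  have "continuous_on (cbox a b) (\<lambda>y. w y * \<rho> (x - y))"
    by (intro continuous_intros continuous_on_subset[OF w(1)] continuous_on_compose2[OF \<rho>]) auto
  then have "(\<lambda>y. w y * \<rho> (x - y)) absolutely_integrable_on cbox a b"
    by (rule absolutely_integrable_continuous)
  then have "(LINT y:cbox a b|lebesgue. w y * \<rho> (x - y)) = integral (cbox a b) (\<lambda>y. w y * \<rho> (x - y))"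
    by (rule set_lebesgue_integral_eq_integral)
  moreover have "conv w \<rho> x = (LINT y:cbox a b|lebesgue. w y * \<rho> (x - y))"
    unfolding conv_def set_lebesgue_integral_def
    by (rule Bochner_Integration.integral_cong[OF refl]) (use w(2) in \<open>auto simp: indicator_def\<close>)
  ultimately show ?thesis by simp
qed

lemma conv_has_derivative:
  fixes w \<rho> :: "'a::euclidean_space \<Rightarrow> real"
  assumes w: "continuous_on UNIV w" "\<And>y. y \<notin> cbox a b \<Longrightarrow> w y = 0" and \<rho>: "Ck (Suc 0) \<rho>"
  shows "(conv w \<rho> has_derivative (\<lambda>d. conv w (\<lambda>z. gradient \<rho> z \<bullet> d) x)) (at x)"
proof -
  have \<rho>c: "continuous_on UNIV \<rho>" using Ck_Suc_D[OF \<rho>] by simp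
  have gc: "continuous_on UNIV (gradient \<rho>)" by (rule Ck_continuous_gradient[OF \<rho>])
  let ?f = "\<lambda>x y. w y * \<rho> (x - y)"
  let ?fx = "\<lambda>x y. w y *\<^sub>R blinfun_inner_left (gradient \<rho> (x - y))"
  have cfx: "continuous_on (UNIV \<times> cbox a b) (\<lambda>(x, y). ?fx x y)"
    unfolding split_beta
    by (intro continuous_on_scaleR continuous_on_compose2[OF w(1)] continuous_on_fst continuous_on_snd continuous_on_id
        bounded_linear.continuous_on[OF bounded_linear_blinfun_inner_left]
        continuous_on_compose2[OF gc] continuous_on_diff) auto
  have der: "((\<lambda>x. integral (cbox a b) (?f x)) has_derivative integral (cbox a b) (?fx x)) (at x within UNIV)"
  proof (rule leibniz_rule[OF _ _ cfx])
    fix x y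
    have "((\<lambda>x. \<rho> (x - y)) has_derivative (\<lambda>d. gradient \<rho> (x - y) \<bullet> d)) (at x)"
      by (rule has_derivative_compose[of "\<lambda>x. x - y" "\<lambda>d. d" x UNIV \<rho>, OF _ Ck_has_derivative[OF \<rho>]])
        (auto intro!: derivative_eq_intros)
    from has_derivative_mult_right[OF this, of "w y"]
    have "((\<lambda>x. ?f x y) has_derivative (\<lambda>d. w y * (gradient \<rho> (x - y) \<bullet> d))) (at x)" .
    moreover have "blinfun_apply (?fx x y) = (\<lambda>d. w y * (gradient \<rho> (x - y) \<bullet> d))"
      by (auto simp: fun_eq_iff blinfun.scaleR_left inner_commute)
    ultimately show "((\<lambda>x. ?f x y) has_derivative blinfun_apply (?fx x y)) (at x within UNIV)"
      by simp
  next
    fix x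
    show "?f x integrable_on cbox a b"
      by (rule integrable_continuous)
        (intro continuous_intros continuous_on_subset[OF w(1)] continuous_on_compose2[OF \<rho>c], auto)
  qed auto
  have "blinfun_apply (integral (cbox a b) (?fx x)) = (\<lambda>d. conv w (\<lambda>z. gradient \<rho> z \<bullet> d) x)"
  proof
    fix d
    have "?fx x integrable_on cbox a b"
      by (rule integrable_continuous, rule continuous_on_compose2[OF cfx, of _ "\<lambda>y. (x, y)", unfolded split_beta fst_conv snd_conv])
        (auto intro!: continuous_intros)
    then have "blinfun_apply (integral (cbox a b) (?fx x)) d = integral (cbox a b) (\<lambda>y. w y * (gradient \<rho> (x - y) \<bullet> d))"
      by (simp add: blinfun_apply_integral blinfun.scaleR_left inner_commute)
    also have "\<dots> = conv w (\<lambda>z. gradient \<rho> z \<bullet> d) x"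
      by (rule conv_eq_integral[symmetric, OF w(1)]) (use w(2) gc in \<open>auto intro!: continuous_intros\<close>)
    finally show "blinfun_apply (integral (cbox a b) (?fx x)) d = conv w (\<lambda>z. gradient \<rho> z \<bullet> d) x" .
  qed
  moreover have "conv w \<rho> = (\<lambda>x. integral (cbox a b) (?f x))"
    using conv_eq_integral[OF w \<rho>c] by blast
  ultimately show ?thesis using der by simp
qed

lemma Ck_conv:
  fixes w \<rho> :: "'a::euclidean_space \<Rightarrow> real"
  assumes w: "continuous_on UNIV w" "\<And>y. y \<notin> cbox a b \<Longrightarrow> w y = 0" and \<rho>: "\<And>k. Ck k \<rho>"
  shows "Ck k (conv w \<rho>)"
  using \<rho>
proof (induction k arbitrary: \<rho>)
  case 0
  have "continuous (at x) (conv w \<rho>)" for x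
    by (rule has_derivative_continuous[OF conv_has_derivative[OF w 0]])
  then show ?case by (simp add: continuous_on_eq_continuous_within)
next
  case (Suc k)
  have d: "(conv w \<rho> has_derivative (\<lambda>d. conv w (\<lambda>z. gradient \<rho> z \<bullet> d) x)) (at x)" for x
    by (rule conv_has_derivative[OF w Suc.prems])
  have "Ck k (\<lambda>x. frechet_derivative (conv w \<rho>) (at x) b)" if b: "b \<in> Basis" for b
  proof -
    have "frechet_derivative (conv w \<rho>) (at x) b = conv w (\<lambda>z. frechet_derivative \<rho> (at z) b) x" for x
      using fun_cong[OF frechet_derivative_at[OF d[of x]], of b] by (simp add: gradient_inner_Basis[OF b])
    moreover have "Ck j (\<lambda>z. frechet_derivative \<rho> (at z) b)" for j
      using Suc.prems[of "Suc j"] b by simp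
    ultimately show ?thesis using Suc.IH by simp
  qed
  moreover have "conv w \<rho> differentiable (at x)" for x by (rule differentiableI[OF d])
  ultimately show ?case by simp
qed

lemma gradient_conv:
  fixes w \<rho> :: "'a::euclidean_space \<Rightarrow> real"
  assumes w: "lip_grad w g" "\<And>y. y \<notin> cbox a b \<Longrightarrow> w y = 0" and \<rho>: "\<rho> \<in> test_functions UNIV"
    and i: "i \<in> Basis"
  shows "gradient (conv w \<rho>) x \<bullet> i = conv (\<lambda>y. g y \<bullet> i) \<rho> x"
proof -
  let ?K = "closure {z. \<rho> z \<noteq> 0}"
  have C1: "Ck (Suc 0) \<rho>" and K: "compact ?K" using test_functionsD[OF \<rho>] by blast+
  have wc: "continuous_on UNIV w" using lip_continuous_on[OF lip_grad_lip[OF w(1)]] .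
  have "gradient (conv w \<rho>) x \<bullet> i = conv w (\<lambda>z. gradient \<rho> z \<bullet> i) x"
  proof -
    have "(conv w \<rho> has_derivative (\<lambda>d. conv w (\<lambda>z. gradient \<rho> z \<bullet> d) x)) (at x)"
      by (rule conv_has_derivative[OF wc w(2) C1])
    from fun_cong[OF frechet_derivative_at[OF this], of i] show ?thesis
      by (simp add: gradient_inner_Basis[OF i])
  qed
  also have "\<dots> = - (LINT y|lebesgue. w y * ((-1) *\<^sub>R gradient \<rho> ((-1) *\<^sub>R y + x) \<bullet> i))"
    by (simp add: conv_def)
  also have "\<dots> = - (- (LINT y|lebesgue. (g y \<bullet> i) * \<rho> ((-1) *\<^sub>R y + x)))"
  proof (subst integral_by_parts[OF w(1) lip_grad_affine[OF test_functions_lip_grad[OF \<rho>]],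
        where S="(\<lambda>z. x - z) ` ?K"])
    have "compact ((\<lambda>z. x - z) ` ?K)"
      by (intro compact_continuous_image K continuous_intros)
    then show "bounded ((\<lambda>z. x - z) ` ?K)" "(\<lambda>z. x - z) ` ?K \<in> sets lebesgue"
      by (auto dest: compact_imp_bounded compact_imp_closed)
    fix y assume y: "y \<notin> (\<lambda>z. x - z) ` ?K"
    have "x - y \<notin> ?K" using y image_eqI[of y "\<lambda>z. x - z" "x - y"] by auto
    then show "\<rho> ((-1) *\<^sub>R y + x) = 0" "(-1) *\<^sub>R gradient \<rho> ((-1) *\<^sub>R y + x) = 0"
      using gradient_eq_0[of "x - y" \<rho>] closure_subset[of "{z. \<rho> z \<noteq> 0}"] by auto
  qed auto
  finally show ?thesis by (simp add: conv_def)
qed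

text \<open>Averaging against a probability density keeps a bound on the deviation from a constant.\<close>

lemma conv_close:
  fixes u \<rho> :: "'a::euclidean_space \<Rightarrow> real"
  assumes u: "u \<in> borel_measurable lebesgue"
    and \<rho>: "continuous_on UNIV \<rho>" "\<And>z. \<rho> z \<ge> 0" "(LINT z|lebesgue. \<rho> z) = 1"
    and close: "AE y in lebesgue. \<rho> (x - y) \<noteq> 0 \<longrightarrow> \<bar>u y - c\<bar> \<le> e"
  shows "\<bar>conv u \<rho> x - c\<bar> \<le> e"
proof -
  have \<rho>b: "\<rho> \<in> borel_measurable lebesgue"
    using borel_measurable_continuous_onI[OF \<rho>(1)] by (simp add: measurable_completion)
  define r where "r = (\<lambda>y. \<rho> (x - y))"
  have r1: "(LINT y|lebesgue. r y) = 1" using lebesgue_integral_reflect[OF \<rho>b, of x] \<rho>(3) by (simp add: r_def)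
  then have ri: "integrable lebesgue r" by (metis not_integrable_integral_eq zero_neq_one)
  have ei: "integrable lebesgue (\<lambda>y. (u y - c) * r y)"
  proof (rule Bochner_Integration.integrable_bound[of _ "\<lambda>y. e * r y"])
    show "(\<lambda>y. (u y - c) * r y) \<in> borel_measurable lebesgue"
      using u borel_measurable_integrable[OF ri] by simp
    show "AE y in lebesgue. norm ((u y - c) * r y) \<le> norm (e * r y)"
      using close
    proof eventually_elim
      case (elim y)
      show ?case
      proof (cases "r y = 0")
        case False
        then have "\<bar>u y - c\<bar> \<le> \<bar>e\<bar>" using elim unfolding r_def by linarith
        then show ?thesis by (simp add: abs_mult mult_right_mono)
      qed simp
    qed
  qed (use ri in simp)
  have "conv u \<rho> x = (LINT y|lebesgue. (u y - c) * r y + c * r y)"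
    unfolding conv_def r_def by (simp add: algebra_simps)
  also have "\<dots> = (LINT y|lebesgue. (u y - c) * r y) + c"
    using ei ri r1 by simp
  finally have "\<bar>conv u \<rho> x - c\<bar> = \<bar>LINT y|lebesgue. (u y - c) * r y\<bar>" by simp
  also have "\<dots> \<le> (LINT y|lebesgue. \<bar>(u y - c) * r y\<bar>)"
    by (rule integral_abs_bound)
  also have "\<dots> \<le> (LINT y|lebesgue. e * r y)"
  proof (rule integral_mono_AE)
    show "integrable lebesgue (\<lambda>y. \<bar>(u y - c) * r y\<bar>)" using ei by simp
    show "integrable lebesgue (\<lambda>y. e * r y)" using ri by simp
    show "AE y in lebesgue. \<bar>(u y - c) * r y\<bar> \<le> e * r y"
      using close
    proof eventually_elim
      case (elim y)
      then show ?case using \<rho>(2)[of "x - y"] by (cases "r y = 0") (auto simp: abs_mult r_def mult_right_mono)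
    qed
  qed
  also have "\<dots> = e" using r1 by simp
  finally show ?thesis .
qed

subsection \<open>Convergence in the Sobolev norm\<close>

lemma LINT_lebesgue_on_cong_AE:
  fixes h k :: "'a::euclidean_space \<Rightarrow> real"
  assumes k: "k \<in> borel_measurable lebesgue" and S: "S \<in> sets lebesgue"
    and eq: "AE x in lebesgue. x \<in> S \<longrightarrow> h x = k x"
  shows "(LINT x|lebesgue_on S. h x) = (LINT x|lebesgue_on S. k x)"
proof -
  have km: "(\<lambda>x. indicator S x * k x) \<in> borel_measurable lebesgue"
    using S k by (intro borel_measurable_times borel_measurable_indicator)
  have ae: "AE x in lebesgue. indicator S x * k x = indicator S x * h x"
    using eq by eventually_elim (auto simp: indicator_def)
  show ?thesis
    unfolding LINT_lebesgue_on[OF S]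
    by (rule integral_cong_AE[OF borel_measurable_AE[OF km ae] km]) (use ae in eventually_elim, rule sym)
qed

lemma integrable_on_bounded:
  fixes f :: "'a::euclidean_space \<Rightarrow> real"
  assumes "f \<in> borel_measurable lebesgue" "S \<in> sets lebesgue" "bounded S"
    and "AE x in lebesgue. x \<in> S \<longrightarrow> \<bar>f x\<bar> \<le> B"
  shows "integrable lebesgue (\<lambda>x. indicator S x * f x)"
proof (rule integrableI_bounded_set[where A=S and B=B])
  show "(\<lambda>x. indicator S x * f x) \<in> borel_measurable lebesgue"
    using assms by (intro borel_measurable_times borel_measurable_indicator)
  show "AE x in lebesgue. x \<in> S \<longrightarrow> norm (indicator S x * f x) \<le> B"
    using assms(4) by eventually_elim auto
  show "emeasure lebesgue S < \<infinity>" using bounded_emeasure_finite assms by blast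
qed (use assms in auto)

lemma H1_norm_lip_grad:
  fixes v :: "'a::euclidean_space \<Rightarrow> real"
  assumes w: "lip_grad w g" and D: "open D" and eq: "\<And>x. x \<in> D \<Longrightarrow> v x = w x"
  shows "H1_norm D v = sqrt ((LINT x|lebesgue_on D. (w x)\<^sup>2) + (LINT x|lebesgue_on D. (norm (g x))\<^sup>2))"
proof -
  have Dm: "D \<in> sets lebesgue" using D by simp
  have hw: "has_weak_grad D v g" by (rule lip_grad_has_weak_grad[OF w D]) (rule eq)
  have "(LINT x|lebesgue_on D. (norm (v x))\<^sup>2) = (LINT x|lebesgue_on D. (w x)\<^sup>2)"
    by (rule LINT_lebesgue_on_cong_AE[OF _ Dm])
      (use eq lip_measurable_lebesgue[OF lip_grad_lip[OF w]] in auto)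
  moreover have "(LINT x|lebesgue_on D. (norm (weak_grad D v x))\<^sup>2) = (LINT x|lebesgue_on D. (norm (g x))\<^sup>2)"
  proof (rule LINT_lebesgue_on_cong_AE[OF _ Dm])
    show "(\<lambda>x. (norm (g x))\<^sup>2) \<in> borel_measurable lebesgue" using lip_grad_measurable[OF w] by simp
    show "AE x in lebesgue. x \<in> D \<longrightarrow> (norm (weak_grad D v x))\<^sup>2 = (norm (g x))\<^sup>2"
      using weak_grad_AE[OF D hw] by eventually_elim auto
  qed
  ultimately show ?thesis unfolding H1_norm_def L2_norm_def by (simp add: integral_nonneg_AE)
qed

lemma LINT_square_tendsto_0:
  fixes f :: "nat \<Rightarrow> 'a::euclidean_space \<Rightarrow> 'b::euclidean_space"
  assumes D: "D \<in> sets lebesgue" "bounded D" and f: "\<And>n. f n \<in> borel_measurable lebesgue"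
    and lim: "AE x in lebesgue. (\<lambda>n. f n x) \<longlonglongrightarrow> 0"
    and bd: "\<And>n. AE x in lebesgue. norm (f n x) \<le> B"
  shows "(\<lambda>n. LINT x|lebesgue_on D. (norm (f n x))\<^sup>2) \<longlonglongrightarrow> 0"
proof -
  have "(\<lambda>n. LINT x|lebesgue. indicator D x * (norm (f n x))\<^sup>2) \<longlonglongrightarrow> (LINT x|(lebesgue::'a measure). 0)"
  proof (rule integral_dominated_convergence[where w="\<lambda>x. indicator D x * B\<^sup>2"])
    show "(\<lambda>x. indicator D x * (norm (f n x))\<^sup>2) \<in> borel_measurable lebesgue" for n
      using D f by (intro borel_measurable_times borel_measurable_indicator) auto
    show "integrable lebesgue (\<lambda>x. indicator D x * B\<^sup>2)"
      by (rule integrable_on_bounded[where B="B\<^sup>2"]) (use D in auto)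
    show "AE x in lebesgue. (\<lambda>n. indicator D x * (norm (f n x))\<^sup>2) \<longlonglongrightarrow> 0"
      using lim
    proof eventually_elim
      case (elim x)
      have "(\<lambda>n. indicator D x * (norm (f n x))\<^sup>2) \<longlonglongrightarrow> indicator D x * (norm (0::'b))\<^sup>2"
        by (intro tendsto_intros elim)
      then show ?case by simp
    qed
    show "AE x in lebesgue. norm (indicator D x * (norm (f n x))\<^sup>2) \<le> indicator D x * B\<^sup>2" for n
      using bd[of n] by eventually_elim (auto simp: indicator_def intro!: power_mono)
  qed simp
  then show ?thesis by (simp add: LINT_lebesgue_on[OF D(1)])
qed

lemma lip_grad_in_H1:
  fixes v :: "'a::euclidean_space \<Rightarrow> real"
  assumes w: "lip_grad w g" and D: "open D" "bounded D"
  shows "w \<in> H1 D"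
proof -
  have Dm: "D \<in> sets lebesgue" using D by simp
  obtain B where B: "B \<ge> 0" "\<And>x. x \<in> D \<Longrightarrow> \<bar>w x\<bar> \<le> B" using lip_bounded[OF lip_grad_lip[OF w] D(2)] by blast
  obtain L where L: "L \<ge> 0" "AE x in lebesgue. norm (g x) \<le> L" using lip_grad_bounded[OF w] by blast
  have wm: "w \<in> borel_measurable lebesgue" using lip_measurable_lebesgue[OF lip_grad_lip[OF w]] .
  have gm: "g \<in> borel_measurable lebesgue" using lip_grad_measurable[OF w] .
  have "integrable lebesgue (\<lambda>x. indicator D x * (norm (w x))\<^sup>2)"
  proof (rule integrable_on_bounded[OF _ Dm D(2), where B="B\<^sup>2"])
    show "AE x in lebesgue. x \<in> D \<longrightarrow> \<bar>(norm (w x))\<^sup>2\<bar> \<le> B\<^sup>2"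
      using B by (intro AE_I2) (auto simp: abs_le_square_iff[symmetric])
  qed (use wm in simp)
  moreover have "integrable lebesgue (\<lambda>x. indicator D x * (norm (g x))\<^sup>2)"
  proof (rule integrable_on_bounded[OF _ Dm D(2), where B="L\<^sup>2"])
    show "AE x in lebesgue. x \<in> D \<longrightarrow> \<bar>(norm (g x))\<^sup>2\<bar> \<le> L\<^sup>2"
      using L(2) by eventually_elim (auto intro!: power_mono)
  qed (use gm in simp)
  ultimately have "w \<in> L2 D" "g \<in> L2 D"
    using Dm measurable_restrict_space1[OF wm, of D] measurable_restrict_space1[OF gm, of D]
    by (auto simp: L2_def integrable_restrict_space)
  then show ?thesis
    unfolding H1_def using lip_grad_has_weak_grad[OF w D(1)] by blast
qed

text \<open>Mollifiers with shrinking supports.\<close>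

lemma mollifier_exists:
  assumes "\<epsilon> > 0"
  shows "\<exists>\<rho>::'a::euclidean_space \<Rightarrow> real. \<rho> \<in> test_functions UNIV \<and> (\<forall>z. \<rho> z \<ge> 0) \<and>
    (LINT z|lebesgue. \<rho> z) = 1 \<and> (\<forall>z. \<rho> z \<noteq> 0 \<longrightarrow> norm z < \<epsilon>)"
proof -
  obtain a b :: 'a where ab: "0 \<in> box a b" "box a b \<subseteq> ball 0 \<epsilon>"
    using rational_boxes[OF assms, of "0::'a"] by blast
  let ?b = "box_bump a b"
  have tf: "?b \<in> test_functions UNIV" by (rule box_bump_test_functions) simp
  have "lip ?b" using lip_grad_lip[OF test_functions_lip_grad[OF tf]] .
  then have m: "?b \<in> borel_measurable lebesgue" by (rule lip_measurable_lebesgue)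
  obtain B where B: "B \<ge> 0" "\<And>x. x \<in> box a b \<Longrightarrow> \<bar>?b x\<bar> \<le> B"
    using lip_bounded[OF \<open>lip ?b\<close> bounded_box] by blast
  have int: "integrable lebesgue ?b"
  proof (rule integrableI_bounded_set[where A="box a b" and B=B])
    show "AE x in lebesgue. x \<notin> box a b \<longrightarrow> ?b x = 0" using box_bump_eq_0[of _ a b] by (intro AE_I2) blast
  qed (use m B in \<open>auto simp: emeasure_lborel_box_eq\<close>)
  have "(LINT z|lebesgue. ?b z) \<noteq> 0"
  proof
    assume "(LINT z|lebesgue. ?b z) = 0"
    then have ae: "AE z in lebesgue. ?b z = 0"
      using integral_nonneg_eq_0_iff_AE[OF int] box_bump_nonneg by auto
    have "AE z in lebesgue. z \<notin> box a b"
      using ae by eventually_elim (use box_bump_pos_iff in force)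
    then have "box a b \<in> null_sets lebesgue" by (simp add: AE_iff_null_sets)
    then have "negligible (box a b)" by (simp add: negligible_iff_null_sets)
    then show False using ab negligible_interval(2)[of a b] by auto
  qed
  moreover have "(LINT z|lebesgue. ?b z) \<ge> 0" by (simp add: box_bump_nonneg)
  ultimately have c: "(LINT z|lebesgue. ?b z) > 0" by simp
  define \<rho> where "\<rho> = (\<lambda>z. inverse (LINT z|lebesgue. ?b z) * ?b z)"
  have r0: "\<rho> z = 0" if "z \<notin> box a b" for z using box_bump_eq_0[OF that] by (simp add: \<rho>_def)
  have "\<rho> \<in> test_functions UNIV"
  proof (rule test_functionsI[where K="cbox a b"])
    show "Ck k \<rho>" for k unfolding \<rho>_def by (intro Ck_mult Ck_const Ck_box_bump)
  qed (use r0 box_subset_cbox in auto)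
  moreover have "\<rho> z \<ge> 0" for z using c box_bump_nonneg[of a b z] by (simp add: \<rho>_def)
  moreover have "(LINT z|lebesgue. \<rho> z) = 1" using c by (simp add: \<rho>_def)
  moreover have "norm z < \<epsilon>" if "\<rho> z \<noteq> 0" for z using r0[of z] that subsetD[OF ab(2), of z] by auto
  ultimately show ?thesis by blast
qed

lemma lip_grad_in_H10:
  fixes w :: "'a::euclidean_space \<Rightarrow> real"
  assumes w: "lip_grad w g" and D: "open D" "bounded D" and K: "compact K" "K \<subseteq> D"
    and 0: "\<And>x. x \<notin> K \<Longrightarrow> w x = 0"
  shows "w \<in> H10 D"
proof -
  have Dm: "D \<in> sets lebesgue" using D by simp
  have lw: "lip w" using w by (rule lip_grad_lip)
  obtain G where G: "open G" "negligible (- G)" "continuous_on G g"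
    "\<And>x. x \<in> G \<Longrightarrow> (w has_derivative (\<lambda>d. g x \<bullet> d)) (at x)" using lip_gradE[OF w] by blast
  obtain L where L: "L \<ge> 0" "\<And>x y. \<bar>w x - w y\<bar> \<le> L * norm (x - y)" using lipE[OF lw] by blast
  obtain M where M: "M \<ge> 0" "AE x in lebesgue. norm (g x) \<le> M" using lip_grad_bounded[OF w] by blast
  obtain \<delta> where \<delta>: "\<delta> > 0" "(\<Union>x\<in>K. cball x \<delta>) \<subseteq> D"
    using compact_subset_open_imp_cball_epsilon_subset[OF K(1) D(1) K(2)] by blast
  obtain a b where ab: "K \<subseteq> cbox a b"
    using bounded_subset_cbox_symmetric[OF compact_imp_bounded[OF K(1)]] by blast
  have w0: "w y = 0" if "y \<notin> cbox a b" for y using 0 ab that by blast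
  define \<epsilon> where "\<epsilon> = (\<lambda>n. \<delta> * inverse (real (Suc n)))"
  have \<epsilon>: "\<epsilon> n > 0" "\<epsilon> n \<le> \<delta>" for n using \<delta>(1) by (auto simp: \<epsilon>_def field_simps)
  have \<epsilon>0: "\<epsilon> \<longlonglongrightarrow> 0" unfolding \<epsilon>_def using tendsto_mult_right_zero[OF LIMSEQ_inverse_real_of_nat] by blast
  have "\<forall>n. \<exists>\<rho>::'a \<Rightarrow> real. \<rho> \<in> test_functions UNIV \<and> (\<forall>z. \<rho> z \<ge> 0) \<and>
    (LINT z|lebesgue. \<rho> z) = 1 \<and> (\<forall>z. \<rho> z \<noteq> 0 \<longrightarrow> norm z < \<epsilon> n)"
    using mollifier_exists \<epsilon>(1) by blast
  then obtain \<rho> where \<rho>: "\<And>n. \<rho> n \<in> test_functions (UNIV :: 'a set)" "\<And>n z. \<rho> n z \<ge> 0"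
    "\<And>n. (LINT z|lebesgue. \<rho> n z) = 1" "\<And>n z. \<rho> n z \<noteq> 0 \<Longrightarrow> norm z < \<epsilon> n"
    by metis
  have \<rho>c: "continuous_on UNIV (\<rho> n)" for n using test_functionsD(3)[OF \<rho>(1), of 0] by simp
  define \<phi> where "\<phi> = (\<lambda>n. conv w (\<rho> n))"
  have wm: "w \<in> borel_measurable lebesgue" using lip_measurable_lebesgue[OF lw] .
  have \<phi>close: "\<bar>\<phi> n x - w x\<bar> \<le> L * \<epsilon> n" for n x
    unfolding \<phi>_def
  proof (rule conv_close[OF wm \<rho>c \<rho>(2,3)], intro AE_I2 impI)
    fix y assume "\<rho> n (x - y) \<noteq> 0"
    then have "norm (y - x) \<le> \<epsilon> n" using \<rho>(4) by (fastforce simp: norm_minus_commute)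
    then show "\<bar>w y - w x\<bar> \<le> L * \<epsilon> n"
      using L(2)[of y x] mult_left_mono[OF _ L(1), of "norm (y - x)" "\<epsilon> n"] by linarith
  qed
  have \<phi>tf: "\<phi> n \<in> test_functions D" for n
  proof (rule test_functionsI)
    show "Ck k (\<phi> n)" for k
      unfolding \<phi>_def by (rule Ck_conv[OF lip_continuous_on[OF lw] w0 test_functionsD(3)[OF \<rho>(1)]])
    have "(\<Union>x\<in>K. cball x \<delta>) = {x + y |x y. x \<in> K \<and> y \<in> cball 0 \<delta>}"
    proof safe
      fix x z assume "x \<in> K" "z \<in> cball x \<delta>"
      then show "\<exists>u v. z = u + v \<and> u \<in> K \<and> v \<in> cball 0 \<delta>"
        by (intro exI[of _ x] exI[of _ "z - x"]) (auto simp: dist_norm norm_minus_commute)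
    next
      fix x y :: 'a assume "x \<in> K" "y \<in> cball 0 \<delta>"
      then show "x + y \<in> (\<Union>x\<in>K. cball x \<delta>)" by (intro UN_I[of x]) (auto simp: dist_norm)
    qed
    then show "compact (\<Union>x\<in>K. cball x \<delta>)" using compact_sums[OF K(1) compact_cball[of 0 \<delta>]] by simp
    show "(\<Union>x\<in>K. cball x \<delta>) \<subseteq> D" by fact
    fix x assume x: "x \<notin> (\<Union>x\<in>K. cball x \<delta>)"
    have "w y * \<rho> n (x - y) = 0" for y
    proof (rule ccontr)
      assume "w y * \<rho> n (x - y) \<noteq> 0"
      then have "y \<in> K" "norm (x - y) < \<epsilon> n" using 0 \<rho>(4) by auto
      then have "x \<in> cball y \<delta>" using \<epsilon>(2)[of n] by (auto simp: dist_norm norm_minus_commute)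
      then show False using x \<open>y \<in> K\<close> by blast
    qed
    then have "(\<lambda>y. w y * \<rho> n (x - y)) = (\<lambda>y. 0)" by (rule ext)
    then show "\<phi> n x = 0" by (simp only: \<phi>_def conv_def Bochner_Integration.integral_zero)
  qed
  \<comment> \<open>The gradient of the mollification is the mollified gradient: it inherits the bound and converges where the
    gradient is continuous.\<close>
  have g\<phi>: "gradient (\<phi> n) x \<bullet> i = conv (\<lambda>y. g y \<bullet> i) (\<rho> n) x" if "i \<in> Basis" for n x i
    unfolding \<phi>_def by (rule gradient_conv[OF w w0 \<rho>(1) that])
  have gm: "(\<lambda>y. g y \<bullet> i) \<in> borel_measurable lebesgue" for i
    using lip_grad_measurable[OF w] by simp
  have g\<phi>bd: "norm (gradient (\<phi> n) x) \<le> DIM('a) * M" for n x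
  proof -
    have "\<bar>gradient (\<phi> n) x \<bullet> i\<bar> \<le> M" if i: "i \<in> Basis" for i
    proof -
      have "\<bar>conv (\<lambda>y. g y \<bullet> i) (\<rho> n) x - 0\<bar> \<le> M"
      proof (rule conv_close[OF gm \<rho>c \<rho>(2,3)])
        show "AE y in lebesgue. \<rho> n (x - y) \<noteq> 0 \<longrightarrow> \<bar>g y \<bullet> i - 0\<bar> \<le> M"
          using M(2) by eventually_elim (use Basis_le_norm[OF i] order_trans in auto)
      qed
      then show ?thesis using g\<phi>[OF i] by simp
    qed
    then have "(\<Sum>i\<in>Basis. \<bar>gradient (\<phi> n) x \<bullet> i\<bar>) \<le> of_nat (DIM('a)) * M"
      by (intro sum_bounded_above) auto
    then show ?thesis using norm_le_l1[of "gradient (\<phi> n) x"] by simp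
  qed
  have g\<phi>lim: "(\<lambda>n. gradient (\<phi> n) x) \<longlonglongrightarrow> g x" if x: "x \<in> G" for x
  proof (subst tendsto_componentwise_iff, intro ballI LIMSEQ_I)
    fix i :: 'a and e :: real assume i: "i \<in> Basis" and e: "e > 0"
    have "continuous (at x) g" using G(1,3) x by (simp add: continuous_on_eq_continuous_at)
    then obtain d where d: "d > 0" "\<And>y. dist y x < d \<Longrightarrow> dist (g y) (g x) < e / 2"
      unfolding continuous_at_eps_delta using e by (meson half_gt_zero)
    obtain n0 where n0: "\<And>n. n \<ge> n0 \<Longrightarrow> \<epsilon> n < d"
      using LIMSEQ_D[OF \<epsilon>0 d(1)] \<epsilon>(1) by (metis abs_of_pos diff_zero real_norm_def)
    have "norm (gradient (\<phi> n) x \<bullet> i - g x \<bullet> i) < e" if n: "n \<ge> n0" for n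
    proof -
      have "\<bar>conv (\<lambda>y. g y \<bullet> i) (\<rho> n) x - g x \<bullet> i\<bar> \<le> e / 2"
      proof (rule conv_close[OF gm \<rho>c \<rho>(2,3)], intro AE_I2 impI)
        fix y assume "\<rho> n (x - y) \<noteq> 0"
        then have "norm (x - y) < \<epsilon> n" by (rule \<rho>(4))
        then have "dist y x < d" using n0[OF n] by (simp add: dist_norm norm_minus_commute)
        then have "norm (g y - g x) < e / 2" using d(2) by (simp add: dist_norm)
        then show "\<bar>g y \<bullet> i - g x \<bullet> i\<bar> \<le> e / 2"
          using Basis_le_norm[OF i, of "g y - g x"] by (simp add: inner_diff_left)
      qed
      then show ?thesis using e by (simp add: g\<phi>[OF i])
    qed
    then show "\<exists>n0. \<forall>n\<ge>n0. norm (gradient (\<phi> n) x \<bullet> i - g x \<bullet> i) < e" by blast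
  qed
  have lg: "lip_grad (\<lambda>x. w x - \<phi> n x) (\<lambda>x. g x - gradient (\<phi> n) x)" for n
    by (rule lip_grad_diff[OF w test_functions_lip_grad[OF \<phi>tf]])
  have 1: "(\<lambda>n. LINT x|lebesgue_on D. (norm (w x - \<phi> n x))\<^sup>2) \<longlonglongrightarrow> 0"
  proof (rule LINT_square_tendsto_0[OF Dm D(2)])
    show "(\<lambda>x. w x - \<phi> n x) \<in> borel_measurable lebesgue" for n
      by (rule lip_measurable_lebesgue[OF lip_grad_lip[OF lg]])
    show "AE x in lebesgue. (\<lambda>n. w x - \<phi> n x) \<longlonglongrightarrow> 0"
    proof (rule AE_I2)
      fix x
      have "(\<lambda>n. L * \<epsilon> n) \<longlonglongrightarrow> 0" using tendsto_mult_right_zero[OF \<epsilon>0] by blast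
      then show "(\<lambda>n. w x - \<phi> n x) \<longlonglongrightarrow> 0"
        by (rule Lim_null_comparison[rotated]) (use \<phi>close in \<open>auto simp: abs_minus_commute\<close>)
    qed
    show "AE x in lebesgue. norm (w x - \<phi> n x) \<le> L * \<delta>" for n
    proof (rule AE_I2)
      show "norm (w x - \<phi> n x) \<le> L * \<delta>" for x
        using \<phi>close[of n x] mult_left_mono[OF \<epsilon>(2)[of n] L(1)] by (simp add: abs_minus_commute)
    qed
  qed
  have 2: "(\<lambda>n. LINT x|lebesgue_on D. (norm (g x - gradient (\<phi> n) x))\<^sup>2) \<longlonglongrightarrow> 0"
  proof (rule LINT_square_tendsto_0[OF Dm D(2)])
    show "(\<lambda>x. g x - gradient (\<phi> n) x) \<in> borel_measurable lebesgue" for n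
      by (rule lip_grad_measurable[OF lg])
    show "AE x in lebesgue. (\<lambda>n. g x - gradient (\<phi> n) x) \<longlonglongrightarrow> 0"
      using negligible_compl_AE[OF G(2)]
    proof eventually_elim
      case (elim x)
      show ?case using tendsto_diff[OF tendsto_const g\<phi>lim[OF elim], of "g x"] by simp
    qed
    show "AE x in lebesgue. norm (g x - gradient (\<phi> n) x) \<le> M + DIM('a) * M" for n
      using M(2)
    proof eventually_elim
      case (elim x)
      then show ?case using g\<phi>bd[of n x] norm_triangle_ineq4[of "g x" "gradient (\<phi> n) x"] by linarith
    qed
  qed
  have "(\<lambda>n. H1_norm D (\<lambda>x. w x - \<phi> n x)) \<longlonglongrightarrow> 0"
    unfolding H1_norm_lip_grad[OF lg D(1) refl]
    using tendsto_real_sqrt[OF tendsto_add[OF 1 2]] by simp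
  then show ?thesis
    unfolding H10_def using lip_grad_in_H1[OF w D] \<phi>tf by blast
qed

section \<open>Boundary values\<close>

text \<open>Against a Lipschitz weight, functions in \<open>H10\<close> can be integrated by parts without a boundary
  term, although the weight need not vanish on the boundary.\<close>

lemma H10_integral_by_parts:
  fixes v V \<zeta> :: "'a::euclidean_space \<Rightarrow> real"
  assumes v: "v \<in> H10 D" and D: "open D" "bounded D"
    and V: "lip_grad V g" and eq: "\<And>x. x \<in> D \<Longrightarrow> v x = V x" and z: "lip_grad \<zeta> h" and b: "norm b \<le> 1"
  shows "(LINT x|lebesgue_on D. \<zeta> x * (g x \<bullet> b) + (h x \<bullet> b) * V x) = 0"
proof -
  have Dm: "D \<in> sets lebesgue" using D by simp
  obtain \<phi> where \<phi>: "\<And>n. \<phi> n \<in> test_functions D"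
    and lim: "(\<lambda>n. H1_norm D (\<lambda>x. v x - \<phi> n x)) \<longlonglongrightarrow> 0"
    using v unfolding H10_def by blast
  define d where "d = (\<lambda>n x. V x - \<phi> n x)"
  define e where "e = (\<lambda>n x. g x - gradient (\<phi> n) x)"
  have de: "lip_grad (d n) (e n)" for n
    unfolding d_def e_def by (rule lip_grad_diff[OF V test_functions_lip_grad[OF \<phi>]])
  define Q where "Q = (\<lambda>n. (LINT x|lebesgue_on D. (d n x)\<^sup>2) + (LINT x|lebesgue_on D. (norm (e n x))\<^sup>2))"
  have "H1_norm D (\<lambda>x. v x - \<phi> n x) = sqrt (Q n)" for n
    unfolding Q_def by (rule H1_norm_lip_grad[OF de D(1)]) (simp add: d_def eq)
  with lim have "(\<lambda>n. sqrt (Q n)) \<longlonglongrightarrow> 0" by simp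
  then have "(\<lambda>n. (sqrt (Q n))\<^sup>2) \<longlonglongrightarrow> 0\<^sup>2" by (intro tendsto_intros)
  moreover have "Q n \<ge> 0" for n unfolding Q_def by (simp add: integral_nonneg_AE)
  ultimately have Q0: "Q \<longlonglongrightarrow> 0" by simp
  have intg: "integrable (lebesgue_on D) (\<lambda>x. F x * (G x \<bullet> b))"
    if F: "lip F" and G: "lip_grad H G" for F H :: "'a \<Rightarrow> real" and G
  proof -
    obtain B where B: "B \<ge> 0" "\<And>x. x \<in> D \<Longrightarrow> \<bar>F x\<bar> \<le> B" using lip_bounded[OF F D(2)] by blast
    obtain L where L: "L \<ge> 0" "AE x in lebesgue. norm (G x) \<le> L" using lip_grad_bounded[OF G] by blast
    have "integrable lebesgue (\<lambda>x. indicator D x * (F x * (G x \<bullet> b)))"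
    proof (rule integrable_on_bounded[OF _ Dm D(2), where B="B * L"])
      show "(\<lambda>x. F x * (G x \<bullet> b)) \<in> borel_measurable lebesgue"
        using lip_measurable_lebesgue[OF F] lip_grad_measurable[OF G] by simp
      show "AE x in lebesgue. x \<in> D \<longrightarrow> \<bar>F x * (G x \<bullet> b)\<bar> \<le> B * L"
        using L(2)
      proof eventually_elim
        case (elim x)
        have "\<bar>G x \<bullet> b\<bar> \<le> norm (G x) * norm b" by (rule Cauchy_Schwarz_ineq2)
        also have "\<dots> \<le> L * 1" by (intro mult_mono elim b L) auto
        finally show ?case using B by (auto simp: abs_mult intro!: mult_mono)
      qed
    qed
    then show ?thesis using Dm by (simp add: integrable_restrict_space)
  qed
  have sq: "integrable (lebesgue_on D) (\<lambda>x. (F x)\<^sup>2)" if F: "lip F" for F :: "'a \<Rightarrow> real"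
  proof -
    obtain B where B: "B \<ge> 0" "\<And>x. x \<in> D \<Longrightarrow> \<bar>F x\<bar> \<le> B" using lip_bounded[OF F D(2)] by blast
    have "integrable lebesgue (\<lambda>x. indicator D x * (F x)\<^sup>2)"
    proof (rule integrable_on_bounded[OF _ Dm D(2), where B="B\<^sup>2"])
      show "AE x in lebesgue. x \<in> D \<longrightarrow> \<bar>(F x)\<^sup>2\<bar> \<le> B\<^sup>2"
        using B by (intro AE_I2) (auto simp: abs_le_square_iff[symmetric])
    qed (use lip_measurable_lebesgue[OF F] in simp)
    then show ?thesis using Dm by (simp add: integrable_restrict_space)
  qed
  have nsq: "integrable (lebesgue_on D) (\<lambda>x. (norm (G x))\<^sup>2)" if G: "lip_grad H G" for H :: "'a \<Rightarrow> real" and G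
  proof -
    obtain L where L: "L \<ge> 0" "AE x in lebesgue. norm (G x) \<le> L" using lip_grad_bounded[OF G] by blast
    have "integrable lebesgue (\<lambda>x. indicator D x * (norm (G x))\<^sup>2)"
    proof (rule integrable_on_bounded[OF _ Dm D(2), where B="L\<^sup>2"])
      show "AE x in lebesgue. x \<in> D \<longrightarrow> \<bar>(norm (G x))\<^sup>2\<bar> \<le> L\<^sup>2"
        using L(2) by eventually_elim (auto intro!: power_mono)
    qed (use lip_grad_measurable[OF G] in simp)
    then show ?thesis using Dm by (simp add: integrable_restrict_space)
  qed
  define I where "I = (LINT x|lebesgue_on D. \<zeta> x * (g x \<bullet> b) + (h x \<bullet> b) * V x)"
  define A where "A = (LINT x|lebesgue_on D. (\<zeta> x)\<^sup>2 + (norm (h x))\<^sup>2)"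
  have lz: "lip \<zeta>" and lV: "lip V" and ld: "\<And>n. lip (d n)" and l\<phi>: "\<And>n. lip (\<phi> n)"
    using z V de test_functions_lip_grad[OF \<phi>] lip_grad_lip by blast+
  have Id: "I = (LINT x|lebesgue_on D. \<zeta> x * (e n x \<bullet> b) + d n x * (h x \<bullet> b))" for n
  proof -
    let ?K = "closure {x. \<phi> n x \<noteq> 0}"
    have K: "compact ?K" "?K \<subseteq> D" by (fact test_functionsD[OF \<phi>])+
    have k0: "\<phi> n x = 0" "gradient (\<phi> n) x = 0" if "x \<notin> ?K" for x
      using that closure_subset[of "{x. \<phi> n x \<noteq> 0}"] gradient_eq_0[of x "\<phi> n"] by blast+
    have kD: "\<phi> n x = 0" "gradient (\<phi> n) x = 0" if "x \<notin> D" for x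
      using that k0 K(2) by blast+
    have "(LINT x|lebesgue. \<zeta> x * (gradient (\<phi> n) x \<bullet> b)) = - (LINT x|lebesgue. (h x \<bullet> b) * \<phi> n x)"
    proof (rule integral_by_parts[OF z test_functions_lip_grad[OF \<phi>[of n]] compact_imp_bounded[OF K(1)]])
      show "?K \<in> sets lebesgue" by simp
    qed (fact k0)+
    moreover have "(LINT x|lebesgue. \<zeta> x * (gradient (\<phi> n) x \<bullet> b)) = (LINT x|lebesgue_on D. \<zeta> x * (gradient (\<phi> n) x \<bullet> b))"
      unfolding LINT_lebesgue_on[OF Dm]
      by (rule Bochner_Integration.integral_cong[OF refl]) (use kD in \<open>auto simp: indicator_def\<close>)
    moreover have "(LINT x|lebesgue. (h x \<bullet> b) * \<phi> n x) = (LINT x|lebesgue_on D. \<phi> n x * (h x \<bullet> b))"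
      unfolding LINT_lebesgue_on[OF Dm]
      by (rule Bochner_Integration.integral_cong[OF refl]) (use kD in \<open>auto simp: indicator_def\<close>)
    ultimately have "(LINT x|lebesgue_on D. \<zeta> x * (gradient (\<phi> n) x \<bullet> b) + \<phi> n x * (h x \<bullet> b)) = 0"
      using intg[OF lz test_functions_lip_grad[OF \<phi>, of n]] intg[OF l\<phi>[of n] z] by simp
    moreover have "I = (LINT x|lebesgue_on D. (\<zeta> x * (gradient (\<phi> n) x \<bullet> b) + \<phi> n x * (h x \<bullet> b))
        + (\<zeta> x * (e n x \<bullet> b) + d n x * (h x \<bullet> b)))"
      unfolding I_def d_def e_def by (simp add: algebra_simps)
    ultimately show ?thesis
      using intg[OF lz test_functions_lip_grad[OF \<phi>, of n]] intg[OF l\<phi>[of n] z] intg[OF lz de[of n]] intg[OF ld[of n] z]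
      by simp
  qed
  \<comment> \<open>Young's inequality with a small parameter, followed by the limit along the approximating sequence.\<close>
  have bound: "\<bar>I\<bar> \<le> \<delta> / 2 * A + Q n / (2 * \<delta>)" if \<delta>: "\<delta> > 0" for \<delta> n
  proof -
    have young: "\<bar>p * q\<bar> \<le> \<delta> / 2 * p\<^sup>2 + q\<^sup>2 / (2 * \<delta>)" for p q :: real
    proof -
      have "0 \<le> (\<delta> * \<bar>p\<bar> - \<bar>q\<bar>)\<^sup>2 / (2 * \<delta>)" using \<delta> by simp
      also have "\<dots> = \<delta> / 2 * p\<^sup>2 + q\<^sup>2 / (2 * \<delta>) - \<bar>p * q\<bar>"
        using \<delta> by (simp add: power2_diff abs_mult field_simps power2_eq_square)
      finally show ?thesis by simp
    qed
    have ib: "\<bar>y \<bullet> b\<bar> \<le> norm y" for y :: 'a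
      using Cauchy_Schwarz_ineq2[of y b] mult_left_mono[OF b, of "norm y"] by simp
    have ib2: "(y \<bullet> b)\<^sup>2 \<le> (norm y)\<^sup>2" for y :: 'a
      using ib[of y] by (simp add: abs_le_square_iff[symmetric])
    have pt: "\<bar>\<zeta> x * (e n x \<bullet> b) + d n x * (h x \<bullet> b)\<bar>
        \<le> \<delta> / 2 * ((\<zeta> x)\<^sup>2 + (norm (h x))\<^sup>2) + ((d n x)\<^sup>2 + (norm (e n x))\<^sup>2) / (2 * \<delta>)" for x
    proof -
      have "\<delta> / 2 * (h x \<bullet> b)\<^sup>2 \<le> \<delta> / 2 * (norm (h x))\<^sup>2" using \<delta> ib2 by (intro mult_left_mono) auto
      moreover have "(e n x \<bullet> b)\<^sup>2 / (2 * \<delta>) \<le> (norm (e n x))\<^sup>2 / (2 * \<delta>)" using \<delta> ib2 by (intro divide_right_mono) auto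
      moreover note young[of "\<zeta> x" "e n x \<bullet> b"] young[of "h x \<bullet> b" "d n x"]
      ultimately show ?thesis unfolding ring_distribs add_divide_distrib
        using abs_triangle_ineq[of "\<zeta> x * (e n x \<bullet> b)" "d n x * (h x \<bullet> b)"] by (simp add: mult.commute)
    qed
    have "\<bar>I\<bar> \<le> (LINT x|lebesgue_on D. \<bar>\<zeta> x * (e n x \<bullet> b) + d n x * (h x \<bullet> b)\<bar>)"
      unfolding Id[of n] by (rule integral_abs_bound)
    also have "\<dots> \<le> (LINT x|lebesgue_on D. \<delta> / 2 * ((\<zeta> x)\<^sup>2 + (norm (h x))\<^sup>2) + ((d n x)\<^sup>2 + (norm (e n x))\<^sup>2) / (2 * \<delta>))"
      by (rule integral_mono)
        (use pt intg[OF lz de[of n]] intg[OF ld[of n] z] sq[OF lz] nsq[OF z] sq[OF ld[of n]] nsq[OF de[of n]] in auto)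
    also have "\<dots> = \<delta> / 2 * A + Q n / (2 * \<delta>)"
      unfolding A_def Q_def using sq[OF lz] nsq[OF z] sq[OF ld[of n]] nsq[OF de[of n]] by simp
    finally show ?thesis .
  qed
  have "\<bar>I\<bar> \<le> \<delta> / 2 * A" if \<delta>: "\<delta> > 0" for \<delta>
  proof (rule tendsto_lowerbound)
    have "(\<lambda>n. \<delta> / 2 * A + Q n / (2 * \<delta>)) \<longlonglongrightarrow> \<delta> / 2 * A + 0 / (2 * \<delta>)"
      by (intro tendsto_intros Q0) (use \<delta> in simp)
    then show "(\<lambda>n. \<delta> / 2 * A + Q n / (2 * \<delta>)) \<longlonglongrightarrow> \<delta> / 2 * A" by simp
  qed (use bound[OF \<delta>] in auto)
  then have "\<bar>I\<bar> \<le> 0 + \<epsilon>" if "\<epsilon> > 0" for \<epsilon>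
  proof -
    have A0: "A \<ge> 0" unfolding A_def by (simp add: integral_nonneg_AE)
    have "\<bar>I\<bar> \<le> (\<epsilon> / (A + 1)) / 2 * A" using that A0 \<open>\<And>\<delta>. \<delta> > 0 \<Longrightarrow> \<bar>I\<bar> \<le> \<delta> / 2 * A\<close>[of "\<epsilon> / (A + 1)"] by simp
    also have "\<dots> \<le> \<epsilon>" using that A0 by (simp add: field_simps)
    finally show ?thesis by simp
  qed
  then have "\<bar>I\<bar> \<le> 0" by (rule field_le_epsilon)
  then show ?thesis unfolding I_def by simp
qed

text \<open>A Lipschitz representative of a function in \<open>H10\<close> vanishes at a boundary point lying on a
  supporting hyperplane with unit normal \<open>n\<close>, provided that the strips of width \<open>t\<close> along the hyperplane occupy a
  volume of order \<open>t\<close> near the point: testing with the distance to the inner face of the strip times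
  the function itself bounds the integral of its square over the strip by a multiple of $t^2$.\<close>

lemma H10_trace_zero:
  fixes v V :: "'a::euclidean_space \<Rightarrow> real"
  assumes v: "v \<in> H10 D" and D: "open D" "bounded D"
    and V: "lip_grad V g" and eq: "\<And>x. x \<in> D \<Longrightarrow> v x = V x"
    and S: "bounded S" "\<And>x. x \<notin> S \<Longrightarrow> V x = 0"
    and n: "norm n = 1" and half: "\<And>x. x \<in> D \<Longrightarrow> n \<bullet> x + s < 0"
    and strips: "\<And>r. r > 0 \<Longrightarrow> \<exists>c>0. \<exists>t0>0. \<forall>t. 0 < t \<and> t < t0 \<longrightarrow>
      (\<exists>A\<in>sets lebesgue. A \<subseteq> D \<inter> ball p r \<inter> {x. n \<bullet> x + s + t > 0} \<and> measure lebesgue A \<ge> c * t)"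
  shows "V p = 0"
proof (rule ccontr)
  assume Vp: "V p \<noteq> 0"
  have Dm: "D \<in> sets lebesgue" using D by simp
  have n0: "n \<noteq> 0" using n by auto
  obtain L where L: "L \<ge> 0" "AE x in lebesgue. norm (g x) \<le> L" using lip_grad_bounded[OF V] by blast
  have lV: "lip V" using V by (rule lip_grad_lip)
  have int: "integrable lebesgue (\<lambda>x. indicator D x * (indicator {x. n \<bullet> x + s + t > 0} x * (V x)\<^sup>2))" for t
  proof -
    obtain B where B: "B \<ge> 0" "\<And>x. x \<in> D \<Longrightarrow> \<bar>V x\<bar> \<le> B" using lip_bounded[OF lV D(2)] by blast
    show ?thesis
    proof (rule integrable_on_bounded[OF _ Dm D(2), where B="B\<^sup>2"])
      have "open {x. n \<bullet> x + s + t > 0}" by (intro open_Collect_less continuous_intros)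
      then show "(\<lambda>x. indicator {x. n \<bullet> x + s + t > 0} x * (V x)\<^sup>2) \<in> borel_measurable lebesgue"
        using lip_measurable_lebesgue[OF lV] by (intro borel_measurable_times borel_measurable_indicator) auto
      show "AE x in lebesgue. x \<in> D \<longrightarrow> \<bar>indicator {x. n \<bullet> x + s + t > 0} x * (V x)\<^sup>2\<bar> \<le> B\<^sup>2"
        using B by (intro AE_I2) (auto simp: indicator_def abs_le_square_iff[symmetric])
    qed
  qed
  define C where "C = 4 * L\<^sup>2 * measure lebesgue D"
  have strip: "(LINT x|lebesgue. indicator D x * (indicator {x. n \<bullet> x + s + t > 0} x * (V x)\<^sup>2)) \<le> C * t\<^sup>2"
    if t: "t > 0" for t
  proof -
    let ?P = "{x. n \<bullet> x + (s + t) > 0}"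
    define l where "l = (\<lambda>x. max 0 (n \<bullet> x + (s + t)))"
    let ?h = "\<lambda>x. l x *\<^sub>R g x + V x *\<^sub>R (if n \<bullet> x + (s + t) > 0 then n else 0)"
    have "lip_grad (\<lambda>x. l x * V x) ?h"
      unfolding l_def by (rule lip_grad_mult[OF lip_grad_pos_part[OF n0] V S])
    from H10_integral_by_parts[OF v D V eq this, of n]
    have z: "(LINT x|lebesgue_on D. l x * V x * (g x \<bullet> n) + (?h x \<bullet> n) * V x) = 0" using n by simp
    have nn: "n \<bullet> n = 1" using n by (simp add: dot_square_norm)
    let ?R1 = "\<lambda>x. indicator D x * (2 * (l x * V x * (g x \<bullet> n) + (?h x \<bullet> n) * V x))"
    let ?R2 = "\<lambda>x. indicator D x * (4 * t\<^sup>2 * L\<^sup>2)"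
    let ?R = "\<lambda>x. ?R1 x + ?R2 x"
    have i2: "integrable lebesgue ?R2"
      by (rule integrable_on_bounded[OF _ Dm D(2), where B="4 * t\<^sup>2 * L\<^sup>2"]) auto
      have iR: "integrable lebesgue ?R"
      proof -
        obtain B where B: "B \<ge> 0" "\<And>x. x \<in> D \<Longrightarrow> \<bar>V x\<bar> \<le> B" using lip_bounded[OF lV D(2)] by blast
        have lm: "lip l" unfolding l_def by (intro lip_max lip_add lip_const lip_inner)
        obtain B' where B': "B' \<ge> 0" "\<And>x. x \<in> D \<Longrightarrow> \<bar>l x\<bar> \<le> B'" using lip_bounded[OF lm D(2)] by blast
        have m: "?h \<in> borel_measurable lebesgue"
          using lip_grad_measurable[OF \<open>lip_grad (\<lambda>x. l x * V x) ?h\<close>] .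
        obtain M where M: "M \<ge> 0" "AE x in lebesgue. norm (?h x) \<le> M"
          using lip_grad_bounded[OF \<open>lip_grad (\<lambda>x. l x * V x) ?h\<close>] by blast
        have "integrable lebesgue (\<lambda>x. indicator D x * (2 * (l x * V x * (g x \<bullet> n) + (?h x \<bullet> n) * V x)))"
        proof (rule integrable_on_bounded[OF _ Dm D(2), where B="2 * (B' * B * L + M * B)"])
          have "(\<lambda>x. ?h x \<bullet> n) \<in> borel_measurable lebesgue" using m by (intro borel_measurable_inner) auto
          moreover have gm: "(\<lambda>x. g x \<bullet> n) \<in> borel_measurable lebesgue"
            using lip_grad_measurable[OF V] by (intro borel_measurable_inner) auto
          ultimately show "(\<lambda>x. 2 * (l x * V x * (g x \<bullet> n) + (?h x \<bullet> n) * V x)) \<in> borel_measurable lebesgue"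
            by (intro borel_measurable_times borel_measurable_add borel_measurable_const gm
                lip_measurable_lebesgue[OF lV] lip_measurable_lebesgue[OF lm])
          show "AE x in lebesgue. x \<in> D \<longrightarrow> \<bar>2 * (l x * V x * (g x \<bullet> n) + (?h x \<bullet> n) * V x)\<bar> \<le> 2 * (B' * B * L + M * B)"
            using L(2) M(2)
          proof eventually_elim
            case (elim x)
            have 1: "\<bar>g x \<bullet> n\<bar> \<le> L" using Cauchy_Schwarz_ineq2[of "g x" n] n elim(1) by simp
            have 2: "\<bar>?h x \<bullet> n\<bar> \<le> M" using Cauchy_Schwarz_ineq2[of "?h x" n] n elim(2) by simp
            show ?case
            proof
              assume x: "x \<in> D"
              have "\<bar>l x * V x * (g x \<bullet> n)\<bar> \<le> B' * B * L" unfolding abs_mult by (intro mult_mono 1 B(2) B'(2) x) (use B B' L in auto)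
              moreover have "\<bar>(?h x \<bullet> n) * V x\<bar> \<le> M * B" unfolding abs_mult by (intro mult_mono 2 B(2) x) (use B M in auto)
              moreover have "\<bar>2 * (p + q)\<bar> \<le> 2 * (P + Q)" if "\<bar>p\<bar> \<le> P" "\<bar>q\<bar> \<le> Q" for p q P Q :: real
                using that abs_triangle_ineq[of p q] by (simp add: abs_mult)
              ultimately show "\<bar>2 * (l x * V x * (g x \<bullet> n) + (?h x \<bullet> n) * V x)\<bar> \<le> 2 * (B' * B * L + M * B)" by blast
            qed
          qed
        qed
        then show ?thesis using i2 by (rule Bochner_Integration.integrable_add)
      qed
    have "(LINT x|lebesgue. indicator D x * (indicator ?P x * (V x)\<^sup>2)) \<le> integral\<^sup>L lebesgue ?R"
    proof (rule integral_mono_AE[OF _ iR])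
        show "integrable lebesgue (\<lambda>x. indicator D x * (indicator ?P x * (V x)\<^sup>2))"
          using int[of t] by (simp add: add.assoc)
        show "AE x in lebesgue. indicator D x * (indicator ?P x * (V x)\<^sup>2) \<le> ?R x"
          using L(2)
        proof eventually_elim
          case (elim x)
          show ?case
          proof (cases "x \<in> D")
            case True
            have gn: "\<bar>g x \<bullet> n\<bar> \<le> L" using Cauchy_Schwarz_ineq2[of "g x" n] n elim by simp
            have lt: "0 \<le> l x" "l x \<le> t" using half[OF True] t by (auto simp: l_def)
            define a where "a = l x * (g x \<bullet> n)"
            have "\<bar>a\<bar> \<le> t * L" unfolding a_def abs_mult by (intro mult_mono gn) (use lt t in auto)
            then have a2: "a\<^sup>2 \<le> (t * L)\<^sup>2" by (metis abs_ge_zero power2_abs power_mono)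
            show ?thesis
            proof (cases "x \<in> ?P")
              case P: True
              have e1: "?h x \<bullet> n = a + V x" using P nn by (simp add: a_def inner_add_left)
              have e2: "l x * V x * (g x \<bullet> n) = a * V x" by (simp add: a_def)
              have "0 \<le> (2 * a + V x)\<^sup>2" by simp
              then have "(V x)\<^sup>2 \<le> 2 * (a * V x + (a + V x) * V x) + 4 * t\<^sup>2 * L\<^sup>2"
                using a2 by (simp add: power2_eq_square algebra_simps)
              then show ?thesis unfolding e1 e2 using True P by simp
            next
              case False
              then have "l x = 0" by (simp add: l_def)
              then show ?thesis using False by simp
            qed
          qed simp
        qed
      qed
    also have "\<dots> = integral\<^sup>L lebesgue ?R1 + integral\<^sup>L lebesgue ?R2"
      using Bochner_Integration.integrable_diff[OF iR i2] i2 by (intro Bochner_Integration.integral_add) simp_all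
    also have "integral\<^sup>L lebesgue ?R1 = 2 * (LINT x|lebesgue_on D. l x * V x * (g x \<bullet> n) + (?h x \<bullet> n) * V x)"
      unfolding LINT_lebesgue_on[OF Dm] by (simp only: mult.left_commute[of _ 2] integral_mult_right_zero)
    also have "\<dots> = 0" using z by simp
    also have "0 + integral\<^sup>L lebesgue ?R2 = C * t\<^sup>2"
      using Dm by (simp add: C_def)
    finally show ?thesis by (simp add: add.assoc)
  qed
  define \<delta> where "\<delta> = (V p)\<^sup>2 / 4"
  have \<delta>: "\<delta> > 0" using Vp by (simp add: \<delta>_def)
  have "continuous (at p) V" using lip_continuous_on[OF lV, of UNIV] by (simp add: continuous_on_eq_continuous_at)
  then obtain r where r: "r > 0" "\<And>x. dist x p < r \<Longrightarrow> dist (V x) (V p) < \<bar>V p\<bar> / 2"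
    unfolding continuous_at_eps_delta using Vp by (metis half_gt_zero zero_less_abs_iff)
  have ge: "\<delta> \<le> (V x)\<^sup>2" if "x \<in> ball p r" for x
  proof -
    have "\<bar>V x - V p\<bar> < \<bar>V p\<bar> / 2" using r(2)[of x] that by (simp add: dist_norm norm_minus_commute)
    then have "\<bar>V p / 2\<bar> \<le> \<bar>V x\<bar>" by linarith
    then have "(V p / 2)\<^sup>2 \<le> (V x)\<^sup>2" by (simp only: abs_le_square_iff)
    then show ?thesis by (simp add: \<delta>_def power_divide)
  qed
  obtain c t0 where c: "c > 0" "t0 > 0" "\<And>t. 0 < t \<Longrightarrow> t < t0 \<Longrightarrow>
      \<exists>A\<in>sets lebesgue. A \<subseteq> D \<inter> ball p r \<inter> {x. n \<bullet> x + s + t > 0} \<and> measure lebesgue A \<ge> c * t"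
    using strips[OF r(1)] by blast
  have "\<delta> * c \<le> C * t" if t: "0 < t" "t < t0" for t
  proof -
    obtain A where A: "A \<in> sets lebesgue" "A \<subseteq> D \<inter> ball p r \<inter> {x. n \<bullet> x + s + t > 0}" "measure lebesgue A \<ge> c * t"
      using c(3)[OF t] by blast
    have "\<delta> * (c * t) \<le> \<delta> * measure lebesgue A" using A(3) \<delta> by simp
    also have "\<dots> = (LINT x|lebesgue. \<delta> * indicator A x)"
      using A(1) by simp
    also have "\<dots> \<le> (LINT x|lebesgue. indicator D x * (indicator {x. n \<bullet> x + s + t > 0} x * (V x)\<^sup>2))"
    proof (rule integral_mono_AE'[OF int])
      show "AE x in lebesgue. \<delta> * indicator A x \<le> indicator D x * (indicator {x. n \<bullet> x + s + t > 0} x * (V x)\<^sup>2)"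
        using A(2) ge by (intro AE_I2) (auto simp: indicator_def)
    qed simp
    also have "\<dots> \<le> C * t\<^sup>2" by (rule strip[OF t(1)])
    finally show ?thesis using t by (simp add: power2_eq_square mult.assoc[symmetric])
  qed
  then have "\<delta> * c \<le> 0"
  proof -
    assume *: "\<And>t. 0 < t \<Longrightarrow> t < t0 \<Longrightarrow> \<delta> * c \<le> C * t"
    have "((\<lambda>t. C * t) \<longlongrightarrow> C * 0) (at_right 0)" by (intro tendsto_intros)
    moreover have "\<forall>\<^sub>F t in at_right 0. \<delta> * c \<le> C * t"
      using c(2) * by (auto simp: eventually_at_right_field)
    ultimately show ?thesis using tendsto_lowerbound[of "\<lambda>t. C * t" "C * 0" "at_right 0"] by simp
  qed
  then show False using \<delta> c(1) by (simp add: mult_le_0_iff)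
qed

section \<open>Nodal basis functions of the mesh\<close>

text \<open>The nodal basis function of the vertex at the origin, on the mesh of width one with diagonals parallel to
  $(1,-1)$. Its support is the hexagon around the origin.\<close>

definition courant :: "real \<Rightarrow> real \<Rightarrow> real" where
  "courant s t = max 0 (1 - max \<bar>s\<bar> (max \<bar>t\<bar> \<bar>s + t\<bar>))"

text \<open>The nodal basis function of the vertex \<open>gridpt N k l\<close>, defined on the whole plane.\<close>

definition hat :: "nat \<Rightarrow> nat \<Rightarrow> nat \<Rightarrow> real \<times> real \<Rightarrow> real" where
  "hat N k l p = courant (2 * real N * fst p - real k) (2 * real N * snd p - real l)"

text \<open>Affine on a set, in the form in which \<open>S10\<close> asks for it.\<close>

definition affine_on :: "(real \<times> real) set \<Rightarrow> (real \<times> real \<Rightarrow> real) \<Rightarrow> bool" where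
  "affine_on S f \<longleftrightarrow> (\<exists>p q. \<forall>x\<in>S. f x = p \<bullet> x + q)"

lemma affine_on_subset: "affine_on T f \<Longrightarrow> S \<subseteq> T \<Longrightarrow> affine_on S f"
  unfolding affine_on_def by blast

lemma affine_on_inner: "affine_on S (\<lambda>x. c \<bullet> x)"
  unfolding affine_on_def by (intro exI[of _ c] exI[of _ 0]) simp

lemma affine_on_cmult: "affine_on S f \<Longrightarrow> affine_on S (\<lambda>x. c * f x)"
  unfolding affine_on_def
proof safe
  fix p q assume "\<forall>x\<in>S. f x = p \<bullet> x + q"
  then show "\<exists>p q. \<forall>x\<in>S. c * f x = p \<bullet> x + q"
    by (intro exI[of _ "c *\<^sub>R p"] exI[of _ "c * q"]) (simp add: algebra_simps)
qed

lemma affine_on_add: "affine_on S f \<Longrightarrow> affine_on S g \<Longrightarrow> affine_on S (\<lambda>x. f x + g x)"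
  unfolding affine_on_def
proof safe
  fix p q p' q' assume "\<forall>x\<in>S. f x = p \<bullet> x + q" "\<forall>x\<in>S. g x = p' \<bullet> x + q'"
  then show "\<exists>p q. \<forall>x\<in>S. f x + g x = p \<bullet> x + q"
    by (intro exI[of _ "p + p'"] exI[of _ "q + q'"]) (simp add: algebra_simps)
qed

lemma affine_on_sum:
  "finite I \<Longrightarrow> (\<And>i. i \<in> I \<Longrightarrow> affine_on S (f i)) \<Longrightarrow> affine_on S (\<lambda>x. \<Sum>i\<in>I. f i x)"
proof (induction I rule: finite_induct)
  case empty
  then show ?case using affine_on_inner[of S 0] by simp
qed (simp add: affine_on_add)

lemma affine_on_hull_eq:
  assumes "affine_on (convex hull V) f" "affine_on (convex hull V) g" "\<And>x. x \<in> V \<Longrightarrow> f x = g x"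
    and "x \<in> convex hull V"
  shows "f x = g x"
proof -
  obtain p q p' q' where pq: "\<And>x. x \<in> convex hull V \<Longrightarrow> f x = p \<bullet> x + q"
    "\<And>x. x \<in> convex hull V \<Longrightarrow> g x = p' \<bullet> x + q'"
    using assms(1,2) unfolding affine_on_def by blast
  have "convex hull V \<subseteq> {x. (p - p') \<bullet> x = q' - q}"
  proof (rule hull_minimal)
    show "V \<subseteq> {x. (p - p') \<bullet> x = q' - q}"
    proof
      fix x assume x: "x \<in> V"
      then have "p \<bullet> x + q = p' \<bullet> x + q'" using pq assms(3)[OF x] hull_inc[OF x, of convex] by metis
      then show "x \<in> {x. (p - p') \<bullet> x = q' - q}" by (simp add: inner_diff_left)
    qed
  qed (rule convex_hyperplane)
  then have "(p - p') \<bullet> x = q' - q" using assms(4) by blast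
  then show ?thesis using pq assms(4) by (simp add: inner_diff_left)
qed

text \<open>The closed triangles below and above the diagonal of the square with lower left corner \<open>(i, j)\<close>,
  in coordinates scaled by \<open>2 N\<close>.\<close>

definition lower_tri :: "nat \<Rightarrow> int \<Rightarrow> int \<Rightarrow> (real \<times> real) set" where
  "lower_tri N i j = {p. of_int i \<le> 2 * real N * fst p \<and> of_int j \<le> 2 * real N * snd p \<and>
     2 * real N * fst p + 2 * real N * snd p \<le> of_int i + of_int j + 1}"

definition upper_tri :: "nat \<Rightarrow> int \<Rightarrow> int \<Rightarrow> (real \<times> real) set" where
  "upper_tri N i j = {p. 2 * real N * fst p \<le> of_int i + 1 \<and> 2 * real N * snd p \<le> of_int j + 1 \<and>
     of_int i + of_int j + 1 \<le> 2 * real N * fst p + 2 * real N * snd p}"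

lemma courant_affine_lower:
  fixes i j :: int
  shows "\<exists>a b c. \<forall>s t. of_int i \<le> s \<longrightarrow> of_int j \<le> t \<longrightarrow> s + t \<le> of_int i + of_int j + 1 \<longrightarrow>
    courant s t = a * s + b * t + c"
proof -
  consider "i = 0" "j = 0" | "i = -1" "j = 0" | "i = 0" "j = -1" | "i = -1" "j = -1"
    | "i \<ge> 1" | "i \<le> -2" | "j \<ge> 1" | "j \<le> -2" by linarith
  then show ?thesis
  proof cases
    case 1 then show ?thesis
      by (intro exI[of _ "-1"] exI[of _ "-1"] exI[of _ 1]) (auto simp: courant_def)
  next
    case 2 then show ?thesis
      by (intro exI[of _ 1] exI[of _ 0] exI[of _ 1]) (auto simp: courant_def max_def abs_if)
  next
    case 3 then show ?thesis
      by (intro exI[of _ 0] exI[of _ 1] exI[of _ 1]) (auto simp: courant_def max_def abs_if)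
  next
    case 4 then show ?thesis
      by (intro exI[of _ 0] exI[of _ 0] exI[of _ 0]) (auto simp: courant_def max_def abs_if)
  next
    case 5 then have "real_of_int i \<ge> 1" by simp
    then show ?thesis
      by (intro exI[of _ 0] exI[of _ 0] exI[of _ 0]) (auto simp: courant_def max_def abs_if)
  next
    case 6 then have "real_of_int i \<le> -2" by simp
    then show ?thesis
      by (intro exI[of _ 0] exI[of _ 0] exI[of _ 0]) (auto simp: courant_def max_def abs_if)
  next
    case 7 then have "real_of_int j \<ge> 1" by simp
    then show ?thesis
      by (intro exI[of _ 0] exI[of _ 0] exI[of _ 0]) (auto simp: courant_def max_def abs_if)
  next
    case 8 then have "real_of_int j \<le> -2" by simp
    then show ?thesis
      by (intro exI[of _ 0] exI[of _ 0] exI[of _ 0]) (auto simp: courant_def max_def abs_if)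
  qed
qed

lemma courant_affine_upper:
  fixes i j :: int
  shows "\<exists>a b c. \<forall>s t. s \<le> of_int i + 1 \<longrightarrow> t \<le> of_int j + 1 \<longrightarrow> of_int i + of_int j + 1 \<le> s + t \<longrightarrow>
    courant s t = a * s + b * t + c"
proof -
  \<comment> \<open>The point reflection exchanges the two kinds of triangles.\<close>
  obtain a b c where *: "\<And>s t. of_int (- i - 1) \<le> s \<Longrightarrow> of_int (- j - 1) \<le> t \<Longrightarrow>
      s + t \<le> of_int (- i - 1) + of_int (- j - 1) + 1 \<Longrightarrow> courant s t = a * s + b * t + c"
    using courant_affine_lower[of "- i - 1" "- j - 1"] by blast
  have even: "courant s t = courant (- s) (- t)" for s t
    unfolding courant_def using abs_minus_cancel[of "s + t"] by simp
  show ?thesis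
  proof (intro exI allI impI)
    fix s t :: real
    assume "s \<le> of_int i + 1" "t \<le> of_int j + 1" "of_int i + of_int j + 1 \<le> s + t"
    then show "courant s t = (- a) * s + (- b) * t + c"
      unfolding even[of s t] using *[of "- s" "- t"] by simp
  qed
qed

lemma hat_affine_lower: "affine_on (lower_tri N i j) (hat N k l)"
proof -
  obtain a b c where *: "\<And>s t. of_int (i - int k) \<le> s \<Longrightarrow> of_int (j - int l) \<le> t \<Longrightarrow>
      s + t \<le> of_int (i - int k) + of_int (j - int l) + 1 \<Longrightarrow> courant s t = a * s + b * t + c"
    using courant_affine_lower[of "i - int k" "j - int l"] by blast
  show ?thesis
    unfolding affine_on_def
  proof (intro exI ballI)
    fix p assume "p \<in> lower_tri N i j"
    then show "hat N k l p = (2 * real N * a, 2 * real N * b) \<bullet> p + (c - a * real k - b * real l)"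
      unfolding hat_def using *[of "2 * real N * fst p - real k" "2 * real N * snd p - real l"]
      by (simp add: lower_tri_def inner_prod_def algebra_simps)
  qed
qed

lemma hat_affine_upper: "affine_on (upper_tri N i j) (hat N k l)"
proof -
  obtain a b c where *: "\<And>s t. s \<le> of_int (i - int k) + 1 \<Longrightarrow> t \<le> of_int (j - int l) + 1 \<Longrightarrow>
      of_int (i - int k) + of_int (j - int l) + 1 \<le> s + t \<Longrightarrow> courant s t = a * s + b * t + c"
    using courant_affine_upper[of "i - int k" "j - int l"] by blast
  show ?thesis
    unfolding affine_on_def
  proof (intro exI ballI)
    fix p assume "p \<in> upper_tri N i j"
    then show "hat N k l p = (2 * real N * a, 2 * real N * b) \<bullet> p + (c - a * real k - b * real l)"
      unfolding hat_def using *[of "2 * real N * fst p - real k" "2 * real N * snd p - real l"]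
      by (simp add: upper_tri_def inner_prod_def algebra_simps)
  qed
qed

lemma convex_lower_tri: "convex (lower_tri N i j)"
proof -
  have "lower_tri N i j = {p. (2 * real N, 0) \<bullet> p \<ge> of_int i} \<inter> {p. (0, 2 * real N) \<bullet> p \<ge> of_int j} \<inter>
      {p. (2 * real N, 2 * real N) \<bullet> p \<le> of_int i + of_int j + 1}"
    by (auto simp: lower_tri_def inner_prod_def)
  then show ?thesis by (simp add: convex_Int convex_halfspace_le convex_halfspace_ge)
qed

lemma convex_upper_tri: "convex (upper_tri N i j)"
proof -
  have "upper_tri N i j = {p. (2 * real N, 0) \<bullet> p \<le> of_int i + 1} \<inter> {p. (0, 2 * real N) \<bullet> p \<le> of_int j + 1} \<inter>
      {p. (2 * real N, 2 * real N) \<bullet> p \<ge> of_int i + of_int j + 1}"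
    by (auto simp: upper_tri_def inner_prod_def)
  then show ?thesis by (simp add: convex_Int convex_halfspace_le convex_halfspace_ge)
qed

lemma gridpt_sel:
  assumes "N \<ge> 1"
  shows "2 * real N * fst (gridpt N i j) = real i" "2 * real N * snd (gridpt N i j) = real j"
  using assms by (simp_all add: gridpt_def)

lemma gridpt_eq_iff: "N \<ge> 1 \<Longrightarrow> gridpt N i j = gridpt N k l \<longleftrightarrow> i = k \<and> j = l"
  by (auto simp: gridpt_def field_simps)

lemma hull_lower_tri:
  assumes N: "N \<ge> 1"
  shows "convex hull {gridpt N i (Suc j), gridpt N (Suc i) j, gridpt N i j} = lower_tri N (int i) (int j)"
proof
  show "convex hull {gridpt N i (Suc j), gridpt N (Suc i) j, gridpt N i j} \<subseteq> lower_tri N (int i) (int j)"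
    by (intro hull_minimal convex_lower_tri) (auto simp: lower_tri_def gridpt_sel[OF N])
  show "lower_tri N (int i) (int j) \<subseteq> convex hull {gridpt N i (Suc j), gridpt N (Suc i) j, gridpt N i j}"
  proof
    fix p assume p: "p \<in> lower_tri N (int i) (int j)"
    define u where "u = 2 * real N * fst p - real i"
    define v where "v = 2 * real N * snd p - real j"
    have uv: "0 \<le> u" "0 \<le> v" "0 \<le> 1 - u - v" using p by (auto simp: u_def v_def lower_tri_def)
    have fs: "fst p = (real i + u) / (2 * real N)" "snd p = (real j + v) / (2 * real N)"
      using N by (auto simp: u_def v_def)
    have "p = v *\<^sub>R gridpt N i (Suc j) + u *\<^sub>R gridpt N (Suc i) j + (1 - u - v) *\<^sub>R gridpt N i j"
      using N by (intro prod_eqI) (simp_all add: gridpt_def fs field_simps)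
    then show "p \<in> convex hull {gridpt N i (Suc j), gridpt N (Suc i) j, gridpt N i j}"
      unfolding convex_hull_3 using uv by (intro CollectI exI[of _ v] exI[of _ u] exI[of _ "1 - u - v"]) simp
  qed
qed

lemma hull_upper_tri:
  assumes N: "N \<ge> 1"
  shows "convex hull {gridpt N i (Suc j), gridpt N (Suc i) j, gridpt N (Suc i) (Suc j)} = upper_tri N (int i) (int j)"
proof
  show "convex hull {gridpt N i (Suc j), gridpt N (Suc i) j, gridpt N (Suc i) (Suc j)} \<subseteq> upper_tri N (int i) (int j)"
    by (intro hull_minimal convex_upper_tri) (auto simp: upper_tri_def gridpt_sel[OF N])
  show "upper_tri N (int i) (int j) \<subseteq> convex hull {gridpt N i (Suc j), gridpt N (Suc i) j, gridpt N (Suc i) (Suc j)}"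
  proof
    fix p assume p: "p \<in> upper_tri N (int i) (int j)"
    define u where "u = real i + 1 - 2 * real N * fst p"
    define v where "v = real j + 1 - 2 * real N * snd p"
    have uv: "0 \<le> u" "0 \<le> v" "0 \<le> 1 - u - v" using p by (auto simp: u_def v_def upper_tri_def)
    have fs: "fst p = (real i + 1 - u) / (2 * real N)" "snd p = (real j + 1 - v) / (2 * real N)"
      using N by (auto simp: u_def v_def)
    have "p = u *\<^sub>R gridpt N i (Suc j) + v *\<^sub>R gridpt N (Suc i) j + (1 - u - v) *\<^sub>R gridpt N (Suc i) (Suc j)"
      using N by (intro prod_eqI) (simp_all add: gridpt_def fs field_simps)
    then show "p \<in> convex hull {gridpt N i (Suc j), gridpt N (Suc i) j, gridpt N (Suc i) (Suc j)}"
      unfolding convex_hull_3 using uv by (intro CollectI exI[of _ u] exI[of _ v] exI[of _ "1 - u - v"]) simp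
  qed
qed

lemma meshE:
  assumes "V \<in> mesh N" "N \<ge> 1"
  obtains i j where "i < 2 * N" "j < 2 * N"
    "V = {gridpt N i (Suc j), gridpt N (Suc i) j, gridpt N i j}" "convex hull V = lower_tri N (int i) (int j)"
  | i j where "i < 2 * N" "j < 2 * N"
    "V = {gridpt N i (Suc j), gridpt N (Suc i) j, gridpt N (Suc i) (Suc j)}" "convex hull V = upper_tri N (int i) (int j)"
  using assms(1) hull_lower_tri[OF assms(2)] hull_upper_tri[OF assms(2)] unfolding mesh_def by blast

lemma hat_affine_mesh: "V \<in> mesh N \<Longrightarrow> N \<ge> 1 \<Longrightarrow> affine_on (convex hull V) (hat N k l)"
  by (erule meshE) (auto simp: hat_affine_lower hat_affine_upper)

lemma hat_gridpt:
  assumes N: "N \<ge> 1" shows "hat N k l (gridpt N i j) = (if i = k \<and> j = l then 1 else 0)"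
proof -
  have "i = k \<or> \<bar>real i - real k\<bar> \<ge> 1" "j = l \<or> \<bar>real j - real l\<bar> \<ge> 1" by linarith+
  then show ?thesis by (auto simp: hat_def gridpt_sel[OF N] courant_def)
qed

lemma hat_support:
  assumes "hat N k l p \<noteq> 0"
  shows "\<bar>2 * real N * fst p - real k\<bar> < 1" "\<bar>2 * real N * snd p - real l\<bar> < 1"
  using assms unfolding hat_def courant_def by (auto simp: max_def split: if_splits)

lemma mesh_covers:
  assumes N: "N \<ge> 1" and p: "0 \<le> fst p" "fst p \<le> 1" "0 \<le> snd p" "snd p \<le> 1"
  obtains V where "V \<in> mesh N" "p \<in> convex hull V"
proof -
  have ex: "\<exists>i<2 * N. real i \<le> 2 * real N * x \<and> 2 * real N * x \<le> real i + 1" if x: "0 \<le> x" "x \<le> 1" for x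
  proof (cases "x = 1")
    case True
    then show ?thesis using N by (intro exI[of _ "2 * N - 1"]) (auto simp: of_nat_diff)
  next
    case False
    have "2 * real N * x < 2 * real N" using False x N by simp
    then have "\<lfloor>2 * real N * x\<rfloor> < int (2 * N)" by (simp add: floor_less_iff)
    moreover have "0 \<le> \<lfloor>2 * real N * x\<rfloor>" using x by simp
    ultimately have "nat \<lfloor>2 * real N * x\<rfloor> < 2 * N" by (simp only: nat_less_iff)
    then show ?thesis using x by (intro exI[of _ "nat \<lfloor>2 * real N * x\<rfloor>"]) auto
  qed
  obtain i where i: "i < 2 * N" "real i \<le> 2 * real N * fst p" "2 * real N * fst p \<le> real i + 1" using ex p(1,2) by blast
  obtain j where j: "j < 2 * N" "real j \<le> 2 * real N * snd p" "2 * real N * snd p \<le> real j + 1" using ex p(3,4) by blast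
  show ?thesis
  proof (cases "2 * real N * fst p + 2 * real N * snd p \<le> real i + real j + 1")
    case True
    show ?thesis
    proof (rule that)
      show "{gridpt N i (Suc j), gridpt N (Suc i) j, gridpt N i j} \<in> mesh N" unfolding mesh_def using i(1) j(1) by blast
      show "p \<in> convex hull {gridpt N i (Suc j), gridpt N (Suc i) j, gridpt N i j}"
        unfolding hull_lower_tri[OF N] using i j True by (simp add: lower_tri_def)
    qed
  next
    case False
    show ?thesis
    proof (rule that)
      show "{gridpt N i (Suc j), gridpt N (Suc i) j, gridpt N (Suc i) (Suc j)} \<in> mesh N" unfolding mesh_def using i(1) j(1) by blast
      show "p \<in> convex hull {gridpt N i (Suc j), gridpt N (Suc i) j, gridpt N (Suc i) (Suc j)}"
        unfolding hull_upper_tri[OF N] using i j False by (simp add: upper_tri_def)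
    qed
  qed
qed

text \<open>The combination of the nodal basis functions with index in \<open>I\<close> and coefficients \<open>c\<close>.\<close>

definition nodal_sum :: "nat \<Rightarrow> (nat \<times> nat) set \<Rightarrow> (nat \<Rightarrow> nat \<Rightarrow> real) \<Rightarrow> real \<times> real \<Rightarrow> real" where
  "nodal_sum N I c p = (\<Sum>(k, l)\<in>I. c k l * hat N k l p)"

lemma nodal_sum_affine: "V \<in> mesh N \<Longrightarrow> N \<ge> 1 \<Longrightarrow> finite I \<Longrightarrow> affine_on (convex hull V) (nodal_sum N I c)"
  unfolding nodal_sum_def split_beta by (intro affine_on_sum affine_on_cmult hat_affine_mesh)

lemma nodal_sum_gridpt:
  assumes N: "N \<ge> 1" and I: "finite I"
  shows "nodal_sum N I c (gridpt N i j) = (if (i, j) \<in> I then c i j else 0)"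
proof -
  have "nodal_sum N I c (gridpt N i j) = (\<Sum>x\<in>I. if x = (i, j) then c i j else 0)"
    unfolding nodal_sum_def by (rule sum.cong) (auto simp: hat_gridpt[OF N] split: if_splits)
  then show ?thesis using I by simp
qed

lemma closure_Omega: "closure Omega = {0..1} \<times> {0..1}"
  unfolding Omega_def closure_Times by simp

lemma S10_affine: "v \<in> S10 N \<Longrightarrow> V \<in> mesh N \<Longrightarrow> affine_on (convex hull V) v"
  unfolding S10_def affine_on_def by blast

lemma S10_eq_nodal_sum:
  assumes N: "N \<ge> 1" and v: "v \<in> S10 N" and p: "p \<in> closure Omega"
  shows "v p = nodal_sum N ({..2 * N} \<times> {..2 * N}) (\<lambda>k l. v (gridpt N k l)) p"
proof -
  obtain V where V: "V \<in> mesh N" "p \<in> convex hull V"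
  proof -
    have "0 \<le> fst p" "fst p \<le> 1" "0 \<le> snd p" "snd p \<le> 1" using p by (auto simp: closure_Omega)
    from mesh_covers[OF N this] show ?thesis using that by blast
  qed
  show ?thesis
  proof (rule affine_on_hull_eq[OF S10_affine[OF v V(1)] nodal_sum_affine[OF V(1) N] _ V(2)])
    fix x assume "x \<in> V"
    then obtain k l where "x = gridpt N k l" "k \<le> 2 * N" "l \<le> 2 * N"
      using V(1) unfolding mesh_def by fastforce
    then show "v x = nodal_sum N ({..2 * N} \<times> {..2 * N}) (\<lambda>k l. v (gridpt N k l)) x"
      by (simp add: nodal_sum_gridpt[OF N])
  qed simp
qed

subsection \<open>Differentiability off the mesh lines\<close>

text \<open>The complement of all mesh lines, continued to the whole plane.\<close>

definition off_mesh :: "nat \<Rightarrow> (real \<times> real) set" where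
  "off_mesh N = {p. 2 * real N * fst p \<notin> \<int> \<and> 2 * real N * snd p \<notin> \<int> \<and> 2 * real N * fst p + 2 * real N * snd p \<notin> \<int>}"

lemma negligible_inner_Ints:
  fixes c :: "real \<times> real" assumes "c \<noteq> 0" shows "negligible {p. c \<bullet> p \<in> \<int>}"
proof -
  have "{p. c \<bullet> p \<in> \<int>} = (\<Union>n::int. {p. c \<bullet> p = of_int n})" by (auto elim!: Ints_cases)
  also have "negligible \<dots>"
    by (intro negligible_countable_Union countable_image) (auto intro: negligible_affine_hyperplane[OF assms])
  finally show ?thesis .
qed

lemma open_inner_Ints: "open {p. (c::real \<times> real) \<bullet> p \<notin> \<int>}"
proof -
  have "{p. c \<bullet> p \<notin> \<int>} = (\<lambda>p. c \<bullet> p) -` (- \<int>)" by auto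
  moreover have "closed (\<int> :: real set)" by (rule closed_Ints)
  ultimately show ?thesis by (auto intro!: open_vimage continuous_intros)
qed

lemma off_mesh_eq: "off_mesh N = {p. (2 * real N, 0) \<bullet> p \<notin> \<int>} \<inter> {p. (0, 2 * real N) \<bullet> p \<notin> \<int>}
    \<inter> {p. (2 * real N, 2 * real N) \<bullet> p \<notin> \<int>}"
  by (auto simp: off_mesh_def inner_prod_def)

lemma open_off_mesh: "open (off_mesh N)"
  unfolding off_mesh_eq by (intro open_Int open_inner_Ints)

lemma negligible_off_mesh:
  assumes "N \<ge> 1" shows "negligible (- off_mesh N)"
proof -
  have "- off_mesh N = {p. (2 * real N, 0) \<bullet> p \<in> \<int>} \<union> {p. (0, 2 * real N) \<bullet> p \<in> \<int>} \<union> {p. (2 * real N, 2 * real N) \<bullet> p \<in> \<int>}"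
    unfolding off_mesh_eq by auto
  then show ?thesis using assms by (auto intro!: negligible_Un negligible_inner_Ints simp: zero_prod_def)
qed

lemma floor_strict:
  fixes x :: real
  assumes "x \<notin> \<int>" shows "of_int \<lfloor>x\<rfloor> < x" "x < of_int \<lfloor>x\<rfloor> + 1"
  using assms Ints_of_int[of "\<lfloor>x\<rfloor>"] of_int_floor_le[of x] floor_correct[of x]
  by (auto simp: less_le)

lemma hat_locally_affine:
  assumes p: "p \<in> off_mesh N"
  shows "\<exists>S. open S \<and> p \<in> S \<and> affine_on S (hat N k l)"
proof -
  define s where "s = (\<lambda>p::real \<times> real. 2 * real N * fst p)"
  define t where "t = (\<lambda>p::real \<times> real. 2 * real N * snd p)"
  define i where "i = \<lfloor>s p\<rfloor>"
  define j where "j = \<lfloor>t p\<rfloor>"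
  have cont: "continuous_on UNIV s" "continuous_on UNIV t" unfolding s_def t_def by (intro continuous_intros)+
  have i: "of_int i < s p" "s p < of_int i + 1" and j: "of_int j < t p" "t p < of_int j + 1"
    using p floor_strict[of "s p"] floor_strict[of "t p"] by (auto simp: i_def j_def s_def t_def off_mesh_def)
  have ne: "s p + t p \<noteq> of_int i + of_int j + 1"
    using p unfolding s_def t_def off_mesh_def by (metis (mono_tags, lifting) Ints_1 Ints_add Ints_of_int mem_Collect_eq)
  show ?thesis
  proof (cases "s p + t p < of_int i + of_int j + 1")
    case True
    let ?S = "{q. of_int i < s q} \<inter> {q. of_int j < t q} \<inter> {q. s q + t q < of_int i + of_int j + 1}"
    have "open ?S" by (intro open_Int open_Collect_less continuous_intros cont)
    moreover have "p \<in> ?S" using i j True by simp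
    moreover have "affine_on ?S (hat N k l)"
      by (rule affine_on_subset[OF hat_affine_lower[of N i j]]) (auto simp: lower_tri_def s_def t_def)
    ultimately show ?thesis by blast
  next
    case False
    let ?S = "{q. s q < of_int i + 1} \<inter> {q. t q < of_int j + 1} \<inter> {q. of_int i + of_int j + 1 < s q + t q}"
    have "open ?S" by (intro open_Int open_Collect_less continuous_intros cont)
    moreover have "p \<in> ?S" using i j False ne by simp
    moreover have "affine_on ?S (hat N k l)"
      by (rule affine_on_subset[OF hat_affine_upper[of N i j]]) (auto simp: upper_tri_def s_def t_def)
    ultimately show ?thesis by blast
  qed
qed

lemma has_derivative_gradient:
  fixes f :: "'a::euclidean_space \<Rightarrow> real"
  assumes "(f has_derivative (\<lambda>d. p \<bullet> d)) (at x)" shows "gradient f x = p"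
  unfolding gradient_def frechet_derivative_at[OF assms, symmetric] by (simp add: euclidean_representation)

lemma lip_grad_locally_affine:
  assumes f: "lip f" and G: "open G" "negligible (- G)"
    and loc: "\<And>x. x \<in> G \<Longrightarrow> \<exists>S. open S \<and> x \<in> S \<and> affine_on S f"
  shows "lip_grad f (gradient f)"
proof -
  have loc': "\<exists>S p. open S \<and> x \<in> S \<and> (\<forall>y\<in>S. (f has_derivative (\<lambda>d. p \<bullet> d)) (at y))" if x: "x \<in> G" for x
  proof -
    obtain S p q where S: "open S" "x \<in> S" "\<And>y. y \<in> S \<Longrightarrow> f y = p \<bullet> y + q"
      using loc[OF x] unfolding affine_on_def by blast
    have "(f has_derivative (\<lambda>d. p \<bullet> d)) (at y)" if y: "y \<in> S" for y
    proof -
      have "((\<lambda>y. p \<bullet> y + q) has_derivative (\<lambda>d. p \<bullet> d)) (at y)" by (auto intro!: derivative_eq_intros)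
      then show ?thesis by (rule has_derivative_transform_within_open[OF _ S(1) y]) (simp add: S(3))
    qed
    then show ?thesis using S by blast
  qed
  show ?thesis
  proof (rule lip_gradI[OF f G])
    show "(f has_derivative (\<lambda>d. gradient f x \<bullet> d)) (at x)" if x: "x \<in> G" for x
    proof -
      obtain p where p: "(f has_derivative (\<lambda>d. p \<bullet> d)) (at x)" using loc'[OF x] by blast
      show ?thesis using p has_derivative_gradient[OF p] by simp
    qed
    show "continuous_on G (gradient f)"
      unfolding continuous_on_eq_continuous_at[OF G(1)]
    proof
      fix x assume x: "x \<in> G"
      obtain S p where S: "open S" "x \<in> S" "\<And>y. y \<in> S \<Longrightarrow> (f has_derivative (\<lambda>d. p \<bullet> d)) (at y)"
        using loc'[OF x] by blast
      have "gradient f y = p" if "y \<in> S" for y by (rule has_derivative_gradient[OF S(3)[OF that]])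
      then have "continuous_on S (gradient f)" by (intro continuous_on_eq[OF continuous_on_const[of S p]]) simp
      then show "continuous (at x) (gradient f)"
        using continuous_on_eq_continuous_at[OF S(1)] S(2) by blast
    qed
  qed
qed

lemma lip_courant: "lip (\<lambda>p. courant (2 * real N * fst p - a) (2 * real N * snd p - b))"
proof -
  have 1: "lip (\<lambda>p::real \<times> real. 2 * real N * fst p - a)"
    using lip_add[OF lip_inner[of "(2 * real N, 0)"] lip_const[of "- a"]] by (simp add: inner_prod_def)
  have 2: "lip (\<lambda>p::real \<times> real. 2 * real N * snd p - b)"
    using lip_add[OF lip_inner[of "(0, 2 * real N)"] lip_const[of "- b"]] by (simp add: inner_prod_def)
  have "lip (\<lambda>p. max 0 (1 + (-1) * max \<bar>2 * real N * fst p - a\<bar> (max \<bar>2 * real N * snd p - b\<bar>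
      \<bar>(2 * real N * fst p - a) + (2 * real N * snd p - b)\<bar>)))"
    by (intro lip_max lip_const lip_add lip_cmult lip_abs 1 2)
  then show ?thesis by (simp add: courant_def)
qed

lemma lip_grad_hat: "N \<ge> 1 \<Longrightarrow> lip_grad (hat N k l) (gradient (hat N k l))"
  by (rule lip_grad_locally_affine[OF _ open_off_mesh negligible_off_mesh hat_locally_affine])
    (use lip_courant in \<open>simp_all add: hat_def[abs_def]\<close>)

lemma lip_grad_nodal_sum:
  assumes "N \<ge> 1" "finite I"
  shows "lip_grad (nodal_sum N I c) (\<lambda>p. \<Sum>(k, l)\<in>I. c k l *\<^sub>R gradient (hat N k l) p)"
  unfolding nodal_sum_def[abs_def] split_beta
  by (intro lip_grad_sum lip_grad_cmult lip_grad_hat assms)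

subsection \<open>Discrete functions with zero boundary values\<close>

lemma hat_bounded_support:
  assumes N: "N \<ge> 1" and k: "k \<le> 2 * N" "l \<le> 2 * N" and p: "p \<notin> cbox (-1, -1) (2, 2)"
  shows "hat N k l p = 0"
proof (rule ccontr)
  assume "hat N k l p \<noteq> 0"
  note h = hat_support[OF this]
  have *: "-1 \<le> x \<and> x \<le> 2" if "\<bar>2 * real N * x - real m\<bar> < 1" "m \<le> 2 * N" for x m
  proof -
    have m: "real m \<le> 2 * real N" "1 \<le> real N" using that N by auto
    have "2 * real N * x < 1 + 2 * real N" using that(1) m by linarith
    then have "2 * real N * x < 2 * real N * 2" using m by linarith
    then have "x < 2" using m by (subst (asm) mult_less_cancel_left_pos) auto
    moreover have "2 * real N * (-1) < 2 * real N * x" using that(1) m by linarith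
    then have "-1 < x" using m by (subst (asm) mult_less_cancel_left_pos) auto
    ultimately show ?thesis by simp
  qed
  have "p \<in> cbox (-1, -1) (2, 2)"
    using *[OF h(1) k(1)] *[OF h(2) k(2)] by (cases p) (auto simp: cbox_Pair_eq)
  with p show False by simp
qed

lemma nodal_sum_bounded_support:
  assumes "N \<ge> 1" "I \<subseteq> {..2 * N} \<times> {..2 * N}" "p \<notin> cbox (-1, -1) (2, 2)"
  shows "nodal_sum N I c p = 0"
  unfolding nodal_sum_def
  by (rule sum.neutral) (use assms hat_bounded_support[OF assms(1) _ _ assms(3)] in auto)

lemma open_Omega: "open Omega"
  unfolding Omega_def by (intro open_Times) auto

lemma bounded_Omega: "bounded Omega"
  unfolding Omega_def by (intro bounded_Times) auto

lemma measure_rect: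
  assumes "a \<le> c" "b \<le> d" shows "measure lborel (box (a::real, b::real) (c, d)) = (c - a) * (d - b)"
proof -
  have B: "(Basis :: (real \<times> real) set) = {(1, 0), (0, 1)}" by (auto simp: Basis_prod_def)
  show ?thesis using assms by (simp add: measure_lborel_box_eq B)
qed

lemma mem_box_rect: "(x, y) \<in> box (a::real, b::real) (c, d) \<longleftrightarrow> a < x \<and> x < c \<and> b < y \<and> y < d"
  by (auto simp: box_def Basis_prod_def)

lemma interval_near:
  fixes y r :: real assumes "0 \<le> y" "y \<le> 1" "r > 0"
  obtains a b where "0 \<le> a" "a < b" "b \<le> 1" "\<And>x. a < x \<Longrightarrow> x < b \<Longrightarrow> \<bar>x - y\<bar> < r"
  by (rule that[of "max 0 (y - r)" "min 1 (y + r)"]) (use assms in auto)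

lemma dist_prod_less:
  fixes x y a b r :: real
  assumes "\<bar>x - a\<bar> < r / 2" "\<bar>y - b\<bar> < r / 2"
  shows "(x, y) \<in> ball (a, b) r"
proof -
  have "norm ((a, b) - (x, y)) \<le> \<bar>a - x\<bar> + \<bar>b - y\<bar>"
    using sqrt_sum_squares_le_sum_abs[of "a - x" "b - y"] by (simp add: norm_prod_def)
  then show ?thesis
    using assms abs_minus_commute[of a x] abs_minus_commute[of b y] unfolding mem_ball dist_norm by linarith
qed

lemma H10_zero_on_edges:
  fixes v V :: "real \<times> real \<Rightarrow> real"
  assumes v: "v \<in> H10 Omega" and V: "lip_grad V g" and eq: "\<And>x. x \<in> Omega \<Longrightarrow> v x = V x"
    and S: "bounded S" "\<And>x. x \<notin> S \<Longrightarrow> V x = 0" and z: "0 \<le> z" "z \<le> 1"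
  shows "V (1, z) = 0" "V (0, z) = 0" "V (z, 1) = 0" "V (z, 0) = 0"
proof -
  note T = H10_trace_zero[OF v open_Omega bounded_Omega V eq S]
  have strip: "\<exists>c>0. \<exists>t0>0. \<forall>t. 0 < t \<and> t < t0 \<longrightarrow>
      (\<exists>A\<in>sets lebesgue. A \<subseteq> Omega \<inter> ball p r \<inter> H t \<and> measure lebesgue A \<ge> c * t)"
    if r: "r > 0" and rect: "\<And>t a b. 0 < t \<Longrightarrow> t < min 1 (r / 2) \<Longrightarrow> 0 \<le> a \<Longrightarrow> a < b \<Longrightarrow> b \<le> 1 \<Longrightarrow>
      (\<And>x. a < x \<Longrightarrow> x < b \<Longrightarrow> \<bar>x - z\<bar> < r / 2) \<Longrightarrow>
      \<exists>A\<in>sets lebesgue. A \<subseteq> Omega \<inter> ball p r \<inter> H t \<and> measure lebesgue A = (b - a) * t" for r p H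
  proof -
    obtain a b where ab: "0 \<le> a" "a < b" "b \<le> 1" "\<And>x. a < x \<Longrightarrow> x < b \<Longrightarrow> \<bar>x - z\<bar> < r / 2"
      using interval_near[OF z, of "r / 2"] r by auto
    have body: "\<exists>A\<in>sets lebesgue. A \<subseteq> Omega \<inter> ball p r \<inter> H t \<and> measure lebesgue A \<ge> (b - a) * t"
      if t: "0 < t" "t < min 1 (r / 2)" for t
    proof -
      obtain A where A: "A \<in> sets lebesgue" "A \<subseteq> Omega \<inter> ball p r \<inter> H t" "measure lebesgue A = (b - a) * t"
        using rect[OF t ab] by blast
      from A(3) have "measure lebesgue A \<ge> (b - a) * t" by simp
      with A(1,2) show ?thesis by blast
    qed
    show ?thesis
      by (rule exI[of _ "b - a"], rule conjI[OF _ exI[of _ "min 1 (r / 2)"]], use ab in simp,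
          rule conjI, use r in simp, use body in blast)
  qed
  show "V (1, z) = 0"
  proof (rule T[where n="(1, 0)" and s="-1"])
    fix r :: real assume r: "r > 0"
    show "\<exists>c>0. \<exists>t0>0. \<forall>t. 0 < t \<and> t < t0 \<longrightarrow> (\<exists>A\<in>sets lebesgue.
        A \<subseteq> Omega \<inter> ball (1, z) r \<inter> {x. (1, 0) \<bullet> x + - 1 + t > 0} \<and> measure lebesgue A \<ge> c * t)"
    proof (rule strip[OF r])
      fix t a b :: real
      assume t: "0 < t" "t < min 1 (r / 2)" and ab: "0 \<le> a" "a < b" "b \<le> 1" "\<And>x. a < x \<Longrightarrow> x < b \<Longrightarrow> \<bar>x - z\<bar> < r / 2"
      show "\<exists>A\<in>sets lebesgue. A \<subseteq> Omega \<inter> ball (1, z) r \<inter> {x. (1, 0) \<bullet> x + - 1 + t > 0} \<and> measure lebesgue A = (b - a) * t"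
        by (intro bexI[of _ "box (1 - t, a) (1, b)"])
          (use t ab in \<open>auto simp: measure_rect mem_box_rect Omega_def intro!: dist_prod_less\<close>)
    qed
  qed (auto simp: norm_prod_def Omega_def)
  show "V (0, z) = 0"
  proof (rule T[where n="(-1, 0)" and s="0"])
    fix r :: real assume r: "r > 0"
    show "\<exists>c>0. \<exists>t0>0. \<forall>t. 0 < t \<and> t < t0 \<longrightarrow> (\<exists>A\<in>sets lebesgue.
        A \<subseteq> Omega \<inter> ball (0, z) r \<inter> {x. (-1, 0) \<bullet> x + 0 + t > 0} \<and> measure lebesgue A \<ge> c * t)"
    proof (rule strip[OF r])
      fix t a b :: real
      assume t: "0 < t" "t < min 1 (r / 2)" and ab: "0 \<le> a" "a < b" "b \<le> 1" "\<And>x. a < x \<Longrightarrow> x < b \<Longrightarrow> \<bar>x - z\<bar> < r / 2"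
      show "\<exists>A\<in>sets lebesgue. A \<subseteq> Omega \<inter> ball (0, z) r \<inter> {x. (-1, 0) \<bullet> x + 0 + t > 0} \<and> measure lebesgue A = (b - a) * t"
        by (intro bexI[of _ "box (0, a) (t, b)"])
          (use t ab in \<open>auto simp: measure_rect mem_box_rect Omega_def intro!: dist_prod_less\<close>)
    qed
  qed (auto simp: norm_prod_def Omega_def)
  show "V (z, 1) = 0"
  proof (rule T[where n="(0, 1)" and s="-1"])
    fix r :: real assume r: "r > 0"
    show "\<exists>c>0. \<exists>t0>0. \<forall>t. 0 < t \<and> t < t0 \<longrightarrow> (\<exists>A\<in>sets lebesgue.
        A \<subseteq> Omega \<inter> ball (z, 1) r \<inter> {x. (0, 1) \<bullet> x + - 1 + t > 0} \<and> measure lebesgue A \<ge> c * t)"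
    proof (rule strip[OF r])
      fix t a b :: real
      assume t: "0 < t" "t < min 1 (r / 2)" and ab: "0 \<le> a" "a < b" "b \<le> 1" "\<And>x. a < x \<Longrightarrow> x < b \<Longrightarrow> \<bar>x - z\<bar> < r / 2"
      show "\<exists>A\<in>sets lebesgue. A \<subseteq> Omega \<inter> ball (z, 1) r \<inter> {x. (0, 1) \<bullet> x + - 1 + t > 0} \<and> measure lebesgue A = (b - a) * t"
        by (intro bexI[of _ "box (a, 1 - t) (b, 1)"])
          (use t ab in \<open>auto simp: measure_rect mem_box_rect Omega_def intro!: dist_prod_less\<close>)
    qed
  qed (auto simp: norm_prod_def Omega_def)
  show "V (z, 0) = 0"
  proof (rule T[where n="(0, -1)" and s="0"])
    fix r :: real assume r: "r > 0"
    show "\<exists>c>0. \<exists>t0>0. \<forall>t. 0 < t \<and> t < t0 \<longrightarrow> (\<exists>A\<in>sets lebesgue.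
        A \<subseteq> Omega \<inter> ball (z, 0) r \<inter> {x. (0, -1) \<bullet> x + 0 + t > 0} \<and> measure lebesgue A \<ge> c * t)"
    proof (rule strip[OF r])
      fix t a b :: real
      assume t: "0 < t" "t < min 1 (r / 2)" and ab: "0 \<le> a" "a < b" "b \<le> 1" "\<And>x. a < x \<Longrightarrow> x < b \<Longrightarrow> \<bar>x - z\<bar> < r / 2"
      show "\<exists>A\<in>sets lebesgue. A \<subseteq> Omega \<inter> ball (z, 0) r \<inter> {x. (0, -1) \<bullet> x + 0 + t > 0} \<and> measure lebesgue A = (b - a) * t"
        by (intro bexI[of _ "box (a, 0) (b, t)"])
          (use t ab in \<open>auto simp: measure_rect mem_box_rect Omega_def intro!: dist_prod_less\<close>)
    qed
  qed (auto simp: norm_prod_def Omega_def)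
qed

text \<open>Indices of the vertices at least \<open>m\<close> cells away from the boundary. The difference is truncated, but it is
  only relevant for $m \le 2N$: otherwise the set of indices is empty for $m \ge 1$.\<close>

abbreviation inner_idx :: "nat \<Rightarrow> nat \<Rightarrow> (nat \<times> nat) set" where
  "inner_idx N m \<equiv> {m..2 * N - m} \<times> {m..2 * N - m}"

text \<open>A discrete function with zero boundary values is determined by its values at the interior vertices.\<close>

lemma S10_H10_nodal_sum:
  assumes N: "N \<ge> 1" and v: "v \<in> S10 N" "v \<in> H10 Omega" and p: "p \<in> Omega"
  shows "v p = nodal_sum N (inner_idx N 1) (\<lambda>k l. v (gridpt N k l)) p"
proof -
  let ?A = "{..2 * N} \<times> {..2 * N}"
  let ?c = "\<lambda>k l. v (gridpt N k l)"
  define V where "V = nodal_sum N ?A ?c"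
  have VO: "v x = V x" if "x \<in> closure Omega" for x
    unfolding V_def by (rule S10_eq_nodal_sum[OF N v(1) that])
  have "lip_grad V (\<lambda>p. \<Sum>(k, l)\<in>?A. ?c k l *\<^sub>R gradient (hat N k l) p)"
    unfolding V_def by (rule lip_grad_nodal_sum[OF N]) simp
  moreover have "v x = V x" if "x \<in> Omega" for x using VO closure_subset that by blast
  moreover have "V x = 0" if "x \<notin> cbox (-1, -1) (2, 2)" for x
    unfolding V_def by (rule nodal_sum_bounded_support[OF N subset_refl that])
  ultimately have Z: "V (1, z) = 0" "V (0, z) = 0" "V (z, 1) = 0" "V (z, 0) = 0" if "0 \<le> z" "z \<le> 1" for z
    using H10_zero_on_edges[OF v(2) _ _ bounded_cbox _ that, where V=V] by blast+
  have "?c k l = 0" if kl: "(k, l) \<in> ?A" "(k, l) \<notin> inner_idx N 1" for k l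
  proof -
    have cases: "k = 0 \<or> k = 2 * N \<or> l = 0 \<or> l = 2 * N" using kl by auto
    have 1: "0 \<le> real k / (2 * real N)" "real k / (2 * real N) \<le> 1" "0 \<le> real l / (2 * real N)" "real l / (2 * real N) \<le> 1"
      using kl(1) N by auto
    have "V (gridpt N k l) = 0"
      using cases Z[OF 1(1,2)] Z[OF 1(3,4)] N unfolding gridpt_def by auto
    moreover have "gridpt N k l \<in> closure Omega" using 1 by (simp add: closure_Omega gridpt_def)
    ultimately show ?thesis using VO by simp
  qed
  then have *: "?c (fst x) (snd x) = 0" if "x \<in> ?A - inner_idx N 1" for x
    using that by (metis DiffD1 DiffD2 prod.collapse)
  have "nodal_sum N ?A ?c p = nodal_sum N (inner_idx N 1) ?c p"
    unfolding nodal_sum_def split_beta by (rule sum.mono_neutral_right) (use * in auto)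
  then show ?thesis using VO[of p] p closure_subset[of Omega] unfolding V_def by auto
qed

text \<open>The discrete function that interpolates $x + y$ at all vertices of distance at least two cells
  from the boundary.\<close>

definition deep_interp :: "nat \<Rightarrow> real \<times> real \<Rightarrow> real" where
  "deep_interp N = nodal_sum N (inner_idx N 2) (\<lambda>k l. (real k + real l) / (2 * real N))"

lemma deep_interp_S10: assumes N: "N \<ge> 1" shows "deep_interp N \<in> S10 N"
proof -
  have "lip (deep_interp N)" unfolding deep_interp_def
    by (rule lip_grad_lip[OF lip_grad_nodal_sum[OF N]]) simp
  then have "continuous_on (closure Omega) (deep_interp N)" by (rule lip_continuous_on)
  moreover have "affine_on (convex hull V) (deep_interp N)" if "V \<in> mesh N" for V
    unfolding deep_interp_def by (rule nodal_sum_affine[OF that N]) simp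
  ultimately show ?thesis unfolding S10_def affine_on_def by blast
qed

lemma deep_interp_H10: assumes N: "N \<ge> 1" shows "deep_interp N \<in> H10 Omega"
proof -
  let ?h = "1 / (2 * real N)"
  let ?K = "cbox (?h, ?h) (1 - ?h, 1 - ?h)"
  have lg: "lip_grad (deep_interp N) (\<lambda>p. \<Sum>(k, l)\<in>inner_idx N 2. ((real k + real l) / (2 * real N)) *\<^sub>R gradient (hat N k l) p)"
    unfolding deep_interp_def by (rule lip_grad_nodal_sum[OF N]) simp
  show ?thesis
  proof (rule lip_grad_in_H10[OF lg open_Omega bounded_Omega compact_cbox[of "(?h, ?h)" "(1 - ?h, 1 - ?h)"]])
    show "?K \<subseteq> Omega"
    proof
      fix p assume "p \<in> ?K"
      then have "?h \<le> fst p" "fst p \<le> 1 - ?h" "?h \<le> snd p" "snd p \<le> 1 - ?h"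
        by (cases p, simp add: cbox_Pair_eq)+
      moreover have "0 < ?h" using N by simp
      ultimately show "p \<in> Omega"
        unfolding Omega_def mem_Times_iff greaterThanLessThan_iff by linarith
    qed
    fix p assume p: "p \<notin> ?K"
    have "hat N k l p = 0" if kl: "(k, l) \<in> inner_idx N 2" for k l
    proof (rule ccontr)
      assume "hat N k l p \<noteq> 0"
      note h = hat_support[OF this]
      have *: "?h \<le> x \<and> x \<le> 1 - ?h" if "\<bar>2 * real N * x - real m\<bar> < 1" "2 \<le> m" "m \<le> 2 * N - 2" for x m
      proof -
        have m: "2 \<le> real m" "real m + 2 \<le> 2 * real N" using that by linarith+
        have "1 \<le> 2 * real N * x" "2 * real N * x \<le> 2 * real N - 1" using that(1) m by linarith+
        then show ?thesis using N by (auto simp: field_simps)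
      qed
      have "p \<in> ?K" using *[OF h(1)] *[OF h(2)] kl by (cases p) (auto simp: cbox_Pair_eq)
      with p show False by simp
    qed
    then show "deep_interp N p = 0" unfolding deep_interp_def nodal_sum_def by (intro sum.neutral) auto
  qed
qed

lemma zero_S10_H10: "(\<lambda>x. 0) \<in> S10 N \<inter> H10 Omega"
proof
  show "(\<lambda>x. 0) \<in> S10 N" unfolding S10_def by (auto intro!: exI[of _ 0])
  show "(\<lambda>x. 0) \<in> H10 Omega"
    by (rule lip_grad_in_H10[OF lip_grad_zero open_Omega bounded_Omega compact_empty]) auto
qed

subsection \<open>Vertex patches\<close>

lemma inner_vertices_subset:
  assumes N: "N \<ge> 1"
  shows "inner_vertices N \<subseteq> (\<lambda>(i, j). gridpt N i j) ` inner_idx N 1"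
proof
  fix z assume z: "z \<in> inner_vertices N"
  then obtain i j where ij: "z = gridpt N i j" unfolding inner_vertices_def mesh_def by fastforce
  have "gridpt N i j \<in> Omega" using z ij unfolding inner_vertices_def by auto
  then have "0 < real i" "real i < 2 * real N" "0 < real j" "real j < 2 * real N"
    using N by (auto simp: gridpt_def Omega_def field_simps)
  then have "(i, j) \<in> inner_idx N 1" by auto
  then show "z \<in> (\<lambda>(i, j). gridpt N i j) ` inner_idx N 1" using ij by force
qed

lemma patch_subset:
  assumes N: "N \<ge> 1" and x: "x \<in> patch N (gridpt N k l)"
  shows "\<bar>2 * real N * fst x - real k\<bar> \<le> 1" "\<bar>2 * real N * snd x - real l\<bar> \<le> 1" "x \<in> closure Omega"
proof -
  obtain V where V: "V \<in> mesh N" "gridpt N k l \<in> V" "x \<in> convex hull V"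
    using x unfolding patch_def by blast
  have B: "\<bar>2 * real N * fst x - real k\<bar> \<le> 1 \<and> \<bar>2 * real N * snd x - real l\<bar> \<le> 1 \<and>
      0 \<le> 2 * real N * fst x \<and> 2 * real N * fst x \<le> 2 * real N \<and> 0 \<le> 2 * real N * snd x \<and> 2 * real N * snd x \<le> 2 * real N"
    using V(1) N
  proof (cases rule: meshE)
    case (1 i j)
    have "real k = real i \<or> real k = real i + 1" "real l = real j \<or> real l = real j + 1"
      using V(2) 1(3) by (auto simp: gridpt_eq_iff[OF N])
    moreover have "real i + 1 \<le> 2 * real N" "real j + 1 \<le> 2 * real N" "0 \<le> real i" "0 \<le> real j" using 1(1,2) by auto
    moreover have "real i \<le> 2 * real N * fst x" "real j \<le> 2 * real N * snd x"
      "2 * real N * fst x + 2 * real N * snd x \<le> real i + real j + 1"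
      using V(3) 1(4) by (auto simp: lower_tri_def)
    ultimately show ?thesis unfolding abs_le_iff by (elim disjE; intro conjI; linarith)
  next
    case (2 i j)
    have "real k = real i \<or> real k = real i + 1" "real l = real j \<or> real l = real j + 1"
      using V(2) 2(3) by (auto simp: gridpt_eq_iff[OF N])
    moreover have "real i + 1 \<le> 2 * real N" "real j + 1 \<le> 2 * real N" "0 \<le> real i" "0 \<le> real j" using 2(1,2) by auto
    moreover have "2 * real N * fst x \<le> real i + 1" "2 * real N * snd x \<le> real j + 1"
      "real i + real j + 1 \<le> 2 * real N * fst x + 2 * real N * snd x"
      using V(3) 2(4) by (auto simp: upper_tri_def)
    ultimately show ?thesis unfolding abs_le_iff by (elim disjE; intro conjI; linarith)
  qed
  have "0 \<le> y \<and> y \<le> 1" if "0 \<le> 2 * real N * y" "2 * real N * y \<le> 2 * real N" for y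
    using that N by (simp add: zero_le_mult_iff)
  then show "x \<in> closure Omega" unfolding closure_Omega mem_Times_iff atLeastAtMost_iff using B by blast
  show "\<bar>2 * real N * fst x - real k\<bar> \<le> 1" "\<bar>2 * real N * snd x - real l\<bar> \<le> 1" using B by blast+
qed

lemma deep_interp_patch:
  assumes N: "N \<ge> 1" and kl: "(k, l) \<in> inner_idx N 3" and x: "x \<in> patch N (gridpt N k l)"
  shows "deep_interp N x = (1, 1) \<bullet> x"
proof -
  obtain V where V: "V \<in> mesh N" "gridpt N k l \<in> V" "x \<in> convex hull V"
    using x unfolding patch_def by blast
  show ?thesis
  proof (rule affine_on_hull_eq[OF S10_affine[OF deep_interp_S10[OF N] V(1)] affine_on_inner _ V(3)])
    fix y assume y: "y \<in> V"
    have "\<exists>i j. y = gridpt N i j \<and> (i, j) \<in> inner_idx N 2"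
      using V(1) N
    proof (cases rule: meshE)
      case (1 i j)
      then show ?thesis using V(2) y kl by (auto simp: gridpt_eq_iff[OF N])
    next
      case (2 i j)
      then show ?thesis using V(2) y kl by (auto simp: gridpt_eq_iff[OF N])
    qed
    then obtain i j where "y = gridpt N i j" "(i, j) \<in> inner_idx N 2" by blast
    moreover from this have "deep_interp N (gridpt N i j) = (real i + real j) / (2 * real N)"
      unfolding deep_interp_def nodal_sum_gridpt[OF N finite_cartesian_product[OF finite_atLeastAtMost finite_atLeastAtMost]]
      by (simp only: if_True)
    ultimately show "deep_interp N y = (1, 1) \<bullet> y"
      by (simp add: gridpt_def inner_prod_def add_divide_distrib)
  qed
qed

lemma patch_closed_null:
  assumes "N \<ge> 1"
  shows "patch N z \<in> sets lebesgue" "negligible (patch N z - interior (patch N z))"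
proof -
  define F where "F = {V \<in> mesh N. z \<in> V}"
  have F: "finite F" unfolding F_def mesh_def by simp
  have Vf: "finite V" if "V \<in> F" for V using that unfolding F_def mesh_def by auto
  have cl: "closed (convex hull V)" if "V \<in> F" for V
    using finite_imp_compact_convex_hull[OF Vf[OF that]] by (rule compact_imp_closed)
  have p: "patch N z = (\<Union>V\<in>F. convex hull V)" unfolding patch_def F_def ..
  then have "closed (patch N z)" using F cl by auto
  then show "patch N z \<in> sets lebesgue" by simp
  have "patch N z - interior (patch N z) \<subseteq> (\<Union>V\<in>F. frontier (convex hull V))"
  proof
    fix x assume x: "x \<in> patch N z - interior (patch N z)"
    then obtain V where V: "V \<in> F" "x \<in> convex hull V" using p by blast
    have "convex hull V \<subseteq> patch N z" using V(1) p by blast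
    then have "x \<notin> interior (convex hull V)" using x interior_mono by blast
    then have "x \<in> frontier (convex hull V)" using V(2) closure_subset unfolding frontier_def by blast
    then show "x \<in> (\<Union>V\<in>F. frontier (convex hull V))" using V(1) by blast
  qed
  moreover have "negligible (\<Union>V\<in>F. frontier (convex hull V))"
    using F by (intro negligible_Union) (auto intro: negligible_convex_frontier)
  ultimately show "negligible (patch N z - interior (patch N z))" by (rule negligible_subset[rotated])
qed

section \<open>A profile with a nearly discontinuous vertex\<close>

text \<open>The taxicab norm; its balls are the diamonds.\<close>

abbreviation l1 :: "real \<times> real \<Rightarrow> real" where
  "l1 u \<equiv> \<bar>fst u\<bar> + \<bar>snd u\<bar>"

text \<open>The radius of the diamond outside of which the profile vanishes, and the radius inside of which it
  vanishes. Both are in units of the mesh width. The outer one is smaller than one, which makes the support of the witness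
  compact in \<open>Omega\<close>.\<close>

definition cut :: "nat \<Rightarrow> real" where
  "cut N = 1 - 1 / (4 * real N)"

definition core :: "nat \<Rightarrow> real" where
  "core N = exp (- real N)"

text \<open>In the two white quadrants the profile is, up to the sign, the function \<open>prof N\<close> of the taxicab norm, between
  the radii \<open>core N\<close> and \<open>cut N\<close>; \<open>dprof N\<close> is its derivative.\<close>

definition prof :: "nat \<Rightarrow> real \<Rightarrow> real" where
  "prof N r = (cut N - r) * (1 + ln r / real N)"

definition dprof :: "nat \<Rightarrow> real \<Rightarrow> real" where
  "dprof N r = (cut N - r) / (real N * r) - (1 + ln r / real N)"

text \<open>The profile. Replacing the norm by its maximum with \<open>core N\<close> makes the logarithmic factor zero in the
  core and shows the function as a product of Lipschitz functions.\<close>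

definition psi :: "nat \<Rightarrow> real \<times> real \<Rightarrow> real" where
  "psi N u = (let r = max (l1 u) (core N) in
     - (fst u + snd u) * (max 0 (cut N - r) * (1 + ln r / real N) / r))"

text \<open>The gradient of \<open>psi N\<close>, off the null set on which the pieces meet.\<close>

definition grad_psi :: "nat \<Rightarrow> real \<times> real \<Rightarrow> real \<times> real" where
  "grad_psi N u = (let r = l1 u in if core N < r \<and> r < cut N
     then - (prof N r / r) *\<^sub>R (1, 1)
       + ((fst u + snd u) * (prof N r / r\<^sup>2 - dprof N r / r)) *\<^sub>R (sgn (fst u), sgn (snd u))
     else 0)"

lemma cut_bounds: "N \<ge> 1 \<Longrightarrow> 3 / 4 \<le> cut N" "N \<ge> 1 \<Longrightarrow> cut N < 1"
  by (auto simp: cut_def field_simps)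

lemma core_bounds: "0 < core N" "N \<ge> 1 \<Longrightarrow> core N \<le> 1 / 2"
proof -
  show "0 < core N" by (simp add: core_def)
  assume "N \<ge> 1"
  then have "core N \<le> exp (-1)" by (simp add: core_def)
  also have "\<dots> \<le> 1 / 2" using exp_ge_add_one_self[of 1] by (simp add: exp_minus field_simps)
  finally show "core N \<le> 1 / 2" .
qed

lemma ln_core: "ln (core N) = - real N"
  by (simp add: core_def)

lemma lip_fst: "lip (\<lambda>u::real \<times> real. fst u)"
  using lip_inner[of "(1::real, 0::real)"] by (simp add: inner_prod_def)

lemma lip_snd: "lip (\<lambda>u::real \<times> real. snd u)"
  using lip_inner[of "(0::real, 1::real)"] by (simp add: inner_prod_def)

lemma lip_l1: "lip l1"
  by (intro lip_add lip_abs lip_fst lip_snd)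

lemma bounded_l1: "bounded {u. l1 u < c}"
proof (rule boundedI)
  fix u :: "real \<times> real" assume "u \<in> {u. l1 u < c}"
  then show "norm u \<le> c" using sqrt_sum_squares_le_sum_abs[of "fst u" "snd u"] by (simp add: norm_prod_def)
qed

lemma lip_psi:
  assumes N: "N \<ge> 1" shows "lip (psi N)"
proof -
  define M where "M = (\<lambda>u. max (l1 u) (core N))"
  have M: "core N \<le> M u" for u by (simp add: M_def)
  have M0: "0 < M u" for u using M[of u] core_bounds(1)[of N] by linarith
  have lM: "lip M" unfolding M_def by (intro lip_max lip_l1 lip_const)
  have l1: "lip (\<lambda>u. 1 / M u)"
  proof (rule lip_compose[OF lM, where K="1 / (core N)\<^sup>2"])
    fix u v
    have "\<bar>1 / M u - 1 / M v\<bar> = \<bar>M u - M v\<bar> / (M u * M v)"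
      using M0[of u] M0[of v] by (simp add: field_simps abs_divide abs_mult flip: abs_minus_commute[of "M u"])
    also have "\<dots> \<le> \<bar>M u - M v\<bar> / (core N)\<^sup>2"
      unfolding power2_eq_square using M[of u] M[of v] core_bounds(1)[of N] M0[of u] M0[of v]
      by (intro divide_left_mono mult_mono) auto
    finally show "\<bar>1 / M u - 1 / M v\<bar> \<le> 1 / (core N)\<^sup>2 * \<bar>M u - M v\<bar>" by simp
  qed simp
  have "lip (\<lambda>u. ln (M u))"
  proof (rule lip_compose[OF lM, where K="1 / core N"])
    have *: "ln a - ln b \<le> 1 / core N * \<bar>a - b\<bar>" if "core N \<le> a" "core N \<le> b" for a b
    proof -
      have ab: "0 < a" "0 < b" using that core_bounds(1)[of N] by auto
      have "ln a - ln b = ln (a / b)" using ab by (simp add: ln_div)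
      also have "\<dots> \<le> a / b - 1" using ab by (intro ln_le_minus_one) simp
      also have "\<dots> = (a - b) / b" using ab by (simp add: field_simps)
      also have "\<dots> \<le> \<bar>a - b\<bar> / b" using ab by (intro divide_right_mono) auto
      also have "\<dots> \<le> \<bar>a - b\<bar> / core N" using that ab core_bounds(1)[of N] by (intro divide_left_mono) auto
      finally show ?thesis by simp
    qed
    show "\<bar>ln (M u) - ln (M v)\<bar> \<le> 1 / core N * \<bar>M u - M v\<bar>" for u v
      using *[OF M[of u] M[of v]] *[OF M[of v] M[of u]] by (simp add: abs_le_iff abs_minus_commute)
  qed (use core_bounds(1)[of N] in simp)
  from lip_add[OF lip_const[of 1] lip_cmult[OF this, of "1 / real N"]]
  have l2: "lip (\<lambda>u. 1 + ln (M u) / real N)" by simp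
  have l3: "lip (\<lambda>u::real \<times> real. - (fst u + snd u))"
    using lip_cmult[OF lip_add[OF lip_fst lip_snd], of "-1"] by simp
  have l4: "lip (\<lambda>u. max 0 (cut N - M u))"
    using lip_max[OF lip_const[of 0] lip_add[OF lip_const[of "cut N"] lip_cmult[OF lM, of "-1"]]] by simp
  let ?S = "{u. l1 u < 1}"
  have S: "bounded ?S" by (rule bounded_l1)
  have 0: "max 0 (cut N - M u) = 0" if "u \<notin> ?S" for u
    using that cut_bounds(2)[OF N] by (auto simp: M_def max_def)
  have "lip (\<lambda>u. 1 / M u * ((1 + ln (M u) / real N) * (- (fst u + snd u) * max 0 (cut N - M u))))"
    by (intro lip_mult_support[OF _ _ S] l1 l2 l3 l4) (use 0 in simp_all)
  moreover have "psi N = (\<lambda>u. 1 / M u * ((1 + ln (M u) / real N) * (- (fst u + snd u) * max 0 (cut N - M u))))"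
    by (auto simp: psi_def M_def Let_def fun_eq_iff)
  ultimately show ?thesis by simp
qed

text \<open>The open set on which \<open>psi N\<close> is differentiable with gradient \<open>grad_psi N\<close>.\<close>

definition good :: "nat \<Rightarrow> (real \<times> real) set" where
  "good N = {u. fst u \<noteq> 0 \<and> snd u \<noteq> 0 \<and> l1 u \<noteq> core N \<and> l1 u \<noteq> cut N}"

lemma open_good: "open (good N)"
  unfolding good_def by (intro open_Collect_conj open_Collect_neq continuous_intros)

lemma negligible_good: "negligible (- good N)"
proof -
  have diag: "negligible {u. l1 u = c}" for c
  proof (rule negligible_subset)
    let ?H = "\<lambda>a b. {u. (a::real, b::real) \<bullet> u = c}"
    show "negligible (?H 1 1 \<union> ?H 1 (-1) \<union> ?H (-1) 1 \<union> ?H (-1) (-1))"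
      by (intro negligible_Un negligible_affine_hyperplane) (auto simp: zero_prod_def)
    show "{u. l1 u = c} \<subseteq> ?H 1 1 \<union> ?H 1 (-1) \<union> ?H (-1) 1 \<union> ?H (-1) (-1)"
      by (auto simp: inner_prod_def abs_if)
  qed
  have "- good N = {u. (1, 0) \<bullet> u = 0} \<union> {u. (0, 1) \<bullet> u = 0} \<union> {u. l1 u = core N} \<union> {u. l1 u = cut N}"
    by (auto simp: good_def inner_prod_def)
  then show ?thesis
    by (auto intro!: negligible_Un diag negligible_affine_hyperplane simp: zero_prod_def)
qed

lemma prof_derivative:
  assumes "N \<ge> 1" "r > 0" shows "(prof N has_real_derivative dprof N r) (at r)"
  unfolding prof_def[abs_def] using assms
  by (auto intro!: derivative_eq_intros simp: dprof_def field_simps)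

lemma psi_inside:
  assumes "core N < l1 u" "l1 u < cut N"
  shows "psi N u = - (fst u + snd u) * (prof N (l1 u) / l1 u)"
  using assms by (simp add: psi_def prof_def Let_def max_def)

lemma psi_outside:
  assumes "l1 u < core N \<or> l1 u > cut N" "N \<ge> 1"
  shows "psi N u = 0"
  using assms(1)
proof
  assume "l1 u < core N"
  then have "max (l1 u) (core N) = core N" by simp
  then show ?thesis using assms(2) by (simp add: psi_def ln_core)
next
  assume "l1 u > cut N"
  then show ?thesis by (simp add: psi_def Let_def max_def)
qed

lemma lip_grad_psi:
  assumes N: "N \<ge> 1" shows "lip_grad (psi N) (grad_psi N)"
proof (rule lip_gradI[OF lip_psi[OF N] open_good negligible_good])
  let ?A = "good N \<inter> {u. core N < l1 u \<and> l1 u < cut N}"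
  let ?B = "good N \<inter> {u. l1 u < core N \<or> l1 u > cut N}"
  have opA: "open ?A"
    by (intro open_Int open_good open_Collect_conj open_Collect_less continuous_intros)
  have opB: "open ?B"
    by (intro open_Int open_good open_Collect_disj open_Collect_less continuous_intros)
  have AB: "good N = ?A \<union> ?B" by (auto simp: good_def)
  have pos: "l1 u > 0" if "u \<in> ?A" for u using that core_bounds(1)[of N] by auto
  have cA: "continuous_on ?A (\<lambda>u. - (prof N (l1 u) / l1 u) *\<^sub>R (1::real, 1::real)
       + ((fst u + snd u) * (prof N (l1 u) / (l1 u)\<^sup>2 - dprof N (l1 u) / l1 u)) *\<^sub>R (sgn (fst u), sgn (snd u)))"
  proof -
    have c1: "continuous_on ?A l1" by (intro continuous_intros)
    have im: "l1 ` ?A \<subseteq> {0<..}" using pos by auto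
    have "continuous_on {0<..} (prof N)" "continuous_on {0<..} (dprof N)"
      unfolding prof_def[abs_def] dprof_def[abs_def] using N by (auto intro!: continuous_intros)
    then have c2: "continuous_on ?A (\<lambda>u. prof N (l1 u))" "continuous_on ?A (\<lambda>u. dprof N (l1 u))"
      using continuous_on_compose2[OF _ c1 im] by blast+
    have nz: "\<forall>u\<in>?A. fst u \<noteq> 0" "\<forall>u\<in>?A. snd u \<noteq> 0" "\<forall>u\<in>?A. l1 u \<noteq> 0" "\<forall>u\<in>?A. (l1 u)\<^sup>2 \<noteq> 0"
    proof -
      have "l1 u \<noteq> 0" if "u \<in> ?A" for u using pos[OF that] by linarith
      then show "\<forall>u\<in>?A. l1 u \<noteq> 0" "\<forall>u\<in>?A. (l1 u)\<^sup>2 \<noteq> 0" by auto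
    qed (auto simp: good_def)
    show ?thesis
      by (intro continuous_on_add continuous_on_scaleR continuous_on_minus continuous_on_divide continuous_on_diff
          continuous_on_mult continuous_on_Pair continuous_on_sgn continuous_on_const continuous_on_fst continuous_on_snd
          continuous_on_id continuous_on_power c1 c2 nz)
  qed
  have "continuous_on ?A (grad_psi N)"
    by (rule continuous_on_eq[OF cA]) (auto simp: grad_psi_def Let_def)
  moreover have "continuous_on ?B (grad_psi N)"
    by (rule continuous_on_eq[OF continuous_on_const[of _ 0]]) (auto simp: grad_psi_def Let_def)
  ultimately have "continuous_on (?A \<union> ?B) (grad_psi N)" by (rule continuous_on_open_Un[OF opA opB])
  then show "continuous_on (good N) (grad_psi N)" by (subst AB)
  fix u assume "u \<in> good N"
  then consider "u \<in> ?A" | "u \<in> ?B" using AB by blast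
  then show "(psi N has_derivative (\<lambda>d. grad_psi N u \<bullet> d)) (at u)"
  proof cases
    case 1
    have r: "l1 u > 0" by (rule pos[OF 1])
    have d1: "(l1 has_derivative (\<lambda>d. sgn (fst u) * fst d + sgn (snd u) * snd d)) (at u)"
    proof -
      have "((\<lambda>u. \<bar>fst u\<bar>) has_derivative (\<lambda>d. sgn (fst u) * fst d)) (at u)"
        using has_derivative_compose[OF has_derivative_fst[OF has_derivative_ident], of "norm :: real \<Rightarrow> real" "\<lambda>h. h \<bullet> sgn (fst u)" u UNIV]
          has_derivative_norm[of "fst u"] 1 by (auto simp: good_def mult.commute)
      moreover have "((\<lambda>u. \<bar>snd u\<bar>) has_derivative (\<lambda>d. sgn (snd u) * snd d)) (at u)"
        using has_derivative_compose[OF has_derivative_snd[OF has_derivative_ident], of "norm :: real \<Rightarrow> real" "\<lambda>h. h \<bullet> sgn (snd u)" u UNIV]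
          has_derivative_norm[of "snd u"] 1 by (auto simp: good_def mult.commute)
      ultimately show ?thesis by (rule has_derivative_add)
    qed
    have "((\<lambda>r. prof N r / r) has_real_derivative (dprof N z / z - prof N z / z\<^sup>2)) (at z)" if "z > 0" for z
      using that by (auto intro!: derivative_eq_intros prof_derivative[OF N] simp: field_simps power2_eq_square)
    note q = this[OF r]
    have "((\<lambda>u. prof N (l1 u) / l1 u) has_derivative
        (\<lambda>d. (dprof N (l1 u) / l1 u - prof N (l1 u) / (l1 u)\<^sup>2) * (sgn (fst u) * fst d + sgn (snd u) * snd d))) (at u)"
      using has_derivative_compose[OF d1 q[unfolded has_field_derivative_def]] by simp
    moreover have "((\<lambda>u. - (fst u + snd u)) has_derivative (\<lambda>d. - (fst d + snd d))) (at u)"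
      by (auto intro!: derivative_eq_intros)
    ultimately have "((\<lambda>u. - (fst u + snd u) * (prof N (l1 u) / l1 u)) has_derivative
        (\<lambda>d. - (fst u + snd u) * ((dprof N (l1 u) / l1 u - prof N (l1 u) / (l1 u)\<^sup>2) * (sgn (fst u) * fst d + sgn (snd u) * snd d))
          + - (fst d + snd d) * (prof N (l1 u) / l1 u))) (at u)"
      by (intro has_derivative_mult)
    moreover have "(\<lambda>d. - (fst u + snd u) * ((dprof N (l1 u) / l1 u - prof N (l1 u) / (l1 u)\<^sup>2) * (sgn (fst u) * fst d + sgn (snd u) * snd d))
          + - (fst d + snd d) * (prof N (l1 u) / l1 u)) = (\<lambda>d. grad_psi N u \<bullet> d)"
    proof
      fix d
      define P where "P = prof N (l1 u) / l1 u"
      define Q where "Q = dprof N (l1 u) / l1 u - prof N (l1 u) / (l1 u)\<^sup>2"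
      have "grad_psi N u = - P *\<^sub>R (1, 1) + ((fst u + snd u) * (- Q)) *\<^sub>R (sgn (fst u), sgn (snd u))"
        using 1 by (simp add: grad_psi_def Let_def P_def Q_def)
      then have "grad_psi N u \<bullet> d = (- P + (fst u + snd u) * (- Q) * sgn (fst u)) * fst d
          + (- P + (fst u + snd u) * (- Q) * sgn (snd u)) * snd d"
        by (cases d) simp
      also have "\<dots> = - (fst u + snd u) * (Q * (sgn (fst u) * fst d + sgn (snd u) * snd d)) + - (fst d + snd d) * P"
        by (simp add: algebra_simps)
      finally show "- (fst u + snd u) * ((dprof N (l1 u) / l1 u - prof N (l1 u) / (l1 u)\<^sup>2) * (sgn (fst u) * fst d + sgn (snd u) * snd d))
          + - (fst d + snd d) * (prof N (l1 u) / l1 u) = grad_psi N u \<bullet> d"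
        unfolding P_def Q_def by simp
    qed
    ultimately have "((\<lambda>u. - (fst u + snd u) * (prof N (l1 u) / l1 u)) has_derivative (\<lambda>d. grad_psi N u \<bullet> d)) (at u)"
      by simp
    then show ?thesis
      by (rule has_derivative_transform_within_open[OF _ opA 1]) (simp add: psi_inside)
  next
    case 2
    have "((\<lambda>u. 0) has_derivative (\<lambda>d. grad_psi N u \<bullet> d)) (at u)"
      using 2 by (auto simp: grad_psi_def Let_def)
    then show ?thesis
      by (rule has_derivative_transform_within_open[OF _ opB 2]) (use psi_outside N in auto)
  qed
qed

subsection \<open>Pointwise bounds for the gradient\<close>

text \<open>A common radial bound for the energy density of $\psi - (x + y)$ on the white and the black quadrants, in the
  unit diamond. The three terms stem from the transition in the angle and the slope of the cutoff, from the values of the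
  logarithmic factor, and from the ring between \<open>cut N\<close> and one, where $\psi = 0$.\<close>

definition err :: "nat \<Rightarrow> real \<Rightarrow> real" where
  "err N r = 50 / ((real N)\<^sup>2 * r\<^sup>2) * indicator {core N..1} r + 16 / ((real N)\<^sup>2 * r) * indicator {0<..1} r
     + 2 * indicator {cut N..1} r"

lemma err_nonneg: "err N r \<ge> 0"
  by (auto simp: err_def indicator_def)

lemma ln_square_le:
  assumes "0 < r" "r \<le> (1::real)" shows "(ln r)\<^sup>2 \<le> 4 / r"
proof -
  have "ln (1 / sqrt r) \<le> 1 / sqrt r - 1" using assms by (intro ln_le_minus_one) simp
  moreover have "ln (1 / sqrt r) = - ln r / 2" using assms by (simp add: ln_div ln_sqrt)
  ultimately have "- ln r \<le> 2 / sqrt r" by simp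
  moreover have "0 \<le> - ln r" using assms by simp
  ultimately have "(- ln r)\<^sup>2 \<le> (2 / sqrt r)\<^sup>2" by (intro power_mono)
  then show ?thesis using assms by (simp add: power_divide)
qed

lemma grad_psi_white:
  assumes "0 < fst u * snd u" "core N < l1 u" "l1 u < cut N"
  shows "grad_psi N u = (- dprof N (l1 u)) *\<^sub>R (1, 1)"
proof -
  have r: "l1 u > 0" using assms core_bounds(1)[of N] by linarith
  have s: "(fst u + snd u) *\<^sub>R (sgn (fst u), sgn (snd u)) = l1 u *\<^sub>R (1, 1)"
    using assms(1) by (auto simp: zero_less_mult_iff sgn_if)
  let ?c = "prof N (l1 u) / (l1 u)\<^sup>2 - dprof N (l1 u) / l1 u"
  have "grad_psi N u = - (prof N (l1 u) / l1 u) *\<^sub>R (1, 1) + ?c *\<^sub>R ((fst u + snd u) *\<^sub>R (sgn (fst u), sgn (snd u)))"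
    using assms by (simp add: grad_psi_def Let_def mult.commute)
  also have "\<dots> = (- (prof N (l1 u) / l1 u) + ?c * l1 u) *\<^sub>R (1, 1)"
    unfolding s by (simp add: algebra_simps)
  also have "- (p / r) + (p / r\<^sup>2 - d / r) * r = - d" if "r > 0" for p d r :: real
    using that by (simp add: field_simps power2_eq_square)
  from this[OF r] have "- (prof N (l1 u) / l1 u) + ?c * l1 u = - dprof N (l1 u)" .
  finally show ?thesis .
qed

lemma norm_pair_sq: "(norm (a::real, b::real))\<^sup>2 = a\<^sup>2 + b\<^sup>2"
  by (simp add: norm_prod_def)

lemma err_core:
  assumes N: "N \<ge> 1" and r: "0 < r" "r < core N" shows "2 \<le> err N r"
proof -
  have r1: "r \<le> 1" using r core_bounds(2)[OF N] by linarith
  have "ln r < - real N" using r ln_core[of N] by (metis ln_less_cancel_iff core_bounds(1))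
  then have "real N < - ln r" by simp
  then have "(real N)\<^sup>2 \<le> (- ln r)\<^sup>2" by (intro power_mono) auto
  also have "\<dots> \<le> 4 / r" using ln_square_le[OF r(1) r1] by simp
  finally have "2 * (real N)\<^sup>2 \<le> 8 / r" by simp
  then have "2 \<le> 8 / ((real N)\<^sup>2 * r)" using N r by (simp add: field_simps)
  also have "\<dots> \<le> 16 / ((real N)\<^sup>2 * r)" using N r by (intro divide_right_mono) auto
  also have "\<dots> \<le> err N r" using r r1 by (simp add: err_def indicator_def)
  finally show ?thesis .
qed

lemma err_white:
  assumes N: "N \<ge> 1" and u: "0 < fst u * snd u" "l1 u < 1" "l1 u \<noteq> core N"
  shows "(norm (grad_psi N u - (1, 1)))\<^sup>2 \<le> err N (l1 u)"
proof -
  define r where "r = l1 u"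
  have r: "0 < r" "r < 1" "r \<noteq> core N" using u by (auto simp: r_def zero_less_mult_iff)
  consider "r < core N" | "cut N \<le> r" | "core N < r" "r < cut N" using r by linarith
  then show ?thesis
  proof cases
    case 1
    then have "grad_psi N u = 0" by (simp add: grad_psi_def r_def Let_def)
    then show ?thesis using err_core[OF N r(1) 1] by (simp add: norm_pair_sq zero_prod_def r_def)
  next
    case 2
    then have "grad_psi N u = 0" by (simp add: grad_psi_def r_def Let_def)
    moreover have "2 \<le> err N r" using 2 r by (simp add: err_def indicator_def)
    ultimately show ?thesis by (simp add: norm_pair_sq zero_prod_def r_def)
  next
    case 3
    define A where "A = ln r / real N"
    define B where "B = (cut N - r) / (real N * r)"
    have "grad_psi N u - (1, 1) = (A - B, A - B)"
      using grad_psi_white[OF u(1)] 3 by (simp add: r_def[symmetric] dprof_def A_def B_def)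
    then have "(norm (grad_psi N u - (1, 1)))\<^sup>2 = 2 * (A - B)\<^sup>2" by (simp add: norm_pair_sq)
    also have "\<dots> \<le> 4 * A\<^sup>2 + 4 * B\<^sup>2"
      using zero_le_power2[of "A + B"] by (simp add: power2_eq_square algebra_simps)
    also have "A\<^sup>2 \<le> 4 / ((real N)\<^sup>2 * r)"
    proof -
      have "A\<^sup>2 \<le> (4 / r) / (real N)\<^sup>2"
        unfolding A_def power_divide using ln_square_le[of r] r by (intro divide_right_mono) auto
      then show ?thesis by (simp add: mult.commute)
    qed
    also have "B\<^sup>2 \<le> 1 / ((real N)\<^sup>2 * r\<^sup>2)"
    proof -
      have "(cut N - r)\<^sup>2 \<le> 1\<^sup>2" using 3 r cut_bounds(2)[OF N] by (intro power_mono) auto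
      then show ?thesis unfolding B_def power_divide power_mult_distrib by (intro divide_right_mono) auto
    qed
    finally have "(norm (grad_psi N u - (1, 1)))\<^sup>2 \<le> 16 / ((real N)\<^sup>2 * r) + 4 / ((real N)\<^sup>2 * r\<^sup>2)" by simp
    also have "\<dots> \<le> 16 / ((real N)\<^sup>2 * r) + 50 / ((real N)\<^sup>2 * r\<^sup>2)"
      by (intro add_left_mono divide_right_mono) auto
    also have "\<dots> \<le> err N r" using 3 r by (simp add: err_def indicator_def)
    finally show ?thesis by (simp add: r_def)
  qed
qed

lemma err_black:
  assumes N: "N \<ge> 1" and u: "0 < l1 u" "l1 u < 1" "l1 u \<noteq> core N"
  shows "(norm (grad_psi N u - (1, 1)))\<^sup>2 / (real N)\<^sup>2 \<le> err N (l1 u)"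
proof -
  define r where "r = l1 u"
  have r: "0 < r" "r < 1" "r \<noteq> core N" using u by (auto simp: r_def)
  have N2: "1 \<le> (real N)\<^sup>2" using N by simp
  consider "r < core N" | "cut N \<le> r" | "core N < r" "r < cut N" using r by linarith
  then show ?thesis
  proof cases
    case 1
    then have "grad_psi N u = 0" by (simp add: grad_psi_def r_def Let_def)
    then have "(norm (grad_psi N u - (1, 1)))\<^sup>2 / (real N)\<^sup>2 = 2 / (real N)\<^sup>2" by (simp add: norm_pair_sq zero_prod_def)
    also have "\<dots> \<le> 2" using N2 by (simp add: divide_le_eq)
    finally show ?thesis using err_core[OF N r(1) 1] by (simp add: r_def)
  next
    case 2
    then have "grad_psi N u = 0" by (simp add: grad_psi_def r_def Let_def)
    then have "(norm (grad_psi N u - (1, 1)))\<^sup>2 / (real N)\<^sup>2 = 2 / (real N)\<^sup>2" by (simp add: norm_pair_sq zero_prod_def)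
    also have "\<dots> \<le> 2" using N2 by (simp add: divide_le_eq)
    also have "2 \<le> err N r" using 2 r by (simp add: err_def indicator_def)
    finally show ?thesis by (simp add: r_def)
  next
    case 3
    have chi: "0 \<le> 1 + ln r / real N" "1 + ln r / real N \<le> 1"
    proof -
      have "- real N \<le> ln r" using 3 ln_core[of N] r core_bounds(1)[of N] by (metis less_imp_le ln_le_cancel_iff)
      then show "0 \<le> 1 + ln r / real N" using N by (simp add: field_simps)
      show "1 + ln r / real N \<le> 1" using r N by (simp add: divide_le_0_iff)
    qed
    have ct: "0 \<le> cut N - r" "cut N - r \<le> 1" using 3 r cut_bounds(2)[OF N] by auto
    have f: "0 \<le> prof N r" "prof N r \<le> 1" using ct chi by (auto simp: prof_def intro: mult_le_one)
    have rinv: "1 \<le> 1 / r" using r by simp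
    have d: "\<bar>dprof N r\<bar> \<le> 1 / r"
    proof -
      have "(cut N - r) / (real N * r) \<le> 1 / (1 * r)"
        using ct N r by (intro frac_le mult_right_mono) auto
      moreover have "0 \<le> (cut N - r) / (real N * r)" using ct r by simp
      ultimately show ?thesis using chi rinv unfolding dprof_def by (simp add: abs_le_iff)
    qed
    \<comment> \<open>Each component of the difference is at most $5/r$, and $50 = 5^2 + 5^2$.\<close>
    have comp: "\<bar>- (prof N r / r) + ((fst u + snd u) * (prof N r / r\<^sup>2 - dprof N r / r)) * s - 1\<bar> \<le> 5 / r"
      if s: "\<bar>s\<bar> \<le> 1" for s
    proof -
      have "\<bar>fst u + snd u\<bar> \<le> r" by (simp add: r_def)
      then have "\<bar>(fst u + snd u) * (prof N r / r\<^sup>2 - dprof N r / r) * s\<bar> \<le> r * (\<bar>prof N r / r\<^sup>2\<bar> + \<bar>dprof N r / r\<bar>) * 1"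
        unfolding abs_mult by (intro mult_mono abs_triangle_ineq4) (use s r in auto)
      also have "\<dots> = prof N r / r + \<bar>dprof N r\<bar>"
        using r f by (simp add: abs_divide field_simps power2_eq_square)
      also have "\<dots> \<le> 1 / r + 1 / r" using f d r by (intro add_mono divide_right_mono) auto
      finally have "\<bar>(fst u + snd u) * (prof N r / r\<^sup>2 - dprof N r / r) * s\<bar> \<le> 2 * (1 / r)" by simp
      moreover have "\<bar>prof N r / r\<bar> \<le> 1 / r" using f r by (simp add: divide_right_mono)
      moreover have "5 / r = 5 * (1 / r)" by simp
      moreover have "\<bar>- p + q - 1\<bar> \<le> 5 * e" if "\<bar>q\<bar> \<le> 2 * e" "\<bar>p\<bar> \<le> e" "1 \<le> e" for p q e :: real
        using that by linarith
      ultimately show ?thesis using rinv by metis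
    qed
    have g: "grad_psi N u = (- (prof N r / r) + ((fst u + snd u) * (prof N r / r\<^sup>2 - dprof N r / r)) * sgn (fst u),
        - (prof N r / r) + ((fst u + snd u) * (prof N r / r\<^sup>2 - dprof N r / r)) * sgn (snd u))"
      using 3 by (simp add: grad_psi_def Let_def r_def)
    have sq: "a\<^sup>2 \<le> (5 / r)\<^sup>2" if "\<bar>a\<bar> \<le> 5 / r" for a
      using power_mono[OF that, of 2] by simp
    have "(norm (grad_psi N u - (1, 1)))\<^sup>2 \<le> (5 / r)\<^sup>2 + (5 / r)\<^sup>2"
      unfolding g diff_Pair norm_pair_sq by (intro add_mono sq comp) (auto simp: sgn_if)
    then have "(norm (grad_psi N u - (1, 1)))\<^sup>2 / (real N)\<^sup>2 \<le> ((5 / r)\<^sup>2 + (5 / r)\<^sup>2) / (real N)\<^sup>2"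
      by (intro divide_right_mono) auto
    also have "\<dots> = 50 / ((real N)\<^sup>2 * r\<^sup>2)" by (simp add: power_divide field_simps)
    also have "\<dots> \<le> err N r" using 3 r by (simp add: err_def indicator_def)
    finally show ?thesis by (simp add: r_def)
  qed
qed

subsection \<open>Integrals of functions of the taxicab norm\<close>

lemma nn_integral_split_sign:
  fixes f :: "real \<Rightarrow> ennreal"
  assumes [measurable]: "f \<in> borel_measurable borel"
  shows "(\<integral>\<^sup>+x. f x \<partial>lborel) = (\<integral>\<^sup>+x. indicator {0<..} x * (f x + f (- x)) \<partial>lborel)"
proof -
  have "(\<integral>\<^sup>+x. f x \<partial>lborel) = (\<integral>\<^sup>+x. indicator {0<..} x * f x + indicator {..<0} x * f x \<partial>lborel)"
  proof (rule nn_integral_cong_AE)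
    show "AE x in lborel. f x = indicator {0<..} x * f x + indicator {..<0} x * f x"
      using AE_lborel_singleton[of 0] by eventually_elim (auto simp: indicator_def)
  qed
  also have "\<dots> = (\<integral>\<^sup>+x. indicator {0<..} x * f x \<partial>lborel) + (\<integral>\<^sup>+x. indicator {..<0} x * f x \<partial>lborel)"
    by (rule nn_integral_add) auto
  also have "(\<integral>\<^sup>+x. indicator {..<0} x * f x \<partial>lborel) = (\<integral>\<^sup>+x. indicator {..<0} (- x) * f (- x) \<partial>lborel)"
    using nn_integral_real_affine[of "\<lambda>x. indicator {..<0} x * f x" "-1" 0] by simp
  also have "\<dots> = (\<integral>\<^sup>+x. indicator {0<..} x * f (- x) \<partial>lborel)"
    by (rule nn_integral_cong) (auto simp: indicator_def)
  also have "(\<integral>\<^sup>+x. indicator {0<..} x * f x \<partial>lborel) + \<dots> = (\<integral>\<^sup>+x. indicator {0<..} x * f x + indicator {0<..} x * f (- x) \<partial>lborel)"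
    by (rule nn_integral_add[symmetric]) auto
  finally show ?thesis by (simp add: distrib_left)
qed

lemma nn_integral_quadrant:
  fixes g :: "real \<Rightarrow> ennreal"
  assumes [measurable]: "g \<in> borel_measurable borel"
  shows "(\<integral>\<^sup>+x. \<integral>\<^sup>+y. indicator {0<..} x * (indicator {0<..} y * g (x + y)) \<partial>lborel \<partial>lborel)
    = (\<integral>\<^sup>+r. ennreal r * indicator {0<..} r * g r \<partial>lborel)"
proof -
  have "(\<integral>\<^sup>+x. \<integral>\<^sup>+y. indicator {0<..} x * (indicator {0<..} y * g (x + y)) \<partial>lborel \<partial>lborel)
      = (\<integral>\<^sup>+x. \<integral>\<^sup>+r. indicator {0<..} x * (indicator {0<..} (r - x) * g r) \<partial>lborel \<partial>lborel)"
  proof (rule nn_integral_cong)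
    fix x :: real
    show "(\<integral>\<^sup>+y. indicator {0<..} x * (indicator {0<..} y * g (x + y)) \<partial>lborel)
        = (\<integral>\<^sup>+r. indicator {0<..} x * (indicator {0<..} (r - x) * g r) \<partial>lborel)"
      using nn_integral_real_affine[of "\<lambda>r. indicator {0<..} x * (indicator {0<..} (r - x) * g r)" 1 x] by simp
  qed
  also have "\<dots> = (\<integral>\<^sup>+r. \<integral>\<^sup>+x. indicator {0<..} x * (indicator {0<..} (r - x) * g r) \<partial>lborel \<partial>lborel)"
    by (rule lborel_pair.Fubini') measurable
  also have "\<dots> = (\<integral>\<^sup>+r. ennreal r * indicator {0<..} r * g r \<partial>lborel)"
  proof (rule nn_integral_cong)
    fix r :: real
    have "(\<integral>\<^sup>+x. indicator {0<..} x * (indicator {0<..} (r - x) * g r) \<partial>lborel)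
        = (\<integral>\<^sup>+x. g r * indicator {0<..<r} x \<partial>lborel)"
      by (rule nn_integral_cong) (auto simp: indicator_def)
    also have "\<dots> = g r * emeasure lborel {0<..<r}" by (rule nn_integral_cmult_indicator) simp
    also have "\<dots> = ennreal r * indicator {0<..} r * g r"
      by (cases "r > 0") (auto simp: indicator_def mult.commute)
    finally show "(\<integral>\<^sup>+x. indicator {0<..} x * (indicator {0<..} (r - x) * g r) \<partial>lborel)
        = ennreal r * indicator {0<..} r * g r" .
  qed
  finally show ?thesis .
qed

text \<open>The plane is folded onto the positive quadrant.\<close>

lemma nn_integral_plane:
  fixes F :: "real \<times> real \<Rightarrow> ennreal"
  assumes [measurable]: "F \<in> borel_measurable borel"
  shows "(\<integral>\<^sup>+u. F u \<partial>lborel) = (\<integral>\<^sup>+x. \<integral>\<^sup>+y. indicator {0<..} x * (indicator {0<..} y *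
     (F (x, y) + F (x, - y) + F (- x, y) + F (- x, - y))) \<partial>lborel \<partial>lborel)"
proof -
  have "(\<integral>\<^sup>+u. F u \<partial>lborel) = (\<integral>\<^sup>+u. F u \<partial>(lborel \<Otimes>\<^sub>M lborel))" by (simp add: lborel_prod)
  also have "\<dots> = (\<integral>\<^sup>+x. \<integral>\<^sup>+y. F (x, y) \<partial>lborel \<partial>lborel)"
    by (rule lborel.nn_integral_fst[symmetric]) (simp add: lborel_prod)
  also have "\<dots> = (\<integral>\<^sup>+x. indicator {0<..} x * ((\<integral>\<^sup>+y. F (x, y) \<partial>lborel) + (\<integral>\<^sup>+y. F (- x, y) \<partial>lborel)) \<partial>lborel)"
    by (rule nn_integral_split_sign) measurable
  also have "\<dots> = (\<integral>\<^sup>+x. \<integral>\<^sup>+y. indicator {0<..} x * (indicator {0<..} y *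
     (F (x, y) + F (x, - y) + F (- x, y) + F (- x, - y))) \<partial>lborel \<partial>lborel)"
  proof (rule nn_integral_cong)
    fix x :: real
    have "(\<integral>\<^sup>+y. F (x, y) \<partial>lborel) + (\<integral>\<^sup>+y. F (- x, y) \<partial>lborel) = (\<integral>\<^sup>+y. F (x, y) + F (- x, y) \<partial>lborel)"
      by (rule nn_integral_add[symmetric]) measurable
    also have "\<dots> = (\<integral>\<^sup>+y. indicator {0<..} y * ((F (x, y) + F (- x, y)) + (F (x, - y) + F (- x, - y))) \<partial>lborel)"
      by (rule nn_integral_split_sign) measurable
    finally have "indicator {0<..} x * ((\<integral>\<^sup>+y. F (x, y) \<partial>lborel) + (\<integral>\<^sup>+y. F (- x, y) \<partial>lborel))
      = indicator {0<..} x * (\<integral>\<^sup>+y. indicator {0<..} y * ((F (x, y) + F (- x, y)) + (F (x, - y) + F (- x, - y))) \<partial>lborel)" by simp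
    also have "\<dots> = (\<integral>\<^sup>+y. indicator {0<..} x * (indicator {0<..} y * ((F (x, y) + F (- x, y)) + (F (x, - y) + F (- x, - y)))) \<partial>lborel)"
      by (rule nn_integral_cmult[symmetric]) measurable
    finally show "indicator {0<..} x * ((\<integral>\<^sup>+y. F (x, y) \<partial>lborel) + (\<integral>\<^sup>+y. F (- x, y) \<partial>lborel))
      = (\<integral>\<^sup>+y. indicator {0<..} x * (indicator {0<..} y * (F (x, y) + F (x, - y) + F (- x, y) + F (- x, - y))) \<partial>lborel)"
      by (simp add: ac_simps)
  qed
  finally show ?thesis .
qed

lemma nn_integral_l1:
  fixes g :: "real \<Rightarrow> ennreal"
  assumes [measurable]: "g \<in> borel_measurable borel"
  shows "(\<integral>\<^sup>+u. g (l1 u) \<partial>lborel) = 4 * (\<integral>\<^sup>+r. ennreal r * indicator {0<..} r * g r \<partial>lborel)"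
proof -
  have "(\<integral>\<^sup>+u. g (l1 u) \<partial>lborel) = (\<integral>\<^sup>+x. \<integral>\<^sup>+y. indicator {0<..} x * (indicator {0<..} y * (4 * g (x + y))) \<partial>lborel \<partial>lborel)"
  proof -
    have "(\<lambda>u. g (l1 u)) \<in> borel_measurable borel"
      by (rule measurable_compose[OF lip_borel[OF lip_l1] assms])
    note nn_integral_plane[OF this]
    also have "(\<integral>\<^sup>+x. \<integral>\<^sup>+y. indicator {0<..} x * (indicator {0<..} y *
       (g (l1 (x, y)) + g (l1 (x, - y)) + g (l1 (- x, y)) + g (l1 (- x, - y)))) \<partial>lborel \<partial>lborel)
      = (\<integral>\<^sup>+x. \<integral>\<^sup>+y. indicator {0<..} x * (indicator {0<..} y * (4 * g (x + y))) \<partial>lborel \<partial>lborel)"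
    proof (intro nn_integral_cong)
      have four: "z + z + z + z = 4 * z" for z :: ennreal
        using distrib_right[of 2 2 z] by (simp add: mult_2 add.assoc)
      show "indicator {0<..} x * (indicator {0<..} y *
         (g (l1 (x, y)) + g (l1 (x, - y)) + g (l1 (- x, y)) + g (l1 (- x, - y))))
        = indicator {0<..} x * (indicator {0<..} y * (4 * g (x + y)))" for x y :: real
        by (auto simp: indicator_def four)
    qed
    finally show ?thesis .
  qed
  also have "\<dots> = (\<integral>\<^sup>+r. ennreal r * indicator {0<..} r * (4 * g r) \<partial>lborel)"
    by (rule nn_integral_quadrant) measurable
  also have "\<dots> = (\<integral>\<^sup>+r. 4 * (ennreal r * indicator {0<..} r * g r) \<partial>lborel)"
    by (simp add: ac_simps)
  also have "\<dots> = 4 * (\<integral>\<^sup>+r. ennreal r * indicator {0<..} r * g r \<partial>lborel)"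
    by (rule nn_integral_cmult) measurable
  finally show ?thesis .
qed

lemma distr_l1_white:
  "distr (density lborel (\<lambda>u. indicator {u. 0 < fst u * snd u} u)) borel l1
    = density lborel (\<lambda>r. ennreal (2 * r) * indicator {0<..} r)"
proof (rule measure_eqI)
  fix A assume "A \<in> sets (distr (density lborel (\<lambda>u. indicator {u. 0 < fst u * snd u} u)) borel l1)"
  then have A[measurable]: "A \<in> sets borel" by simp
  have lm[measurable]: "l1 \<in> borel_measurable borel" by (rule lip_borel[OF lip_l1])
  have "open {u :: real \<times> real. 0 < fst u * snd u}" by (intro open_Collect_less continuous_intros)
  then have W[measurable]: "{u :: real \<times> real. 0 < fst u * snd u} \<in> sets borel" by simp
  let ?F = "\<lambda>u :: real \<times> real. indicator {u. 0 < fst u * snd u} u * indicator A (l1 u) :: ennreal"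
  have F: "?F \<in> borel_measurable borel" by measurable
  have "emeasure (distr (density lborel (\<lambda>u. indicator {u. 0 < fst u * snd u} u)) borel l1) A
      = emeasure (density lborel (\<lambda>u. indicator {u. 0 < fst u * snd u} u)) (l1 -` A)"
    by (subst emeasure_distr) auto
  also have "\<dots> = (\<integral>\<^sup>+u. ?F u \<partial>lborel)"
    by (subst emeasure_density) (auto simp: measurable_sets_borel[OF lm A] indicator_def intro!: nn_integral_cong)
  also have "\<dots> = (\<integral>\<^sup>+x. \<integral>\<^sup>+y. indicator {0<..} x * (indicator {0<..} y *
       (?F (x, y) + ?F (x, - y) + ?F (- x, y) + ?F (- x, - y))) \<partial>lborel \<partial>lborel)"
    by (rule nn_integral_plane[OF F])
  also have "\<dots> = (\<integral>\<^sup>+x. \<integral>\<^sup>+y. indicator {0<..} x * (indicator {0<..} y * (2 * indicator A (x + y))) \<partial>lborel \<partial>lborel)"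
    by (intro nn_integral_cong) (auto simp: indicator_def mult_less_0_iff zero_less_mult_iff)
  also have "\<dots> = (\<integral>\<^sup>+r. ennreal r * indicator {0<..} r * (2 * indicator A r) \<partial>lborel)"
    by (rule nn_integral_quadrant) measurable
  also have "\<dots> = emeasure (density lborel (\<lambda>r. ennreal (2 * r) * indicator {0<..} r)) A"
    by (subst emeasure_density) (auto simp: indicator_def ennreal_mult mult.commute intro!: nn_integral_cong)
  finally show "emeasure (distr (density lborel (\<lambda>u. indicator {u. 0 < fst u * snd u} u)) borel l1) A
      = emeasure (density lborel (\<lambda>r. ennreal (2 * r) * indicator {0<..} r)) A" .
qed simp

lemma LINT_l1_white:
  fixes h :: "real \<Rightarrow> real"
  assumes [measurable]: "h \<in> borel_measurable borel"
  shows "(LINT u|lborel. indicator {u. 0 < fst u * snd u} u * h (l1 u))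
    = (LINT r|lborel. 2 * r * indicator {0<..} r * h r)"
proof -
  have lm[measurable]: "l1 \<in> borel_measurable borel" by (rule lip_borel[OF lip_l1])
  have "open {u :: real \<times> real. 0 < fst u * snd u}" by (intro open_Collect_less continuous_intros)
  then have W[measurable]: "{u :: real \<times> real. 0 < fst u * snd u} \<in> sets borel" by simp
  have "(LINT u|lborel. indicator {u. 0 < fst u * snd u} u * h (l1 u))
      = (LINT u|density lborel (\<lambda>u. ennreal (indicator {u. 0 < fst u * snd u} u)). h (l1 u))"
    by (subst integral_density) auto
  also have "\<dots> = (LINT r|distr (density lborel (\<lambda>u. ennreal (indicator {u. 0 < fst u * snd u} u))) borel l1. h r)"
    by (rule integral_distr[symmetric]) auto
  also have "\<dots> = (LINT r|density lborel (\<lambda>r. ennreal (2 * r * indicator {0<..} r)). h r)"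
    unfolding ennreal_indicator distr_l1_white
    by (rule arg_cong[where f="\<lambda>M. integral\<^sup>L M h"], rule density_cong) (auto simp: indicator_def)
  also have "\<dots> = (LINT r|lborel. 2 * r * indicator {0<..} r * h r)"
    by (subst integral_density) (auto simp: indicator_def)
  finally show ?thesis .
qed

lemma err_measurable: "err N \<in> borel_measurable borel"
  unfolding err_def[abs_def] by measurable

lemma nn_integral_err:
  assumes N: "N \<ge> 1"
  shows "(\<integral>\<^sup>+r. ennreal r * indicator {0<..} r * ennreal (err N r) \<partial>lborel) \<le> ennreal (67 / real N)"
proof -
  have c: "0 < core N" "core N \<le> 1" using core_bounds[of N] N by auto
  have ct: "0 < cut N" "cut N < 1" using cut_bounds[OF N] by auto
  let ?a = "\<lambda>r. ennreal (50 / ((real N)\<^sup>2 * r)) * indicator {core N..1} r"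
  let ?b = "\<lambda>r::real. ennreal (16 / (real N)\<^sup>2) * indicator {0..1} r"
  let ?c = "\<lambda>r::real. ennreal 2 * indicator {cut N..1} r"
  have "(\<integral>\<^sup>+r. ennreal r * indicator {0<..} r * ennreal (err N r) \<partial>lborel) \<le> (\<integral>\<^sup>+r. ?a r + ?b r + ?c r \<partial>lborel)"
  proof (rule nn_integral_mono)
    fix r :: real
    show "ennreal r * indicator {0<..} r * ennreal (err N r) \<le> ?a r + ?b r + ?c r"
    proof (cases "0 < r")
      case True
      have "r * err N r = 50 / ((real N)\<^sup>2 * r) * indicator {core N..1} r + 16 / (real N)\<^sup>2 * indicator {0..1} r
          + 2 * r * indicator {cut N..1} r"
        using True by (simp add: err_def field_simps power2_eq_square indicator_def)
      also have "\<dots> \<le> 50 / ((real N)\<^sup>2 * r) * indicator {core N..1} r + 16 / (real N)\<^sup>2 * indicator {0..1} r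
          + 2 * indicator {cut N..1} r"
        by (auto simp: indicator_def)
      finally have "ennreal (r * err N r) \<le> ennreal (50 / ((real N)\<^sup>2 * r) * indicator {core N..1} r
          + 16 / (real N)\<^sup>2 * indicator {0..1} r + 2 * indicator {cut N..1} r)"
        by (rule ennreal_leI)
      also have "\<dots> = ?a r + ?b r + ?c r" using True by (auto simp: indicator_def ennreal_plus)
      finally show ?thesis using True err_nonneg[of N r] by (simp add: ennreal_mult)
    qed simp
  qed
  also have "\<dots> = (\<integral>\<^sup>+r. ?a r \<partial>lborel) + (\<integral>\<^sup>+r. ?b r \<partial>lborel) + (\<integral>\<^sup>+r. ?c r \<partial>lborel)"
  proof -
    have m: "?a \<in> borel_measurable borel" "?b \<in> borel_measurable borel" "?c \<in> borel_measurable borel"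
      by measurable
    have "(\<integral>\<^sup>+r. (?a r + ?b r) + ?c r \<partial>lborel) = (\<integral>\<^sup>+r. ?a r + ?b r \<partial>lborel) + (\<integral>\<^sup>+r. ?c r \<partial>lborel)"
      by (rule nn_integral_add) (use m in auto)
    also have "(\<integral>\<^sup>+r. ?a r + ?b r \<partial>lborel) = (\<integral>\<^sup>+r. ?a r \<partial>lborel) + (\<integral>\<^sup>+r. ?b r \<partial>lborel)"
      by (rule nn_integral_add) (use m in auto)
    finally show ?thesis .
  qed
  also have "(\<integral>\<^sup>+r. ?a r \<partial>lborel) = ennreal (50 / (real N)\<^sup>2 * ln 1 - 50 / (real N)\<^sup>2 * ln (core N))"
  proof (rule nn_integral_FTC_Icc[where F="\<lambda>r. 50 / (real N)\<^sup>2 * ln r"])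
    show "((\<lambda>r. 50 / (real N)\<^sup>2 * ln r) has_real_derivative 50 / ((real N)\<^sup>2 * r)) (at r)" if "r \<in> {core N..1}" for r
    proof -
      have "((\<lambda>r. 50 / (real N)\<^sup>2 * ln r) has_real_derivative 50 / (real N)\<^sup>2 * (1 / r)) (at r)"
        by (intro DERIV_cmult DERIV_ln_divide) (use that c in simp)
      then show ?thesis by simp
    qed
  qed (use c in auto)
  also have "50 / (real N)\<^sup>2 * ln 1 - 50 / (real N)\<^sup>2 * ln (core N) = 50 / real N"
    using N by (simp add: ln_core power2_eq_square)
  also have "(\<integral>\<^sup>+r. ?b r \<partial>lborel) = ennreal (16 / (real N)\<^sup>2)"
    by (subst nn_integral_cmult_indicator) auto
  also have "(\<integral>\<^sup>+r. ?c r \<partial>lborel) = ennreal (2 * (1 - cut N))"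
    using ct ennreal_mult[of 2 "1 - cut N"] by (subst nn_integral_cmult_indicator) (simp_all del: ennreal_numeral)
  also have "ennreal (50 / real N) + ennreal (16 / (real N)\<^sup>2) + ennreal (2 * (1 - cut N))
      = ennreal (50 / real N + 16 / (real N)\<^sup>2 + 2 * (1 - cut N))"
    using ct by (simp add: ennreal_plus)
  also have "\<dots> \<le> ennreal (67 / real N)"
  proof (rule ennreal_leI)
    have "16 / (real N)\<^sup>2 \<le> 16 / real N" using N by (intro divide_left_mono) (auto simp: power2_eq_square)
    moreover have "2 * (1 - cut N) \<le> 1 / real N" using N by (simp add: cut_def field_simps)
    ultimately show "50 / real N + 16 / (real N)\<^sup>2 + 2 * (1 - cut N) \<le> 67 / real N" by (simp add: add_divide_distrib[symmetric])
  qed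
  finally show ?thesis .
qed

lemma err_l1_integral:
  assumes N: "N \<ge> 1"
  shows "integrable lborel (\<lambda>u. err N (l1 u))" "(LINT u|lborel. err N (l1 u)) \<le> 268 / real N"
proof -
  have m: "(\<lambda>u. err N (l1 u)) \<in> borel_measurable borel"
    by (rule measurable_compose[OF lip_borel[OF lip_l1] err_measurable])
  have "(\<integral>\<^sup>+u. ennreal (err N (l1 u)) \<partial>lborel) = 4 * (\<integral>\<^sup>+r. ennreal r * indicator {0<..} r * ennreal (err N r) \<partial>lborel)"
    by (rule nn_integral_l1) (use err_measurable[of N] in measurable)
  also have "\<dots> \<le> 4 * ennreal (67 / real N)" by (intro mult_left_mono nn_integral_err[OF N]) auto
  also have "\<dots> = ennreal (268 / real N)" using ennreal_mult[of 4 "67 / real N"] by simp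
  finally have le: "(\<integral>\<^sup>+u. ennreal (err N (l1 u)) \<partial>lborel) \<le> ennreal (268 / real N)" .
  show i: "integrable lborel (\<lambda>u. err N (l1 u))"
  proof (rule integrableI_nonneg)
    show "(\<integral>\<^sup>+u. ennreal (err N (l1 u)) \<partial>lborel) < \<infinity>" using le by (rule le_less_trans) simp
  qed (use m err_nonneg in auto)
  have "ennreal (LINT u|lborel. err N (l1 u)) \<le> ennreal (268 / real N)"
    using le nn_integral_eq_integral[OF i] err_nonneg by simp
  then show "(LINT u|lborel. err N (l1 u)) \<le> 268 / real N" by (simp add: ennreal_le_iff)
qed

text \<open>The derivative of the profile in direction $(1,1)$ on the white quadrants, as a function of the taxicab norm.\<close>

definition flux :: "nat \<Rightarrow> real \<Rightarrow> real" where
  "flux N r = indicator {core N<..<cut N} r * (- 2 * dprof N r)"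

lemma flux_measurable: "flux N \<in> borel_measurable borel"
  unfolding flux_def[abs_def] dprof_def by measurable

lemma white_grad_psi:
  "indicator {u. 0 < fst u * snd u} u * (grad_psi N u \<bullet> (1, 1)) = indicator {u. 0 < fst u * snd u} u * flux N (l1 u)"
proof (cases "0 < fst u * snd u")
  case True
  show ?thesis
  proof (cases "core N < l1 u \<and> l1 u < cut N")
    case C: True
    then show ?thesis using grad_psi_white[OF True] True by (simp add: flux_def indicator_def)
  next
    case False
    then show ?thesis by (auto simp: grad_psi_def Let_def flux_def indicator_def)
  qed
qed simp

text \<open>The flux of the profile through the white squares: an integration by parts turns the integral of
  $-r f'(r)$ into that of $f \ge 0$, which is bounded below independently of \<open>N\<close>.\<close>

lemma white_flux:
  assumes N: "N \<ge> 1"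
  shows "(LINT u|lborel. indicator {u. 0 < fst u * snd u} u * (grad_psi N u \<bullet> (1, 1))) \<ge> 1 / 160"
proof -
  have c: "0 < core N" "core N \<le> 1 / 2" using core_bounds[of N] N by auto
  have ct: "3 / 4 \<le> cut N" "cut N < 1" using cut_bounds[OF N] by auto
  have cp: "continuous_on {core N..cut N} (prof N)" "continuous_on {core N..cut N} (dprof N)"
    unfolding prof_def[abs_def] dprof_def[abs_def] using N c by (auto intro!: continuous_intros)
  have "(LINT u|lborel. indicator {u. 0 < fst u * snd u} u * (grad_psi N u \<bullet> (1, 1)))
      = (LINT r|lborel. 2 * r * indicator {0<..} r * flux N r)"
    unfolding white_grad_psi by (rule LINT_l1_white[OF flux_measurable])
  also have "\<dots> = (LINT r|lborel. indicator {core N..cut N} r * (- 4 * (r * dprof N r)))"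
  proof (rule integral_cong_AE)
    show "AE r in lborel. 2 * r * indicator {0<..} r * flux N r = indicator {core N..cut N} r * (- 4 * (r * dprof N r))"
      using AE_lborel_singleton[of "core N"] AE_lborel_singleton[of "cut N"]
      by eventually_elim (use c in \<open>auto simp: flux_def indicator_def\<close>)
    show "(\<lambda>r. indicator {core N..cut N} r * (- 4 * (r * dprof N r))) \<in> borel_measurable lborel"
      unfolding dprof_def by measurable
    show "(\<lambda>r. 2 * r * indicator {0<..} r * flux N r) \<in> borel_measurable lborel"
      using flux_measurable[of N] by measurable
  qed
  also have "\<dots> = integral {core N..cut N} (\<lambda>r. - 4 * (r * dprof N r))"
  proof -
    have "continuous_on {core N..cut N} (\<lambda>r. - 4 * (r * dprof N r))" by (intro continuous_intros cp)
    then have "set_integrable lborel {core N..cut N} (\<lambda>r. - 4 * (r * dprof N r))" by (rule borel_integrable_atLeastAtMost')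
    from set_borel_integral_eq_integral(2)[OF this] show ?thesis by (simp add: set_lebesgue_integral_def)
  qed
  also have "\<dots> = 4 * integral {core N..cut N} (prof N)"
  proof -
    have "((\<lambda>r. prof N r + r * dprof N r) has_integral cut N * prof N (cut N) - core N * prof N (core N)) {core N..cut N}"
    proof (rule fundamental_theorem_of_calculus)
      show "core N \<le> cut N" using c ct by simp
      fix r assume r: "r \<in> {core N..cut N}"
      then have "((\<lambda>r. r * prof N r) has_real_derivative prof N r + r * dprof N r) (at r)"
        using c by (auto intro!: derivative_eq_intros prof_derivative[OF N])
      then show "((\<lambda>r. r * prof N r) has_vector_derivative prof N r + r * dprof N r) (at r within {core N..cut N})"
        by (simp add: has_real_derivative_iff_has_vector_derivative has_vector_derivative_at_within)
    qed
    moreover have "prof N (cut N) = 0" "prof N (core N) = 0" using N by (auto simp: prof_def ln_core)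
    ultimately have "integral {core N..cut N} (\<lambda>r. prof N r + r * dprof N r) = 0" by (simp add: integral_unique)
    moreover have "prof N integrable_on {core N..cut N}" "(\<lambda>r. r * dprof N r) integrable_on {core N..cut N}"
      by (intro integrable_continuous_real continuous_intros cp)+
    ultimately show ?thesis by (simp add: Henstock_Kurzweil_Integration.integral_add)
  qed
  also have "4 * integral {core N..cut N} (prof N) \<ge> 4 * (1 / 640)"
  proof (intro mult_left_mono)
    have nn: "0 \<le> prof N r" if "r \<in> {core N..cut N}" for r
    proof -
      have "- real N \<le> ln r" using that ln_core[of N] c(1) by (metis atLeastAtMost_iff ln_le_cancel_iff order_less_le_trans)
      then have "0 \<le> 1 + ln r / real N" using N by (simp add: field_simps)
      then show ?thesis using that by (simp add: prof_def)
    qed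
    \<comment> \<open>An interval below all radii \<open>cut N\<close>, on which the logarithmic factor is at least $2/5$ even for $N = 1$.\<close>
    have lb: "1 / 40 \<le> prof N r" if r: "r \<in> {5/8..11/16}" for r
    proof -
      have "ln (1 / r) \<le> 1 / r - 1" using r by (intro ln_le_minus_one) auto
      moreover have "1 / r \<le> 8 / 5" using r by (simp add: field_simps)
      ultimately have l: "- (3 / 5) \<le> ln r" using r by (simp add: ln_div)
      have "ln r \<le> 0" using r by simp
      then have "real N * ln r \<le> 1 * ln r" using N by (intro mult_right_mono_neg) auto
      then have "ln r \<le> ln r / real N" using N by (simp add: field_simps)
      then have "2 / 5 \<le> 1 + ln r / real N" using l by linarith
      moreover have "1 / 16 \<le> cut N - r" using r ct by simp
      ultimately have "(1 / 16) * (2 / 5) \<le> (cut N - r) * (1 + ln r / real N)" by (intro mult_mono) auto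
      then show ?thesis by (simp add: prof_def)
    qed
    have sub: "{5/8..11/16} \<subseteq> {core N..cut N}" using c ct by auto
    have "1 / 640 = integral {5/8..11/16} (\<lambda>r::real. 1 / 40 :: real)" by simp
    also have "\<dots> \<le> integral {5/8..11/16} (prof N)"
      by (rule integral_le) (use lb sub in \<open>auto intro!: integrable_continuous_real continuous_on_subset[OF cp(1)]\<close>)
    also have "\<dots> \<le> integral {core N..cut N} (prof N)"
      by (rule integral_subset_le[OF sub]) (use nn sub in \<open>auto intro!: integrable_continuous_real continuous_on_subset[OF cp(1)]\<close>)
    finally show "1 / 640 \<le> integral {core N..cut N} (prof N)" .
  qed simp
  finally show ?thesis by simp
qed

section \<open>The coefficient\<close>

text \<open>The union of the white squares of the checkerboard, continued to the whole plane.\<close>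

definition white :: "nat \<Rightarrow> (real \<times> real) set" where
  "white N = {p. even (\<lfloor>2 * real N * fst p\<rfloor> + \<lfloor>2 * real N * snd p\<rfloor>)}"

lemma white_borel: "white N \<in> sets borel"
proof -
  have f: "(\<lambda>p::real \<times> real. \<lfloor>2 * real N * fst p\<rfloor>) \<in> borel \<rightarrow>\<^sub>M count_space UNIV"
    by (rule measurable_compose[OF _ measurable_real_floor]) (intro borel_measurable_continuous_onI continuous_intros)
  have s: "(\<lambda>p::real \<times> real. \<lfloor>2 * real N * snd p\<rfloor>) \<in> borel \<rightarrow>\<^sub>M count_space UNIV"
    by (rule measurable_compose[OF _ measurable_real_floor]) (intro borel_measurable_continuous_onI continuous_intros)
  have "white N = (\<Union>a. \<Union>b\<in>{b. even (a + b)}. ((\<lambda>p. \<lfloor>2 * real N * fst p\<rfloor>) -` {a}) \<inter> ((\<lambda>p. \<lfloor>2 * real N * snd p\<rfloor>) -` {b}))"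
    by (auto simp: white_def)
  moreover have "(\<lambda>p::real \<times> real. \<lfloor>2 * real N * fst p\<rfloor>) -` {a} \<in> sets borel" for a
    using measurable_sets[OF f, of "{a}"] by simp
  moreover have "(\<lambda>p::real \<times> real. \<lfloor>2 * real N * snd p\<rfloor>) -` {b} \<in> sets borel" for b
    using measurable_sets[OF s, of "{b}"] by simp
  ultimately show ?thesis by (auto intro!: sets.countable_UN'')
qed

lemma white_lebesgue: "white N \<in> sets lebesgue"
  using white_borel by simp

lemma interior_square:
  assumes N: "N \<ge> 1"
  shows "p \<in> interior (square N i j) \<longleftrightarrow> real i < 2 * real N * fst p \<and> 2 * real N * fst p < real i + 1 \<and>
    real j < 2 * real N * snd p \<and> 2 * real N * snd p < real j + 1"
  using N by (cases p) (auto simp: square_def interior_cbox gridpt_def mem_box_rect field_simps)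

lemma coeff_white:
  assumes N: "N \<ge> 1" and p: "p \<in> white N" shows "coeff N p = 1"
proof -
  have "even (i + j)" if "p \<in> interior (square N i j)" for i j
  proof -
    have "\<lfloor>2 * real N * fst p\<rfloor> = int i" "\<lfloor>2 * real N * snd p\<rfloor> = int j"
      using that unfolding interior_square[OF N] by (auto intro!: floor_unique)
    then show ?thesis using p unfolding white_def by (simp flip: of_nat_add)
  qed
  then show ?thesis unfolding coeff_def black_def by (auto dest: bspec)
qed

lemma coeff_black:
  assumes N: "N \<ge> 1" and p: "p \<notin> white N" "p \<in> Omega" "p \<in> off_mesh N"
  shows "coeff N p = 1 / (real N)\<^sup>2"
proof -
  define i where "i = nat \<lfloor>2 * real N * fst p\<rfloor>"
  define j where "j = nat \<lfloor>2 * real N * snd p\<rfloor>"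
  have pos: "0 < fst p" "fst p < 1" "0 < snd p" "snd p < 1" using p(2) by (auto simp: Omega_def)
  have fl: "0 \<le> \<lfloor>2 * real N * fst p\<rfloor>" "0 \<le> \<lfloor>2 * real N * snd p\<rfloor>" using pos by auto
  have "2 * real N * fst p < real (2 * N)" "2 * real N * snd p < real (2 * N)" using pos N by auto
  then have lt: "i < 2 * N" "j < 2 * N" using fl unfolding i_def j_def by (simp_all add: nat_less_iff floor_less_iff)
  have ri: "real i = of_int \<lfloor>2 * real N * fst p\<rfloor>" "real j = of_int \<lfloor>2 * real N * snd p\<rfloor>"
    using fl by (simp_all add: i_def j_def)
  have "p \<in> interior (square N i j)"
    unfolding interior_square[OF N] ri using p(3) floor_strict[of "2 * real N * fst p"] floor_strict[of "2 * real N * snd p"]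
    by (auto simp: off_mesh_def)
  moreover have "black i j"
  proof -
    have "odd (int i + int j)" using p(1) fl by (simp add: white_def i_def j_def)
    then show ?thesis unfolding black_def by (simp flip: of_nat_add)
  qed
  ultimately show ?thesis using lt unfolding coeff_def by auto
qed

lemma coeff_bounds: "N \<ge> 1 \<Longrightarrow> 0 \<le> coeff N p" "N \<ge> 1 \<Longrightarrow> coeff N p \<le> 1"
  by (auto simp: coeff_def divide_le_eq)

lemma coeff_measurable: "coeff N \<in> borel_measurable lebesgue"
proof -
  define O' where "O' = (\<Union>i<2*N. \<Union>j\<in>{j. j < 2 * N \<and> black i j}. interior (square N i j))"
  have "open O'" unfolding O'_def by auto
  then have O': "O' \<in> sets lebesgue" by simp
  have "coeff N = (\<lambda>p. if p \<in> O' then 1 / (real N)\<^sup>2 else 1)"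
    unfolding O'_def coeff_def by (auto simp: fun_eq_iff)
  moreover have "(\<lambda>p. if p \<in> O' then 1 / (real N)\<^sup>2 else 1) \<in> borel_measurable lebesgue"
    using O' by (intro measurable_If_set) auto
  ultimately show ?thesis by simp
qed

lemma energy_norm_lip_grad:
  fixes f V :: "real \<times> real \<Rightarrow> real"
  assumes N: "N \<ge> 1" and V: "lip_grad V g" and D: "open D" and S: "S \<in> sets lebesgue" "negligible (S - D)"
    and eq: "\<And>x. x \<in> D \<Longrightarrow> f x = V x"
  shows "(energy_norm N D S f)\<^sup>2 = (LINT x|lebesgue_on S. coeff N x * (norm (g x))\<^sup>2)"
proof -
  have hw: "has_weak_grad D f g" by (rule lip_grad_has_weak_grad[OF V D]) (rule eq)
  have "(LINT x|lebesgue_on S. (norm (sqrt (coeff N x) *\<^sub>R weak_grad D f x))\<^sup>2) = (LINT x|lebesgue_on S. coeff N x * (norm (g x))\<^sup>2)"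
  proof (rule LINT_lebesgue_on_cong_AE[OF _ S(1)])
    show "(\<lambda>x. coeff N x * (norm (g x))\<^sup>2) \<in> borel_measurable lebesgue"
      using coeff_measurable lip_grad_measurable[OF V] by simp
    have "AE x in lebesgue. x \<notin> S - D" using S(2) by (intro AE_not_in) (simp add: negligible_iff_null_sets)
    then show "AE x in lebesgue. x \<in> S \<longrightarrow> (norm (sqrt (coeff N x) *\<^sub>R weak_grad D f x))\<^sup>2 = coeff N x * (norm (g x))\<^sup>2"
      using weak_grad_AE[OF D hw]
    proof eventually_elim
      case (elim x)
      then show ?case using coeff_bounds(1)[OF N, of x] by (auto simp: power_mult_distrib)
    qed
  qed
  moreover have "0 \<le> (LINT x|lebesgue_on S. coeff N x * (norm (g x))\<^sup>2)"
    by (intro integral_nonneg_AE) (simp add: coeff_bounds(1)[OF N])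
  ultimately show ?thesis unfolding energy_norm_def L2_norm_def by simp
qed

section \<open>The functional that separates the discrete space\<close>

lemma off_mesh_reflect:
  assumes N: "N \<ge> 1" and p: "p \<in> off_mesh N"
  shows "2 *\<^sub>R gridpt N k l - p \<in> off_mesh N" "2 *\<^sub>R gridpt N k l - p \<in> white N \<longleftrightarrow> p \<in> white N"
proof -
  define s where "s = 2 * real N * fst p"
  define t where "t = 2 * real N * snd p"
  have e: "2 * real N * fst (2 *\<^sub>R gridpt N k l - p) = of_int (2 * int k) - s"
    "2 * real N * snd (2 *\<^sub>R gridpt N k l - p) = of_int (2 * int l) - t"
    using N by (auto simp: gridpt_def s_def t_def field_simps)
  have st: "s \<notin> \<int>" "t \<notin> \<int>" "s + t \<notin> \<int>" using p by (auto simp: off_mesh_def s_def t_def)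
  have I: "of_int m - x \<in> \<int> \<longleftrightarrow> x \<in> \<int>" for m :: int and x :: real
    by (metis Ints_diff Ints_of_int diff_diff_eq2 add_diff_cancel_left')
  have sum: "of_int (2 * int k) - s + (of_int (2 * int l) - t) = of_int (2 * int k + 2 * int l) - (s + t)" by simp
  show "2 *\<^sub>R gridpt N k l - p \<in> off_mesh N"
    unfolding off_mesh_def mem_Collect_eq e sum I using st by blast
  have fl: "\<lfloor>of_int m - x\<rfloor> = m - 1 - \<lfloor>x\<rfloor>" if "x \<notin> \<int>" for m :: int and x :: real
  proof -
    have "of_int (m - 1 - \<lfloor>x\<rfloor>) = of_int m - 1 - (of_int \<lfloor>x\<rfloor> :: real)" by simp
    then show ?thesis using floor_strict[OF that] by (intro floor_unique) linarith+
  qed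
  show "2 *\<^sub>R gridpt N k l - p \<in> white N \<longleftrightarrow> p \<in> white N"
    unfolding white_def mem_Collect_eq e fl[OF st(1)] fl[OF st(2)] s_def[symmetric] t_def[symmetric] by simp presburger
qed

text \<open>Each nodal basis function is symmetric about its vertex, as is the union of the white squares;
  hence its gradient integrates to zero over the white squares.\<close>

lemma white_integral_hat:
  assumes N: "N \<ge> 1"
  shows "(LINT p|lebesgue. indicator (white N) p * (gradient (hat N k l) p \<bullet> b)) = 0"
proof -
  let ?c = "2 *\<^sub>R gridpt N k l"
  let ?F = "\<lambda>p. indicator (white N) p * (gradient (hat N k l) p \<bullet> b)"
  note L = lip_grad_hat[OF N, of k l]
  have Fm: "?F \<in> borel_measurable lebesgue"
    using lip_grad_measurable[OF L] white_lebesgue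
    by (intro borel_measurable_times borel_measurable_indicator borel_measurable_inner) auto
  have sym: "hat N k l (?c - p) = hat N k l p" for p
  proof -
    have "2 * real N * fst (?c - p) - real k = - (2 * real N * fst p - real k)"
      "2 * real N * snd (?c - p) - real l = - (2 * real N * snd p - real l)"
      using N by (auto simp: gridpt_def field_simps)
    moreover have "courant (- s) (- t) = courant s t" for s t
      unfolding courant_def using abs_minus_cancel[of "s + t"] by simp
    ultimately show ?thesis unfolding hat_def by (simp only:)
  qed
  have odd: "gradient (hat N k l) (?c - p) = - gradient (hat N k l) p" if p: "p \<in> off_mesh N" for p
  proof -
    obtain S q r where S: "open S" "?c - p \<in> S" "\<And>y. y \<in> S \<Longrightarrow> hat N k l y = q \<bullet> y + r"
    proof -
      obtain S where S: "open S" "?c - p \<in> S" "affine_on S (hat N k l)"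
        using hat_locally_affine[OF off_mesh_reflect(1)[OF N p]] by blast
      then obtain q r where "\<forall>y\<in>S. hat N k l y = q \<bullet> y + r" unfolding affine_on_def by blast
      then show ?thesis using that S(1,2) by blast
    qed
    have "((\<lambda>y. q \<bullet> y + r) has_derivative (\<lambda>d. q \<bullet> d)) (at (?c - p))" by (auto intro!: derivative_eq_intros)
    then have d: "(hat N k l has_derivative (\<lambda>d. q \<bullet> d)) (at (?c - p))"
      by (rule has_derivative_transform_within_open[OF _ S(1,2)]) (simp add: S(3))
    have "((\<lambda>p. ?c - p) has_derivative (\<lambda>d. - d)) (at p)" by (auto intro!: derivative_eq_intros)
    from has_derivative_compose[OF this d] have "(hat N k l has_derivative (\<lambda>d. (- q) \<bullet> d)) (at p)"
      by (simp add: sym)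
    from has_derivative_gradient[OF this] show ?thesis using has_derivative_gradient[OF d] by simp
  qed
  have "(LINT p|lebesgue. ?F p) = (LINT p|lebesgue. ?F (?c - p))"
    by (rule lebesgue_integral_reflect[OF Fm, symmetric])
  also have "\<dots> = (LINT p|lebesgue. - ?F p)"
  proof (rule integral_cong_AE)
    show "(\<lambda>p. ?F (?c - p)) \<in> borel_measurable lebesgue"
      by (rule measurable_compose[OF lebesgue_measurable_reflect Fm])
    show "(\<lambda>p. - ?F p) \<in> borel_measurable lebesgue" using Fm by simp
    show "AE p in lebesgue. ?F (?c - p) = - ?F p"
      using negligible_compl_AE[OF negligible_off_mesh[OF N]]
    proof eventually_elim
      case (elim p)
      then show ?case using odd[OF elim] off_mesh_reflect(2)[OF N elim, of k l] by (simp add: indicator_def)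
    qed
  qed
  finally show ?thesis by simp
qed

section \<open>The counterexample\<close>

text \<open>The interior even vertices.\<close>

definition even_idx :: "nat \<Rightarrow> (nat \<times> nat) set" where
  "even_idx N = {(k, l) \<in> inner_idx N 1. even (k + l)}"

text \<open>Local coordinates at the vertex \<open>gridpt N k l\<close>, in units of the mesh width.\<close>

definition scaled :: "nat \<Rightarrow> nat \<Rightarrow> nat \<Rightarrow> real \<times> real \<Rightarrow> real \<times> real" where
  "scaled N k l p = (2 * real N) *\<^sub>R p + (- real k, - real l)"

text \<open>The sawtooth and its gradient. The factor \<open>1 / (2 * real N)\<close> is the mesh width; it cancels in the gradient.\<close>

definition witness :: "nat \<Rightarrow> real \<times> real \<Rightarrow> real" where
  "witness N p = (\<Sum>(k, l)\<in>even_idx N. 1 / (2 * real N) * psi N (scaled N k l p))"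

definition grad_witness :: "nat \<Rightarrow> real \<times> real \<Rightarrow> real \<times> real" where
  "grad_witness N p = (\<Sum>(k, l)\<in>even_idx N. grad_psi N (scaled N k l p))"

lemma finite_even_idx: "finite (even_idx N)"
  by (rule finite_subset[of _ "inner_idx N 1"]) (auto simp: even_idx_def)

lemma scaled_sel: "fst (scaled N k l p) = 2 * real N * fst p - real k" "snd (scaled N k l p) = 2 * real N * snd p - real l"
  by (simp_all add: scaled_def)

lemma lip_grad_witness:
  assumes N: "N \<ge> 1" shows "lip_grad (witness N) (grad_witness N)"
proof -
  have "lip_grad (\<lambda>p. 1 / (2 * real N) * psi N (scaled N k l p)) (\<lambda>p. grad_psi N (scaled N k l p))" for k l
  proof -
    have "2 * real N \<noteq> 0" using N by simp
    from lip_grad_cmult[OF lip_grad_affine[OF lip_grad_psi[OF N] this, of "(- real k, - real l)"], of "1 / (2 * real N)"]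
    show ?thesis using N by (simp add: scaled_def)
  qed
  then show ?thesis unfolding witness_def[abs_def] grad_witness_def[abs_def] split_beta
    by (intro lip_grad_sum finite_even_idx)
qed

lemma grad_psi_outside: "cut N \<le> l1 u \<Longrightarrow> grad_psi N u = 0"
  by (simp add: grad_psi_def Let_def)

lemma scaled_inside_Omega:
  assumes N: "N \<ge> 1" and kl: "(k, l) \<in> even_idx N" and p: "l1 (scaled N k l p) \<le> cut N"
  shows "p \<in> cbox ((1 - cut N) / (2 * real N), (1 - cut N) / (2 * real N))
     (1 - (1 - cut N) / (2 * real N), 1 - (1 - cut N) / (2 * real N))"
proof -
  have *: "(1 - cut N) / (2 * real N) \<le> x \<and> x \<le> 1 - (1 - cut N) / (2 * real N)"
    if "\<bar>2 * real N * x - real m\<bar> \<le> cut N" "1 \<le> m" "m \<le> 2 * N - 1" for x m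
  proof -
    have m: "1 \<le> real m" "real m + 1 \<le> 2 * real N" using that by linarith+
    have "1 - cut N \<le> 2 * real N * x" "2 * real N * x \<le> 2 * real N - (1 - cut N)" using that(1) m by linarith+
    then show ?thesis using N by (auto simp: field_simps)
  qed
  have "\<bar>2 * real N * fst p - real k\<bar> \<le> cut N" "\<bar>2 * real N * snd p - real l\<bar> \<le> cut N"
    using p by (auto simp: scaled_sel)
  then show ?thesis using *[of "fst p" k] *[of "snd p" l] kl by (cases p) (auto simp: even_idx_def cbox_Pair_eq)
qed

lemma witness_H10: assumes N: "N \<ge> 1" shows "witness N \<in> H10 Omega"
proof -
  let ?h = "(1 - cut N) / (2 * real N)"
  let ?K = "cbox (?h, ?h) (1 - ?h, 1 - ?h)"
  show ?thesis
  proof (rule lip_grad_in_H10[OF lip_grad_witness[OF N] open_Omega bounded_Omega compact_cbox[of "(?h, ?h)" "(1 - ?h, 1 - ?h)"]])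
    show "?K \<subseteq> Omega"
    proof
      fix p assume "p \<in> ?K"
      then have "?h \<le> fst p" "fst p \<le> 1 - ?h" "?h \<le> snd p" "snd p \<le> 1 - ?h"
        by (cases p, simp add: cbox_Pair_eq)+
      moreover have "0 < ?h" using N cut_bounds(2)[OF N] by simp
      ultimately show "p \<in> Omega"
        unfolding Omega_def mem_Times_iff greaterThanLessThan_iff by linarith
    qed
    fix p assume p: "p \<notin> ?K"
    have "psi N (scaled N k l p) = 0" if "(k, l) \<in> even_idx N" for k l
    proof (rule psi_outside[OF _ N])
      show "l1 (scaled N k l p) < core N \<or> cut N < l1 (scaled N k l p)"
        using scaled_inside_Omega[OF N that, of p] p by linarith
    qed
    then show "witness N p = 0" unfolding witness_def by (intro sum.neutral) auto
  qed
qed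

lemma grad_witness_outside:
  assumes N: "N \<ge> 1" and p: "p \<notin> Omega" shows "grad_witness N p = 0"
proof -
  let ?h = "(1 - cut N) / (2 * real N)"
  have h: "0 < ?h" using N cut_bounds(2)[OF N] by simp
  have "grad_psi N (scaled N k l p) = 0" if kl: "(k, l) \<in> even_idx N" for k l
  proof (rule grad_psi_outside, rule ccontr)
    assume "\<not> cut N \<le> l1 (scaled N k l p)"
    then have "p \<in> cbox (?h, ?h) (1 - ?h, 1 - ?h)" by (intro scaled_inside_Omega[OF N kl]) simp
    then have "?h \<le> fst p" "fst p \<le> 1 - ?h" "?h \<le> snd p" "snd p \<le> 1 - ?h"
      by (cases p, simp add: cbox_Pair_eq)+
    then have "p \<in> Omega" using h unfolding Omega_def mem_Times_iff greaterThanLessThan_iff by linarith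
    with p show False by simp
  qed
  then show ?thesis unfolding grad_witness_def by (intro sum.neutral) auto
qed

text \<open>The diamonds around even vertices do not overlap.\<close>

lemma even_idx_unique:
  fixes k l k' l' :: int
  assumes "even (k + l)" "even (k' + l')" and "\<bar>s - of_int k\<bar> + \<bar>t - of_int l\<bar> < 1"
    and "\<bar>s - of_int k'\<bar> + \<bar>t - of_int l'\<bar> < (1::real)"
  shows "k = k' \<and> l = l'"
proof -
  have "\<bar>of_int k - of_int k'\<bar> + \<bar>of_int l - of_int l'\<bar> < (2::real)" using assms(3,4) by linarith
  then have "\<bar>k - k'\<bar> + \<bar>l - l'\<bar> < 2" by linarith
  then show ?thesis using assms(1,2) by presburger
qed

lemma grad_witness_local:
  assumes kl: "(k, l) \<in> even_idx N" and p: "l1 (scaled N k l p) < 1" and N: "N \<ge> 1"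
  shows "grad_witness N p = grad_psi N (scaled N k l p)"
proof -
  have "grad_psi N (scaled N a b p) = 0" if ab: "(a, b) \<in> even_idx N - {(k, l)}" for a b
  proof (rule grad_psi_outside, rule ccontr)
    assume "\<not> cut N \<le> l1 (scaled N a b p)"
    then have "l1 (scaled N a b p) < 1" using cut_bounds(2)[OF N] by linarith
    then have "int a = int k \<and> int b = int l"
      by (intro even_idx_unique[of "int a" "int b" "int k" "int l" "2 * real N * fst p" "2 * real N * snd p"])
        (use ab kl p in \<open>auto simp: even_idx_def scaled_sel simp flip: of_nat_add\<close>)
    then show False using ab by simp
  qed
  then have "grad_witness N p = (\<Sum>(a, b)\<in>{(k, l)}. grad_psi N (scaled N a b p))"
    unfolding grad_witness_def using kl by (intro sum.mono_neutral_right finite_even_idx) auto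
  then show ?thesis by simp
qed

lemma grad_witness_away:
  assumes "\<And>k l. (k, l) \<in> even_idx N \<Longrightarrow> l1 (scaled N k l p) \<ge> 1" and N: "N \<ge> 1"
  shows "grad_witness N p = 0"
  unfolding grad_witness_def by (rule sum.neutral) (use assms cut_bounds(2)[OF N] in \<open>auto intro!: grad_psi_outside intro: order_trans less_imp_le\<close>)

text \<open>The open diamonds around the even vertices of the whole lattice cover all points off their boundaries
  and the grid lines.\<close>

lemma even_nbr:
  fixes s t :: real
  assumes "s \<notin> \<int>" "t \<notin> \<int>" "s + t \<notin> \<int>" "s - t \<notin> \<int>"
  obtains k l :: int where "even (k + l)" "\<bar>s - of_int k\<bar> + \<bar>t - of_int l\<bar> < 1"
proof -
  define i where "i = \<lfloor>s\<rfloor>"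
  define j where "j = \<lfloor>t\<rfloor>"
  have i: "of_int i < s" "s < of_int i + 1" and j: "of_int j < t" "t < of_int j + 1"
    using floor_strict[OF assms(1)] floor_strict[OF assms(2)] by (auto simp: i_def j_def)
  have n1: "s + t \<noteq> of_int (i + j + 1)" using assms(3) Ints_of_int by metis
  have n2: "s - t \<noteq> of_int (i - j)" using assms(4) Ints_of_int by metis
  show ?thesis
  proof (cases "even (i + j)")
    case True
    show ?thesis
    proof (cases "s + t < of_int (i + j + 1)")
      case True
      then show ?thesis using i j \<open>even (i + j)\<close> by (intro that[of i j]) auto
    next
      case False
      then show ?thesis using i j n1 \<open>even (i + j)\<close> by (intro that[of "i + 1" "j + 1"]) auto
    qed
  next
    case False
    show ?thesis
    proof (cases "s - t < of_int (i - j)")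
      case True
      then show ?thesis using i j \<open>odd (i + j)\<close> by (intro that[of i "j + 1"]) auto
    next
      case False
      then show ?thesis using i j n2 \<open>odd (i + j)\<close> by (intro that[of "i + 1" j]) auto
    qed
  qed
qed

text \<open>A set of full measure on which all pieces of the construction are differentiable and no coordinate is on a
  line of the mesh or on the other diagonal of a square.\<close>

definition generic :: "nat \<Rightarrow> (real \<times> real) set" where
  "generic N = off_mesh N \<inter> {p. 2 * real N * fst p - 2 * real N * snd p \<notin> \<int>} \<inter>
     {p. \<forall>(k, l)\<in>even_idx N. scaled N k l p \<in> good N}"

lemma AE_generic:
  assumes N: "N \<ge> 1" shows "AE p in lebesgue. p \<in> generic N"
proof -
  have 1: "AE p in lebesgue. p \<in> off_mesh N" by (rule negligible_compl_AE[OF negligible_off_mesh[OF N]])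
  have "negligible {p. (2 * real N, - 2 * real N) \<bullet> p \<in> \<int>}"
    using N by (intro negligible_inner_Ints) (simp add: zero_prod_def)
  then have 2: "AE p in lebesgue. 2 * real N * fst p - 2 * real N * snd p \<notin> \<int>"
    using AE_not_in[of "{p. (2 * real N, - 2 * real N) \<bullet> p \<in> \<int>}" lebesgue] by (simp add: negligible_iff_null_sets inner_prod_def)
  have 3: "AE p in lebesgue. scaled N k l p \<in> good N" for k l
  proof -
    let ?T = "\<lambda>u. (1 / (2 * real N)) *\<^sub>R (u + (real k, real l))"
    have sub: "- {p. scaled N k l p \<in> good N} \<subseteq> ?T ` (- good N)"
    proof
      fix p assume "p \<in> - {p. scaled N k l p \<in> good N}"
      moreover have "p = ?T (scaled N k l p)"
        using N by (cases p) (simp add: scaled_def)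
      ultimately show "p \<in> ?T ` (- good N)" by blast
    qed
    have "negligible (?T ` (- good N))"
      by (rule negligible_differentiable_image_negligible[OF order_refl negligible_good])
        (auto intro!: derivative_intros simp: differentiable_on_def)
    then have "negligible (- {p. scaled N k l p \<in> good N})" using sub by (rule negligible_subset)
    from negligible_compl_AE[OF this] show ?thesis by simp
  qed
  have "AE p in lebesgue. \<forall>x\<in>even_idx N. scaled N (fst x) (snd x) p \<in> good N"
    using 3 by (intro AE_ball_countable' countable_finite finite_even_idx)
  with 1 2 show ?thesis
    by eventually_elim (auto simp: generic_def)
qed

lemma white_scaled:
  assumes kl: "(k, l) \<in> even_idx N" and p: "l1 (scaled N k l p) < 1" "scaled N k l p \<in> good N"
  shows "p \<in> white N \<longleftrightarrow> 0 < fst (scaled N k l p) * snd (scaled N k l p)"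
proof -
  define s where "s = 2 * real N * fst p"
  define t where "t = 2 * real N * snd p"
  have u: "\<bar>s - real k\<bar> < 1" "\<bar>t - real l\<bar> < 1" "s - real k \<noteq> 0" "t - real l \<noteq> 0"
    using p by (auto simp: scaled_sel good_def s_def t_def)
  have fl: "\<lfloor>x\<rfloor> = (if 0 < x - real m then int m else int m - 1)" if "\<bar>x - real m\<bar> < 1" "x - real m \<noteq> 0" for x m
    using that by (intro floor_unique) (auto split: if_splits)
  have ev: "even (int k + int l)" using kl by (simp add: even_idx_def flip: of_nat_add)
  have "p \<in> white N \<longleftrightarrow> even (\<lfloor>s\<rfloor> + \<lfloor>t\<rfloor>)" by (simp add: white_def s_def t_def)
  also have "\<dots> \<longleftrightarrow> (0 < s - real k \<longleftrightarrow> 0 < t - real l)"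
    unfolding fl[OF u(1,3)] fl[OF u(2,4)] using ev by auto
  also have "\<dots> \<longleftrightarrow> 0 < (s - real k) * (t - real l)"
    using u(3,4) by (auto simp: zero_less_mult_iff)
  finally show ?thesis by (simp add: scaled_sel s_def t_def)
qed

text \<open>The local coordinates scale areas by $4N^2$.\<close>

lemma lborel_integral_scaled:
  fixes F :: "real \<times> real \<Rightarrow> real"
  assumes N: "N \<ge> 1" and F[measurable]: "F \<in> borel_measurable borel"
  shows "(LINT p|lborel. F (scaled N k l p)) = (LINT u|lborel. F u) / (4 * (real N)\<^sup>2)"
    and "integrable lborel F \<Longrightarrow> integrable lborel (\<lambda>p. F (scaled N k l p))"
proof -
  have c: "2 * real N \<noteq> 0" using N by simp
  have lm[measurable]: "scaled N k l \<in> borel_measurable borel"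
    unfolding scaled_def[abs_def] by (intro borel_measurable_continuous_onI continuous_intros)
  have "scaled N k l = (\<lambda>x. (- real k, - real l) + (2 * real N) *\<^sub>R x)"
    by (auto simp: scaled_def fun_eq_iff)
  then have D: "(lborel :: (real \<times> real) measure) = density (distr lborel borel (scaled N k l)) (\<lambda>_. ennreal (4 * (real N)\<^sup>2))"
    using lborel_affine[OF c, of "(- real k, - real l)"] by (simp add: power2_eq_square)
  have "(LINT u|lborel. F u) = (LINT u|density (distr lborel borel (scaled N k l)) (\<lambda>_. ennreal (4 * (real N)\<^sup>2)). F u)"
    using D by simp
  also have "\<dots> = (LINT u|distr lborel borel (scaled N k l). 4 * (real N)\<^sup>2 * F u)"
    by (subst integral_density) auto
  also have "\<dots> = (LINT p|lborel. 4 * (real N)\<^sup>2 * F (scaled N k l p))"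
    by (rule integral_distr) auto
  finally show "(LINT p|lborel. F (scaled N k l p)) = (LINT u|lborel. F u) / (4 * (real N)\<^sup>2)"
    using N by simp
  assume "integrable lborel F"
  then have "integrable (density (distr lborel borel (scaled N k l)) (\<lambda>_. ennreal (4 * (real N)\<^sup>2))) F"
    using D by simp
  then have "integrable (distr lborel borel (scaled N k l)) (\<lambda>u. 4 * (real N)\<^sup>2 * F u)"
    by (subst (asm) integrable_density) auto
  then have "integrable lborel (\<lambda>p. 4 * (real N)\<^sup>2 * F (scaled N k l p))"
    by (subst (asm) integrable_distr_eq) auto
  then show "integrable lborel (\<lambda>p. F (scaled N k l p))" using N by simp
qed

subsection \<open>The local errors\<close>

lemma coeff_grad_witness:
  assumes N: "N \<ge> 1" and p: "p \<in> generic N" "p \<in> Omega" and kl: "(k, l) \<in> even_idx N" "l1 (scaled N k l p) < 1"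
  shows "coeff N p * (norm (grad_witness N p - (1, 1)))\<^sup>2 \<le> err N (l1 (scaled N k l p))"
proof -
  let ?u = "scaled N k l p"
  have u: "?u \<in> good N" using p(1) kl(1) by (auto simp: generic_def)
  have u': "l1 ?u \<noteq> core N" "0 < l1 ?u" using u by (auto simp: good_def)
  have g: "grad_witness N p = grad_psi N ?u" by (rule grad_witness_local[OF kl N])
  show ?thesis
  proof (cases "p \<in> white N")
    case True
    then have "0 < fst ?u * snd ?u" using white_scaled[OF kl u] by simp
    then show ?thesis using err_white[OF N _ kl(2) u'(1)] coeff_white[OF N True] g by simp
  next
    case False
    have "p \<in> off_mesh N" using p(1) by (simp add: generic_def)
    then show ?thesis using err_black[OF N u'(2) kl(2) u'(1)] coeff_black[OF N False p(2)] g by simp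
  qed
qed

text \<open>The vertex itself and its eight neighbours on the grid. The differences are not truncated for interior
  vertices.\<close>

definition nbrs :: "nat \<Rightarrow> nat \<Rightarrow> (nat \<times> nat) set" where
  "nbrs a b = {a - 1..a + 1} \<times> {b - 1..b + 1}"

lemma nbrs: "finite (nbrs a b)" "card (nbrs a b) \<le> 9"
proof -
  have "card {a - 1..a + 1} \<le> 3" for a :: nat by simp
  then have "card {a - 1..a + 1} * card {b - 1..b + 1} \<le> 3 * 3" by (intro mult_mono) auto
  then show "card (nbrs a b) \<le> 9" by (simp add: nbrs_def card_cartesian_product)
qed (simp add: nbrs_def)

lemma near_index:
  assumes "\<bar>x - real a\<bar> \<le> 1" "\<bar>x - of_int k\<bar> < 1"
  shows "int a - 1 \<le> k" "k \<le> int a + 1"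
proof -
  have "\<bar>of_int k - of_int (int a)\<bar> < (2::real)" using assms by simp
  then have "\<bar>k - int a\<bar> < 2" by linarith
  then show "int a - 1 \<le> k" "k \<le> int a + 1" by auto
qed

lemma nbrs_near:
  assumes "p \<in> patch N (gridpt N a b)" "l1 (scaled N k l p) < 1" "N \<ge> 1"
  shows "(k, l) \<in> nbrs a b"
proof -
  note P = patch_subset[OF assms(3,1)]
  have "\<bar>2 * real N * fst p - of_int (int k)\<bar> < 1" "\<bar>2 * real N * snd p - of_int (int l)\<bar> < 1"
    using assms(2) by (auto simp: scaled_sel)
  then have "int a - 1 \<le> int k" "int k \<le> int a + 1" "int b - 1 \<le> int l" "int l \<le> int b + 1"
    using near_index[OF P(1)] near_index[OF P(2)] by blast+
  then show ?thesis unfolding nbrs_def by auto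
qed

text \<open>Far from the boundary every generic point lies in the open diamond of an even vertex.\<close>

lemma deep_even:
  assumes N: "N \<ge> 1" and p: "p \<in> generic N" "p \<in> patch N (gridpt N a b)" and ab: "(a, b) \<in> inner_idx N 3"
  obtains k l where "(k, l) \<in> even_idx N" "l1 (scaled N k l p) < 1"
proof -
  note P = patch_subset[OF N p(2)]
  obtain k l :: int where kl: "even (k + l)" "\<bar>2 * real N * fst p - of_int k\<bar> + \<bar>2 * real N * snd p - of_int l\<bar> < 1"
  proof -
    have "2 * real N * fst p \<notin> \<int>" "2 * real N * snd p \<notin> \<int>" "2 * real N * fst p + 2 * real N * snd p \<notin> \<int>"
      "2 * real N * fst p - 2 * real N * snd p \<notin> \<int>"
      using p(1) by (simp_all add: generic_def off_mesh_def)
    from even_nbr[OF this] show ?thesis using that by blast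
  qed
  have "\<bar>2 * real N * fst p - of_int k\<bar> < 1" "\<bar>2 * real N * snd p - of_int l\<bar> < 1" using kl(2) by linarith+
  then have b: "int a - 1 \<le> k" "k \<le> int a + 1" "int b - 1 \<le> l" "l \<le> int b + 1"
    using near_index[OF P(1)] near_index[OF P(2)] by blast+
  have ab': "3 \<le> int a" "int a \<le> 2 * int N - 3" "3 \<le> int b" "int b \<le> 2 * int N - 3" using ab by auto
  have "0 \<le> k" "0 \<le> l" using b ab' by linarith+
  then obtain k' l' where kl': "k = int k'" "l = int l'" using nonneg_int_cases by metis
  show ?thesis
  proof (rule that)
    show "l1 (scaled N k' l' p) < 1" using kl(2) by (simp add: scaled_sel kl')
    have "even (k' + l')" using kl(1) unfolding kl' by (simp flip: of_nat_add)
    moreover have "1 \<le> k'" "k' \<le> 2 * N - 1" "1 \<le> l'" "l' \<le> 2 * N - 1" using b ab' unfolding kl' by linarith+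
    ultimately show "(k', l') \<in> even_idx N" by (simp add: even_idx_def)
  qed
qed

text \<open>A pointwise bound by profiles centred at the neighbouring vertices gives a bound for the patch: nine terms, each of
  which scales with the area of a cell.\<close>

lemma patch_integral_le:
  fixes F :: "real \<times> real \<Rightarrow> real"
  assumes N: "N \<ge> 1" and F: "F \<in> borel_measurable borel" "integrable lborel F" "\<And>u. 0 \<le> F u"
    and le: "\<And>p. p \<in> generic N \<Longrightarrow> p \<in> patch N (gridpt N a b) \<Longrightarrow> h p \<le> (\<Sum>(k, l)\<in>nbrs a b. F (scaled N k l p))"
  shows "(LINT p|lebesgue_on (patch N (gridpt N a b)). h p) \<le> 9 * (LINT u|lborel. F u) / (4 * (real N)\<^sup>2)"
proof -
  let ?P = "patch N (gridpt N a b)"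
  let ?S = "\<lambda>p. \<Sum>x\<in>nbrs a b. F (scaled N (fst x) (snd x) p)"
  have iF: "integrable lborel (\<lambda>p. F (scaled N k l p))" for k l by (rule lborel_integral_scaled(2)[OF N F(1,2)])
  have iS: "integrable lborel ?S" by (intro Bochner_Integration.integrable_sum iF)
  have mS: "?S \<in> borel_measurable lborel" using iS by auto
  have "(LINT p|lebesgue_on ?P. h p) = (LINT p|lebesgue. indicator ?P p * h p)"
    by (rule LINT_lebesgue_on[OF patch_closed_null(1)[OF N]])
  also have "\<dots> \<le> (LINT p|lebesgue. ?S p)"
  proof (rule integral_mono_AE')
    show "integrable lebesgue ?S" using iS integrable_completion[OF mS] by simp
    show "AE p in lebesgue. 0 \<le> ?S p" by (intro AE_I2 sum_nonneg F(3))
    show "AE p in lebesgue. indicator ?P p * h p \<le> ?S p"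
      using AE_generic[OF N]
    proof eventually_elim
      case (elim p)
      have "0 \<le> ?S p" by (intro sum_nonneg F(3))
      then show ?case using le[OF elim] by (auto simp: indicator_def split_beta)
    qed
  qed
  also have "\<dots> = (LINT p|lborel. ?S p)" by (rule integral_completion[OF mS])
  also have "\<dots> = (\<Sum>x\<in>nbrs a b. (LINT p|lborel. F (scaled N (fst x) (snd x) p)))"
    by (intro Bochner_Integration.integral_sum iF)
  also have "\<dots> = real (card (nbrs a b)) * ((LINT u|lborel. F u) / (4 * (real N)\<^sup>2))"
    by (simp add: lborel_integral_scaled(1)[OF N F(1)])
  also have "\<dots> \<le> 9 * ((LINT u|lborel. F u) / (4 * (real N)\<^sup>2))"
  proof (rule mult_right_mono)
    show "real (card (nbrs a b)) \<le> 9" using nbrs(2)[of a b] by simp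
    show "0 \<le> (LINT u|lborel. F u) / (4 * (real N)\<^sup>2)" using F(3) by (intro divide_nonneg_nonneg integral_nonneg_AE) auto
  qed
  finally show ?thesis by simp
qed

lemma err_l1_borel: "(\<lambda>u. err N (l1 u)) \<in> borel_measurable borel"
  by (rule measurable_compose[OF lip_borel[OF lip_l1] err_measurable])

text \<open>Patches away from the boundary: the sawtooth is compared with $x + y$.\<close>

lemma deep_patch_energy:
  assumes N: "N \<ge> 1" and ab: "(a, b) \<in> inner_idx N 3"
  shows "(LINT p|lebesgue_on (patch N (gridpt N a b)). coeff N p * (norm (grad_witness N p - (1, 1)))\<^sup>2) \<le> 603 / (real N)^3"
proof -
  have "(LINT p|lebesgue_on (patch N (gridpt N a b)). coeff N p * (norm (grad_witness N p - (1, 1)))\<^sup>2)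
      \<le> 9 * (LINT u|lborel. err N (l1 u)) / (4 * (real N)\<^sup>2)"
  proof (rule patch_integral_le[OF N err_l1_borel err_l1_integral(1)[OF N] err_nonneg])
    fix p assume p: "p \<in> generic N" "p \<in> patch N (gridpt N a b)"
    obtain k l where kl: "(k, l) \<in> even_idx N" "l1 (scaled N k l p) < 1" using deep_even[OF N p ab] by blast
    have "p \<in> Omega"
    proof -
      note P = patch_subset[OF N p(2)]
      have "0 < 2 * real N * fst p" "0 < 2 * real N * snd p" "2 * real N * fst p < 2 * real N" "2 * real N * snd p < 2 * real N"
        using P(1,2) ab by (auto simp: abs_le_iff)
      then show ?thesis using N by (simp add: Omega_def mem_Times_iff zero_less_mult_iff)
    qed
    then have "coeff N p * (norm (grad_witness N p - (1, 1)))\<^sup>2 \<le> err N (l1 (scaled N k l p))" by (rule coeff_grad_witness[OF N p(1) _ kl])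
    also have "\<dots> = (\<lambda>x. err N (l1 (scaled N (fst x) (snd x) p))) (k, l)" by simp
    also have "\<dots> \<le> (\<Sum>x\<in>nbrs a b. err N (l1 (scaled N (fst x) (snd x) p)))"
      by (rule member_le_sum[OF nbrs_near[OF p(2) kl(2) N]]) (auto intro: err_nonneg nbrs)
    finally show "coeff N p * (norm (grad_witness N p - (1, 1)))\<^sup>2 \<le> (\<Sum>(k, l)\<in>nbrs a b. err N (l1 (scaled N k l p)))"
      by (simp add: split_beta)
  qed
  also have "\<dots> \<le> 9 * (268 / real N) / (4 * (real N)\<^sup>2)"
    using err_l1_integral(2)[OF N] by (intro divide_right_mono mult_left_mono) auto
  also have "\<dots> = 603 / (real N)^3" by (simp add: power2_eq_square power3_eq_cube)
  finally show ?thesis .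
qed

text \<open>All patches: the sawtooth is compared with zero.\<close>

lemma patch_energy:
  assumes N: "N \<ge> 1"
  shows "(LINT p|lebesgue_on (patch N (gridpt N a b)). coeff N p * (norm (grad_witness N p))\<^sup>2) \<le> 1242 / (real N)\<^sup>2"
proof -
  let ?B = "box (-1::real, -1::real) (1, 1)"
  let ?F = "\<lambda>u. 2 * err N (l1 u) + 4 * indicator ?B u"
  have iB: "integrable lborel (indicator ?B :: real \<times> real \<Rightarrow> real)"
    by (rule integrable_real_indicator) (auto simp: emeasure_lborel_box_eq)
  have iF: "integrable lborel ?F" using err_l1_integral(1)[OF N] iB by simp
  have "(LINT p|lebesgue_on (patch N (gridpt N a b)). coeff N p * (norm (grad_witness N p))\<^sup>2)
      \<le> 9 * (LINT u|lborel. ?F u) / (4 * (real N)\<^sup>2)"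
  proof (rule patch_integral_le[OF N _ iF])
    show "?F \<in> borel_measurable borel" using borel_measurable_integrable[OF iF] by simp
    show nn: "0 \<le> ?F u" for u using err_nonneg[of N "l1 u"] by (simp add: indicator_def)
    fix p assume p: "p \<in> generic N" "p \<in> patch N (gridpt N a b)"
    have nnS: "0 \<le> (\<Sum>x\<in>nbrs a b. ?F (scaled N (fst x) (snd x) p))" by (intro sum_nonneg nn)
    show "coeff N p * (norm (grad_witness N p))\<^sup>2 \<le> (\<Sum>(k, l)\<in>nbrs a b. ?F (scaled N k l p))"
    proof (cases "p \<in> Omega \<and> (\<exists>(k, l)\<in>even_idx N. l1 (scaled N k l p) < 1)")
      case True
      then obtain k l where kl: "(k, l) \<in> even_idx N" "l1 (scaled N k l p) < 1" and pO: "p \<in> Omega" by blast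
      let ?g = "grad_witness N p"
      have "(norm ?g)\<^sup>2 \<le> 2 * (norm (?g - (1, 1)))\<^sup>2 + 4"
      proof -
        obtain x y where g: "?g = (x, y)" by (cases ?g)
        have "0 \<le> (x - 2)\<^sup>2" "0 \<le> (y - 2)\<^sup>2" by simp_all
        then show ?thesis unfolding g diff_Pair norm_pair_sq by (simp add: power2_eq_square algebra_simps)
      qed
      then have "coeff N p * (norm ?g)\<^sup>2 \<le> coeff N p * (2 * (norm (?g - (1, 1)))\<^sup>2 + 4)"
        using coeff_bounds(1)[OF N] by (rule mult_left_mono)
      also have "\<dots> \<le> 2 * (coeff N p * (norm (?g - (1, 1)))\<^sup>2) + 4"
        using coeff_bounds(2)[OF N, of p] by (simp add: algebra_simps)
      also have "\<dots> \<le> 2 * err N (l1 (scaled N k l p)) + 4" using coeff_grad_witness[OF N p(1) pO kl] by simp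
      also have "\<dots> = ?F (scaled N k l p)"
      proof -
        have "scaled N k l p \<in> ?B" using kl(2) by (cases "scaled N k l p") (auto simp: mem_box_rect)
        then show ?thesis by simp
      qed
      also have "\<dots> = (\<lambda>x. ?F (scaled N (fst x) (snd x) p)) (k, l)" by simp
      also have "\<dots> \<le> (\<Sum>x\<in>nbrs a b. ?F (scaled N (fst x) (snd x) p))"
        by (rule member_le_sum[OF nbrs_near[OF p(2) kl(2) N]]) (use nn nbrs in auto)
      finally show ?thesis by (simp add: split_beta)
    next
      case False
      have "grad_witness N p = 0"
      proof (cases "p \<in> Omega")
        case True
        then show ?thesis using False by (intro grad_witness_away[OF _ N]) force
      qed (rule grad_witness_outside[OF N])
      then show ?thesis using nnS by (simp add: split_beta)
    qed
  qed
  also have "\<dots> \<le> 9 * 552 / (4 * (real N)\<^sup>2)"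
  proof (intro divide_right_mono mult_left_mono)
    have "(LINT u|lborel. ?F u) = 2 * (LINT u|lborel. err N (l1 u)) + 4 * measure lborel ?B"
      using err_l1_integral(1)[OF N] iB by simp
    also have "measure lborel ?B = 4" by (simp add: measure_rect)
    also have "2 * (LINT u|lborel. err N (l1 u)) \<le> 2 * (268 / real N)" using err_l1_integral(2)[OF N] by simp
    also have "\<dots> \<le> 536" using N by (simp add: divide_le_eq)
    finally show "(LINT u|lborel. ?F u) \<le> 552" by simp
  qed auto
  also have "\<dots> = 1242 / (real N)\<^sup>2" by simp
  finally show ?thesis .
qed

subsection \<open>The global error\<close>

lemma card_even_idx:
  assumes N: "N \<ge> 1" shows "N\<^sup>2 \<le> card (even_idx N)"
proof -
  let ?f = "\<lambda>(i, j). (2 * i + 1, 2 * j + 1) :: nat \<times> nat"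
  have "inj_on ?f ({..<N} \<times> {..<N})" by (auto simp: inj_on_def)
  then have "card (?f ` ({..<N} \<times> {..<N})) = N\<^sup>2" by (simp add: card_image power2_eq_square)
  moreover have "?f ` ({..<N} \<times> {..<N}) \<subseteq> even_idx N" by (auto simp: even_idx_def)
  ultimately show ?thesis using card_mono[OF finite_even_idx] by metis
qed

lemma white_integral_witness:
  assumes N: "N \<ge> 1"
  shows "integrable lebesgue (\<lambda>p. indicator (white N) p * (grad_witness N p \<bullet> (1, 1)))"
    and "(LINT p|lebesgue. indicator (white N) p * (grad_witness N p \<bullet> (1, 1))) \<ge> 1 / 640"
proof -
  let ?W = "{u :: real \<times> real. 0 < fst u * snd u}"
  let ?F = "\<lambda>u. indicator ?W u * (grad_psi N u \<bullet> (1, 1))"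
  have "open ?W" by (intro open_Collect_less continuous_intros)
  then have W: "?W \<in> sets borel" by simp
  have Fm: "?F \<in> borel_measurable borel"
    unfolding white_grad_psi using W measurable_compose[OF lip_borel[OF lip_l1] flux_measurable]
    by (intro borel_measurable_times borel_measurable_indicator) auto
  have iF: "integrable lborel ?F"
    using white_flux[OF N] not_integrable_integral_eq[of lborel ?F] by fastforce
  let ?S = "\<lambda>p. \<Sum>x\<in>even_idx N. ?F (scaled N (fst x) (snd x) p)"
  have iS1: "integrable lborel (\<lambda>p. ?F (scaled N k l p))" for k l by (rule lborel_integral_scaled(2)[OF N Fm iF])
  have iS: "integrable lborel ?S" by (intro Bochner_Integration.integrable_sum iS1)
  have mS: "?S \<in> borel_measurable lborel" using iS by auto
  have iS': "integrable lebesgue ?S" using iS integrable_completion[OF mS] by simp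
  have m: "(\<lambda>p. indicator (white N) p * (grad_witness N p \<bullet> (1, 1))) \<in> borel_measurable lebesgue"
    using lip_grad_measurable[OF lip_grad_witness[OF N]] white_lebesgue
    by (intro borel_measurable_times borel_measurable_indicator borel_measurable_inner) auto
  have ae: "AE p in lebesgue. ?S p = indicator (white N) p * (grad_witness N p \<bullet> (1, 1))"
    using AE_generic[OF N]
  proof eventually_elim
    case (elim p)
    have "?F (scaled N k l p) = indicator (white N) p * (grad_psi N (scaled N k l p) \<bullet> (1, 1))" if kl: "(k, l) \<in> even_idx N" for k l
    proof (cases "l1 (scaled N k l p) < 1")
      case True
      have "scaled N k l p \<in> good N" using elim kl by (auto simp: generic_def)
      then show ?thesis using white_scaled[OF kl True] by (simp add: indicator_def)
    next
      case False
      then have "grad_psi N (scaled N k l p) = 0" using cut_bounds(2)[OF N] by (intro grad_psi_outside) linarith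
      then show ?thesis by simp
    qed
    then have "?S p = (\<Sum>x\<in>even_idx N. indicator (white N) p * (grad_psi N (scaled N (fst x) (snd x) p) \<bullet> (1, 1)))"
      by (intro sum.cong) auto
    also have "\<dots> = indicator (white N) p * (grad_witness N p \<bullet> (1, 1))"
      by (simp add: grad_witness_def split_beta inner_sum_left sum_distrib_left)
    finally show ?case .
  qed
  show "integrable lebesgue (\<lambda>p. indicator (white N) p * (grad_witness N p \<bullet> (1, 1)))"
    by (rule integrable_cong_AE_imp[OF iS' m]) (use ae in \<open>eventually_elim, simp\<close>)
  have "(LINT p|lebesgue. indicator (white N) p * (grad_witness N p \<bullet> (1, 1))) = (LINT p|lebesgue. ?S p)"
    by (rule integral_cong_AE[OF m borel_measurable_integrable[OF iS']]) (use ae in \<open>eventually_elim, simp\<close>)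
  also have "\<dots> = (LINT p|lborel. ?S p)" by (rule integral_completion[OF mS])
  also have "\<dots> = (\<Sum>x\<in>even_idx N. (LINT p|lborel. ?F (scaled N (fst x) (snd x) p)))"
    by (intro Bochner_Integration.integral_sum iS1)
  also have "\<dots> = (\<Sum>x\<in>even_idx N. (LINT u|lborel. ?F u) / (4 * (real N)\<^sup>2))"
    by (intro sum.cong refl lborel_integral_scaled(1)[OF N Fm])
  also have "\<dots> = real (card (even_idx N)) * ((LINT u|lborel. ?F u) / (4 * (real N)\<^sup>2))" by simp
  also have "\<dots> \<ge> (real N)\<^sup>2 * ((1 / 160) / (4 * (real N)\<^sup>2))"
  proof (intro mult_mono divide_right_mono white_flux[OF N])
    show "(real N)\<^sup>2 \<le> real (card (even_idx N))" using card_even_idx[OF N] by (metis of_nat_le_iff of_nat_power)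
  qed auto
  also have "(real N)\<^sup>2 * ((1 / 160) / (4 * (real N)\<^sup>2)) = 1 / 640" using N by simp
  finally show "(LINT p|lebesgue. indicator (white N) p * (grad_witness N p \<bullet> (1, 1))) \<ge> 1 / 640" .
qed

lemma hat_gradient_outside:
  assumes N: "N \<ge> 1" and kl: "(k, l) \<in> inner_idx N 1" and p: "p \<notin> closure Omega"
  shows "gradient (hat N k l) p = 0"
proof (rule gradient_eq_0)
  have *: "0 < x \<and> x < 1" if "\<bar>2 * real N * x - real m\<bar> < 1" "1 \<le> m" "m \<le> 2 * N - 1" for x m
  proof -
    have m: "1 \<le> real m" "real m + 1 \<le> 2 * real N" using that by linarith+
    have "0 < 2 * real N * x" "2 * real N * x < 2 * real N" using that(1) m by linarith+
    then show ?thesis using N by (simp add: zero_less_mult_iff)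
  qed
  have "{x. hat N k l x \<noteq> 0} \<subseteq> Omega"
  proof
    fix x assume "x \<in> {x. hat N k l x \<noteq> 0}"
    then have "hat N k l x \<noteq> 0" by simp
    note h = hat_support[OF this]
    show "x \<in> Omega" using *[OF h(1)] *[OF h(2)] kl by (auto simp: Omega_def mem_Times_iff)
  qed
  then show "p \<notin> closure {x. hat N k l x \<noteq> 0}" using p closure_mono by blast
qed

lemma white_integrable_hat:
  assumes N: "N \<ge> 1" and kl: "(k, l) \<in> inner_idx N 1"
  shows "integrable lebesgue (\<lambda>p. indicator (white N) p * (gradient (hat N k l) p \<bullet> b))"
proof -
  note L = lip_grad_hat[OF N, of k l]
  obtain M where M: "M \<ge> 0" "AE p in lebesgue. norm (gradient (hat N k l) p) \<le> M" using lip_grad_bounded[OF L] by blast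
  let ?f = "\<lambda>p. indicator (white N) p * (gradient (hat N k l) p \<bullet> b)"
  have m: "?f \<in> borel_measurable lebesgue"
    using lip_grad_measurable[OF L] white_lebesgue
    by (intro borel_measurable_times borel_measurable_indicator borel_measurable_inner) auto
  have "integrable lebesgue (\<lambda>p. indicator (closure Omega) p * ?f p)"
  proof (rule integrable_on_bounded[OF m, where B="M * norm b"])
    show "bounded (closure Omega)" by (rule bounded_closure[OF bounded_Omega])
    show "AE p in lebesgue. p \<in> closure Omega \<longrightarrow> \<bar>?f p\<bar> \<le> M * norm b"
      using M(2)
    proof eventually_elim
      case (elim p)
      have "\<bar>gradient (hat N k l) p \<bullet> b\<bar> \<le> M * norm b"
        using Cauchy_Schwarz_ineq2[of "gradient (hat N k l) p" b] mult_right_mono[OF elim, of "norm b"] by simp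
      moreover have "0 \<le> M * norm b" using M(1) by simp
      ultimately show ?case by (auto simp: indicator_def)
    qed
  qed simp
  moreover have "indicator (closure Omega) p * ?f p = ?f p" for p
    using hat_gradient_outside[OF N kl, of p] by (cases "p \<in> closure Omega") auto
  ultimately show ?thesis by simp
qed

text \<open>The lower bound uses $|G|^2 \ge 2\lambda\,(1,1)\cdot G - 2\lambda^2$ on the white squares. As the functional is at
  least $1/640$ and the area at most one, $\lambda = 1/1280$ is optimal and gives $1/819200$.\<close>

lemma global_error:
  assumes N: "N \<ge> 1" and v: "v \<in> S10 N" "v \<in> H10 Omega"
  shows "(energy_norm N Omega Omega (\<lambda>x. witness N x - v x))\<^sup>2 \<ge> 1 / 819200"
proof -
  let ?I = "inner_idx N 1"
  let ?c = "\<lambda>k l. v (gridpt N k l)"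
  have fI: "finite ?I" by simp
  define V where "V = nodal_sum N ?I ?c"
  define gV where "gV = (\<lambda>p. \<Sum>(k, l)\<in>?I. ?c k l *\<^sub>R gradient (hat N k l) p)"
  define G where "G = (\<lambda>p. grad_witness N p - gV p)"
  have LV: "lip_grad V gV" unfolding V_def gV_def by (rule lip_grad_nodal_sum[OF N fI])
  have LG: "lip_grad (\<lambda>x. witness N x - V x) G" unfolding G_def by (rule lip_grad_diff[OF lip_grad_witness[OF N] LV])
  have Om: "Omega \<in> sets lebesgue" using open_Omega by simp
  let ?h = "\<lambda>x p. ?c (fst x) (snd x) * (indicator (white N) p * (gradient (hat N (fst x) (snd x)) p \<bullet> (1, 1)))"
  have ih: "integrable lebesgue (?h x)" if "x \<in> ?I" for x
    by (intro integrable_mult_right white_integrable_hat[OF N]) (use that in auto)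
  have gV: "indicator (white N) p * (gV p \<bullet> (1, 1)) = (\<Sum>x\<in>?I. ?h x p)" for p
    by (simp add: gV_def split_beta inner_sum_left sum_distrib_left mult.left_commute)
  have iV: "integrable lebesgue (\<lambda>p. indicator (white N) p * (gV p \<bullet> (1, 1)))"
    unfolding gV by (intro Bochner_Integration.integrable_sum ih)
  have "(LINT p|lebesgue. indicator (white N) p * (gV p \<bullet> (1, 1))) = (\<Sum>x\<in>?I. LINT p|lebesgue. ?h x p)"
    unfolding gV by (intro Bochner_Integration.integral_sum ih)
  also have "\<dots> = 0" by (intro sum.neutral ballI) (simp add: white_integral_hat[OF N])
  finally have V0: "(LINT p|lebesgue. indicator (white N) p * (gV p \<bullet> (1, 1))) = 0" .
  have Geq: "indicator (white N) p * (G p \<bullet> (1, 1)) = indicator (white N) p * (grad_witness N p \<bullet> (1, 1)) - indicator (white N) p * (gV p \<bullet> (1, 1))" for p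
    by (simp add: G_def inner_diff_left right_diff_distrib)
  have iG: "integrable lebesgue (\<lambda>p. indicator (white N) p * (G p \<bullet> (1, 1)))"
    unfolding Geq by (intro Bochner_Integration.integrable_diff white_integral_witness(1)[OF N] iV)
  have "(LINT p|lebesgue. indicator (white N) p * (G p \<bullet> (1, 1)))
      = (LINT p|lebesgue. indicator (white N) p * (grad_witness N p \<bullet> (1, 1))) - (LINT p|lebesgue. indicator (white N) p * (gV p \<bullet> (1, 1)))"
    unfolding Geq by (intro Bochner_Integration.integral_diff white_integral_witness(1)[OF N] iV)
  then have IG: "(LINT p|lebesgue. indicator (white N) p * (G p \<bullet> (1, 1))) \<ge> 1 / 640"
    using V0 white_integral_witness(2)[OF N] by linarith
  have iO: "integrable lebesgue (\<lambda>x. indicator Omega x * (2 * (1 / 1280)\<^sup>2 :: real))"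
    by (rule integrable_on_bounded[OF _ Om bounded_Omega, where B="2 * (1 / 1280)\<^sup>2"]) auto
  have "(energy_norm N Omega Omega (\<lambda>x. witness N x - v x))\<^sup>2 = (LINT x|lebesgue_on Omega. coeff N x * (norm (G x))\<^sup>2)"
    by (rule energy_norm_lip_grad[OF N LG open_Omega Om])
      (use S10_H10_nodal_sum[OF N v] in \<open>auto simp: V_def\<close>)
  also have "\<dots> = (LINT x|lebesgue. indicator Omega x * (coeff N x * (norm (G x))\<^sup>2))"
    by (rule LINT_lebesgue_on[OF Om])
  also have "\<dots> \<ge> (LINT x|lebesgue. 1 / 640 * (indicator (white N) x * (G x \<bullet> (1, 1))) - indicator Omega x * (2 * (1 / 1280)\<^sup>2))"
  proof (rule integral_mono_AE)
    show "integrable lebesgue (\<lambda>x. 1 / 640 * (indicator (white N) x * (G x \<bullet> (1, 1))) - indicator Omega x * (2 * (1 / 1280)\<^sup>2))"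
      by (intro Bochner_Integration.integrable_diff integrable_mult_right iG iO)
    obtain M where M: "M \<ge> 0" "AE x in lebesgue. norm (G x) \<le> M" using lip_grad_bounded[OF LG] by blast
    show "integrable lebesgue (\<lambda>x. indicator Omega x * (coeff N x * (norm (G x))\<^sup>2))"
    proof (rule integrable_on_bounded[OF _ Om bounded_Omega, where B="1 * M\<^sup>2"])
      show "(\<lambda>x. coeff N x * (norm (G x))\<^sup>2) \<in> borel_measurable lebesgue"
        using coeff_measurable lip_grad_measurable[OF LG] by simp
      show "AE x in lebesgue. x \<in> Omega \<longrightarrow> \<bar>coeff N x * (norm (G x))\<^sup>2\<bar> \<le> 1 * M\<^sup>2"
        using M(2)
      proof eventually_elim
        case (elim x)
        have "coeff N x * (norm (G x))\<^sup>2 \<le> 1 * M\<^sup>2"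
          by (intro mult_mono coeff_bounds[OF N] power_mono elim) auto
        then show ?case using coeff_bounds(1)[OF N, of x] by simp
      qed
    qed
    have "convex Omega" unfolding Omega_def by (intro convex_Times) auto
    from negligible_convex_frontier[OF this] have "negligible (closure Omega - Omega)"
      using open_Omega by (simp add: frontier_def interior_open)
    then have "AE x in lebesgue. x \<notin> closure Omega - Omega" by (intro AE_not_in) (simp add: negligible_iff_null_sets)
    then show "AE x in lebesgue. 1 / 640 * (indicator (white N) x * (G x \<bullet> (1, 1))) - indicator Omega x * (2 * (1 / 1280)\<^sup>2)
        \<le> indicator Omega x * (coeff N x * (norm (G x))\<^sup>2)"
    proof eventually_elim
      case (elim x)
      show ?case
      proof (cases "x \<in> Omega")
        case True
        have nn: "0 \<le> coeff N x * (norm (G x))\<^sup>2" using coeff_bounds(1)[OF N] by simp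
        show ?thesis
        proof (cases "x \<in> white N")
          case W: True
          have "0 \<le> (norm (G x - (1 / 1280) *\<^sub>R (1, 1)))\<^sup>2" by simp
          also have "\<dots> = (norm (G x))\<^sup>2 - 1 / 640 * (G x \<bullet> (1, 1)) + 2 * (1 / 1280)\<^sup>2"
          proof -
            obtain a b where g: "G x = (a, b)" by (cases "G x")
            have d: "G x - (1 / 1280) *\<^sub>R (1, 1) = (a - 1 / 1280, b - 1 / 1280)" by (simp add: g)
            have i: "G x \<bullet> (1, 1) = a + b" by (simp add: g)
            show ?thesis unfolding d i unfolding g norm_pair_sq by (simp add: power2_eq_square algebra_simps)
          qed
          finally show ?thesis using True W coeff_white[OF N W] by simp
        next
          case False
          then show ?thesis using True nn by (simp add: order_trans[OF _ nn])
        qed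
      next
        case False
        then have "x \<notin> closure Omega" using elim by blast
        then have "gV x = 0" unfolding gV_def using hat_gradient_outside[OF N] by (intro sum.neutral) auto
        then have "G x = 0" using grad_witness_outside[OF N False] by (simp add: G_def)
        then show ?thesis using False by simp
      qed
    qed
  qed
  also have "(LINT x|lebesgue. 1 / 640 * (indicator (white N) x * (G x \<bullet> (1, 1))) - indicator Omega x * (2 * (1 / 1280)\<^sup>2))
      = 1 / 640 * (LINT x|lebesgue. indicator (white N) x * (G x \<bullet> (1, 1))) - (LINT x|lebesgue. indicator Omega x * (2 * (1 / 1280)\<^sup>2))"
    by (subst Bochner_Integration.integral_diff[OF integrable_mult_right[OF iG] iO]) (rule arg_cong2[where f="(-)"], rule integral_mult_right_zero, rule refl)
  also have "(LINT x|lebesgue. indicator Omega x * (2 * (1 / 1280)\<^sup>2 :: real)) = 2 * (1 / 1280)\<^sup>2"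
  proof -
    have "Omega = box (0, 0) (1, 1)" unfolding Omega_def by (auto simp: mem_box_rect)
    moreover have "measure lebesgue (box (0::real, 0::real) (1, 1)) = 1" by (simp add: measure_rect)
    ultimately have "measure lebesgue Omega = 1" by (simp only:)
    then show ?thesis using Om by simp
  qed
  also have "1 / 640 * (LINT x|lebesgue. indicator (white N) x * (G x \<bullet> (1, 1))) - 2 * (1 / 1280)\<^sup>2 \<ge> 1 / 640 * (1 / 640) - 2 * (1 / 1280)\<^sup>2"
    using IG by (intro diff_right_mono mult_left_mono) auto
  also have "1 / 640 * (1 / 640) - 2 * (1 / 1280)\<^sup>2 = (1 / 819200 :: real)" by (simp add: power2_eq_square)
  finally show ?thesis .
qed

subsection \<open>Conclusion\<close>

text \<open>Any global discrete function provides an upper bound for the local infimum; only its values on the patch count.\<close>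

lemma local_error_le:
  assumes N: "N \<ge> 1" and z: "z = gridpt N a b" and V: "lip_grad V g"
    and w: "w \<in> S10 N \<inter> H10 Omega" and eq: "\<And>x. x \<in> patch N z \<Longrightarrow> witness N x - w x = V x"
  shows "(INF v \<in> (\<lambda>v. restrict v (patch N z)) ` (S10 N \<inter> H10 Omega).
      (energy_norm N (interior (patch N z)) (patch N z) (\<lambda>x. witness N x - v x))\<^sup>2)
    \<le> (LINT p|lebesgue_on (patch N (gridpt N a b)). coeff N p * (norm (g p))\<^sup>2)"
proof -
  let ?P = "patch N z"
  have "(INF v \<in> (\<lambda>v. restrict v ?P) ` (S10 N \<inter> H10 Omega).
      (energy_norm N (interior ?P) ?P (\<lambda>x. witness N x - v x))\<^sup>2)
      \<le> (energy_norm N (interior ?P) ?P (\<lambda>x. witness N x - restrict w ?P x))\<^sup>2"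
  proof (rule cINF_lower)
    show "bdd_below ((\<lambda>v. (energy_norm N (interior ?P) ?P (\<lambda>x. witness N x - v x))\<^sup>2) ` (\<lambda>v. restrict v ?P) ` (S10 N \<inter> H10 Omega))"
      by (rule bdd_belowI[of _ 0]) auto
    show "restrict w ?P \<in> (\<lambda>v. restrict v ?P) ` (S10 N \<inter> H10 Omega)" using w by (rule imageI)
  qed
  also have "\<dots> = (LINT p|lebesgue_on ?P. coeff N p * (norm (g p))\<^sup>2)"
  proof (rule energy_norm_lip_grad[OF N V open_interior patch_closed_null[OF N]])
    fix x assume "x \<in> interior ?P"
    then have "x \<in> ?P" using interior_subset by blast
    then show "witness N x - restrict w ?P x = V x" using eq by simp
  qed
  finally show ?thesis by (simp add: z)
qed

lemma card_shallow: "card (inner_idx N 1 - inner_idx N 3) \<le> 16 * N"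
proof -
  let ?E = "{1, 2, 2 * N - 2, 2 * N - 1}"
  let ?R = "{1..2 * N - 1}"
  have "inner_idx N 1 - inner_idx N 3 \<subseteq> (?E \<times> ?R) \<union> (?R \<times> ?E)"
  proof
    fix x assume x: "x \<in> inner_idx N 1 - inner_idx N 3"
    obtain a b where ab: "x = (a, b)" by (cases x)
    have r: "a \<in> ?R" "b \<in> ?R" using x ab by auto
    have edge: "m \<in> ?E" if "m \<in> ?R" "m \<notin> {3..2 * N - 3}" for m
    proof -
      have "m = 1 \<or> m = 2 \<or> m = 2 * N - 2 \<or> m = 2 * N - 1" using that unfolding atLeastAtMost_iff by linarith
      then show ?thesis by blast
    qed
    have "a \<notin> {3..2 * N - 3} \<or> b \<notin> {3..2 * N - 3}" using x ab by blast
    then show "x \<in> (?E \<times> ?R) \<union> (?R \<times> ?E)" using edge r ab by blast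
  qed
  then have "card (inner_idx N 1 - inner_idx N 3) \<le> card ((?E \<times> ?R) \<union> (?R \<times> ?E))" by (rule card_mono[rotated]) simp
  also have "\<dots> \<le> card (?E \<times> ?R) + card (?R \<times> ?E)" by (rule card_Un_le)
  also have "\<dots> = 2 * (card ?E * card ?R)" by (simp only: card_cartesian_product mult.commute mult_2)
  also have "card ?E * card ?R \<le> 4 * (2 * N)"
  proof (rule mult_mono)
    show "card ?E \<le> 4" using card_length[of "[1, 2, 2 * N - 2, 2 * N - 1]"] by simp
  qed auto
  finally show ?thesis by simp
qed

theorem mainTheorem3:
  "\<exists>c C :: real. c > 0 \<and> C > 0 \<and>
     (\<forall>N::nat. N \<ge> 1 \<longrightarrow>
       (\<exists>U\<in>H10 Omega.
          (INF v \<in> S10 N \<inter> H10 Omega. (energy_norm N Omega Omega (\<lambda>x. U x - v x))\<^sup>2) \<ge> c \<and>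
          (\<Sum>z\<in>inner_vertices N.
             INF v \<in> (\<lambda>v. restrict v (patch N z)) ` (S10 N \<inter> H10 Omega).
               (energy_norm N (interior (patch N z)) (patch N z) (\<lambda>x. U x - v x))\<^sup>2)
            \<le> C / real N))"
proof (rule exI[of _ "1 / 819200"], rule exI[of _ "22284"], intro conjI allI impI)
  fix N :: nat assume N: "N \<ge> 1"
  let ?X = "S10 N \<inter> H10 Omega"
  let ?loc = "\<lambda>z. INF v \<in> (\<lambda>v. restrict v (patch N z)) ` ?X.
      (energy_norm N (interior (patch N z)) (patch N z) (\<lambda>x. witness N x - v x))\<^sup>2"
  have glob: "(INF v \<in> ?X. (energy_norm N Omega Omega (\<lambda>x. witness N x - v x))\<^sup>2) \<ge> 1 / 819200"
    by (rule cINF_greatest) (use zero_S10_H10[of N] global_error[OF N] in auto)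
  have shallow: "?loc (gridpt N a b) \<le> 1242 / (real N)\<^sup>2" for a b
  proof -
    have "?loc (gridpt N a b) \<le> (LINT p|lebesgue_on (patch N (gridpt N a b)). coeff N p * (norm (grad_witness N p))\<^sup>2)"
      by (rule local_error_le[OF N refl lip_grad_witness[OF N] zero_S10_H10]) simp
    then show ?thesis using patch_energy[OF N, of a b] by linarith
  qed
  have deep: "?loc (gridpt N a b) \<le> 603 / (real N)^3" if ab: "(a, b) \<in> inner_idx N 3" for a b
  proof -
    have "?loc (gridpt N a b) \<le> (LINT p|lebesgue_on (patch N (gridpt N a b)). coeff N p * (norm (grad_witness N p - (1, 1)))\<^sup>2)"
    proof (rule local_error_le[OF N refl lip_grad_diff[OF lip_grad_witness[OF N] lip_grad_inner]])
      show "deep_interp N \<in> ?X" using deep_interp_S10[OF N] deep_interp_H10[OF N] by blast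
      show "witness N x - deep_interp N x = witness N x - (1, 1) \<bullet> x" if "x \<in> patch N (gridpt N a b)" for x
        using deep_interp_patch[OF N ab that] by simp
    qed
    then show ?thesis using deep_patch_energy[OF N ab] by linarith
  qed
  let ?g = "\<lambda>(i, j). gridpt N i j"
  let ?D = "inner_vertices N \<inter> ?g ` inner_idx N 3"
  let ?S = "inner_vertices N - ?g ` inner_idx N 3"
  \<comment> \<open>At most $4N^2$ vertices are deep and at most $16N$ are not, whence $22284 = 4 \cdot 603 + 16 \cdot 1242$.\<close>
  have split: "(\<Sum>z\<in>inner_vertices N. ?loc z) = (\<Sum>z\<in>?D. ?loc z) + (\<Sum>z\<in>?S. ?loc z)"
    by (rule sum.Int_Diff[OF finite_inner_vertices])
  have D1: "(\<Sum>z\<in>?D. ?loc z) \<le> real (card ?D) * (603 / (real N)^3)"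
    by (rule sum_bounded_above) (use deep in auto)
  have D2: "real (card ?D) * (603 / (real N)^3) \<le> (4 * (real N)\<^sup>2) * (603 / (real N)^3)"
  proof (rule mult_right_mono)
    have "card ?D \<le> card (?g ` inner_idx N 3)" by (rule card_mono) auto
    also have "\<dots> \<le> card (inner_idx N 3)" by (rule card_image_le) simp
    also have "\<dots> \<le> (2 * N) * (2 * N)" unfolding card_cartesian_product by (intro mult_mono) auto
    finally have "real (card ?D) \<le> real ((2 * N) * (2 * N))" by (rule of_nat_mono)
    then show "real (card ?D) \<le> 4 * (real N)\<^sup>2" by (simp add: power2_eq_square)
  qed simp
  have S1: "(\<Sum>z\<in>?S. ?loc z) \<le> real (card ?S) * (1242 / (real N)\<^sup>2)"
    by (rule sum_bounded_above) (use shallow inner_vertices_subset[OF N] in auto)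
  have S2: "real (card ?S) * (1242 / (real N)\<^sup>2) \<le> (16 * real N) * (1242 / (real N)\<^sup>2)"
  proof (rule mult_right_mono)
    have "?S \<subseteq> ?g ` (inner_idx N 1 - inner_idx N 3)" using inner_vertices_subset[OF N] by blast
    then have "card ?S \<le> card (?g ` (inner_idx N 1 - inner_idx N 3))" by (rule card_mono[rotated]) simp
    also have "\<dots> \<le> card (inner_idx N 1 - inner_idx N 3)" by (rule card_image_le) simp
    also have "\<dots> \<le> 16 * N" by (rule card_shallow)
    finally show "real (card ?S) \<le> 16 * real N" by linarith
  qed simp
  have "(4 * (real N)\<^sup>2) * (603 / (real N)^3) + (16 * real N) * (1242 / (real N)\<^sup>2) = 22284 / real N"
    using N by (simp add: field_simps power2_eq_square power3_eq_cube)
  then have loc: "(\<Sum>z\<in>inner_vertices N. ?loc z) \<le> 22284 / real N"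
    unfolding split using D1 D2 S1 S2 by linarith
  show "\<exists>U\<in>H10 Omega.
          (INF v \<in> S10 N \<inter> H10 Omega. (energy_norm N Omega Omega (\<lambda>x. U x - v x))\<^sup>2) \<ge> 1 / 819200 \<and>
          (\<Sum>z\<in>inner_vertices N.
             INF v \<in> (\<lambda>v. restrict v (patch N z)) ` (S10 N \<inter> H10 Omega).
               (energy_norm N (interior (patch N z)) (patch N z) (\<lambda>x. U x - v x))\<^sup>2)
            \<le> 22284 / real N"
    using witness_H10[OF N] glob loc by blast
qed simp_all

end
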